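(* Let $(\mathbb P^\ell)_{\ell\in\mathbb N^*}$ be a sequence of probability measures on quadrangulations with boundary ($\mathbb P^\ell$ being supported on quadrangulations with boundary of semi-perimeter $\ell$) that satisfy the Markov property and are invariant under rerooting. Then there exists $0\le q\le q_c=1/12$ such that $\mathbb P^\ell$ is the Boltzmann probability measure with weight $q$. More precisely, for any quadrangulation with boundary $\mathfrak q$ of semi-perimeter $\ell$, $$\mathbb P^\ell(\mathfrak q)\propto q^{|F(\mathfrak q)|},$$ where $|F(\mathfrak q)|$ is the number of internal faces of $\mathfrak q$.
   Context: A planar map is a finite connected graph properly embedded in the sphere with a distinguished oriented edge (the root edge). Each edge consists of two semi-edges, one per side. The root face is the face to the right of the root edge; its degree is the perimeter. A quadrangulation with boundary is a planar map in which all faces, except possibly the root face, are surrounded by 4 semi-edges; the faces other than the root face are called internal. A quadrangulation with holes is a planar map with boundary which has distinguished faces, called holes, which need not be squares, each one with a marked oriented edge, all non-distinguished interior faces being surrounded by 4 semi-edges. $H(\mathfrak q)$ is the set of holes of $\mathfrak q$ and $\mathrm{Per}(h)$ is the degree of the hole $h$. Gluing: given $\mathfrak q$ with holes and, for each $h\in H(\mathfrak q)$, a map $\mathfrak u_h$ (possibly with holes) of perimeter $\mathrm{Per}(h)$, the map $\mathfrak q\odot(\mathfrak u_h)_{h}$ is obtained by identifying, for each $h$, the root edge of $\mathfrak u_h$ with the marked edge of $h$ and then, following the orientation, the edges of the boundary of $\mathfrak u_h$ with the edges of $h$; it keeps the root and boundary of $\mathfrak q$. Write $\mathfrak q\subset\mathfrak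 p$ if $\mathfrak p=\mathfrak q\odot(\mathfrak u_h)_h$ for some collection $(\mathfrak u_h)_h$, which is then uniquely defined and denoted $(\mathfrak p^{\mathfrak q}_h)_h$. Markov property: $(\mathbb P^\ell)_{\ell\in\mathbb N^*}$ satisfies the Markov property if for any deterministic quadrangulation with holes $\mathfrak q$, $\mathfrak Q\sim\mathbb P^\ell$ conditioned on the event $\{\mathfrak q\subset\mathfrak Q\}$ decomposes as $\mathfrak Q=\mathfrak q\odot(\mathfrak Q^{\mathfrak q}_h)_h$, where the collection $\mathfrak Q^{\mathfrak q}_h\sim\mathbb P^{\mathrm{Per}(h)/2}$ is independent and independent of $\mathfrak q$. Invariance under rerooting: for any deterministic rooted quadrangulation $\mathfrak q_1$ and any copy $\mathfrak q_2$ of $\mathfrak q_1$ differing only in the position of the root edge (rerooting preserves the number of faces and the semi-perimeter), $\mathbb P^\ell(\mathfrak Q=\mathfrak q_1)=\mathbb P^\ell(\mathfrak Q=\mathfrak q_2)$. *)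

theory Defs
  imports "HOL-Probability.Probability" "HOL-Combinatorics.Orbits"
begin

text \<open>
  A finite graph embedded in an oriented surface is encoded by its rotation system. The darts are
  the semi-edges; a dart is identified with the edge oriented so that this semi-edge is on its
  right-hand side. \<open>opp d\<close> is the other semi-edge of the same edge (the reversed oriented edge), and
  \<open>nxt d\<close> is the dart that follows \<open>d\<close> along the face to the right of \<open>d\<close>. Hence the faces are the
  cycles of \<open>nxt\<close>, the darts leaving a given vertex form a cycle of \<open>nxt \<circ> opp\<close>, and the degree of a
  face is the size of the cycle. Values of \<open>opp\<close> and \<open>nxt\<close> outside \<open>darts\<close> are irrelevant.
\<close>

record 'd rmap =
  darts :: "'d set"
  opp :: "'d \<Rightarrow> 'd"
  nxt :: "'d \<Rightarrow> 'd"
  root_dart :: 'd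

definition face_at :: "('d, 'x) rmap_scheme \<Rightarrow> 'd \<Rightarrow> 'd set" where
  "face_at m d = orbit (nxt m) d"

definition vertex_at :: "('d, 'x) rmap_scheme \<Rightarrow> 'd \<Rightarrow> 'd set" where
  "vertex_at m d = orbit (nxt m \<circ> opp m) d"

definition map_faces :: "('d, 'x) rmap_scheme \<Rightarrow> 'd set set" where
  "map_faces m = face_at m ` darts m"

definition map_vertices :: "('d, 'x) rmap_scheme \<Rightarrow> 'd set set" where
  "map_vertices m = vertex_at m ` darts m"

definition map_edges :: "('d, 'x) rmap_scheme \<Rightarrow> 'd set set" where
  "map_edges m = (\<lambda>d. {d, opp m d}) ` darts m"

definition map_connected :: "('d, 'x) rmap_scheme \<Rightarrow> bool" where
  "map_connected m \<longleftrightarrow>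
     (\<forall>d\<in>darts m. \<forall>e\<in>darts m.
        (d, e) \<in> {(x, y). x \<in> darts m \<and> (y = opp m x \<or> y = nxt m x)}\<^sup>*)"

text \<open>Being embedded in the sphere is Euler's relation \<open>V - E + F = 2\<close>.\<close>

definition planar_map :: "('d, 'x) rmap_scheme \<Rightarrow> bool" where
  "planar_map m \<longleftrightarrow>
     finite (darts m) \<and> root_dart m \<in> darts m \<and>
     (\<forall>d\<in>darts m. opp m d \<in> darts m \<and> opp m d \<noteq> d \<and> opp m (opp m d) = d) \<and>
     bij_betw (nxt m) (darts m) (darts m) \<and>
     map_connected m \<and>
     card (map_vertices m) + card (map_faces m) = card (map_edges m) + 2"

definition root_face :: "('d, 'x) rmap_scheme \<Rightarrow> 'd set" where
  "root_face m = face_at m (root_dart m)"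

definition perimeter :: "('d, 'x) rmap_scheme \<Rightarrow> nat" where
  "perimeter m = card (root_face m)"

definition internal_faces :: "('d, 'x) rmap_scheme \<Rightarrow> 'd set set" where
  "internal_faces m = map_faces m - {root_face m}"

definition quadrangulation :: "('d, 'x) rmap_scheme \<Rightarrow> bool" where
  "quadrangulation m \<longleftrightarrow> planar_map m \<and> (\<forall>f\<in>internal_faces m. card f = 4)"

text \<open>
  Maps are considered up to root-preserving isomorphism. A class is represented by the set of its
  representatives whose darts are natural numbers; every finite map has such a representative.
\<close>

definition rmap_iso :: "'a rmap \<Rightarrow> 'b rmap \<Rightarrow> bool" where
  "rmap_iso m m' \<longleftrightarrow>
     (\<exists>f. bij_betw f (darts m) (darts m') \<and> f (root_dart m) = root_dart m' \<and>
          (\<forall>d\<in>darts m. f (opp m d) = opp m' (f d) \<and> f (nxt m d) = nxt m' (f d)))"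

type_synonym map_class = "nat rmap set"

definition iso_class :: "'d rmap \<Rightarrow> map_class" where
  "iso_class m = {m' :: nat rmap. rmap_iso m m'}"

definition quadrangulations :: "nat \<Rightarrow> map_class set" where
  "quadrangulations l =
     {iso_class m | m :: nat rmap. quadrangulation m \<and> perimeter m = 2 * l}"

text \<open>
  Holes. The set \<open>marks\<close> contains exactly one dart of each hole, namely the hole-side semi-edge of
  the marked edge. As an oriented edge, the marked edge of the hole of \<open>h\<close> is \<open>opp h\<close>: it has the
  hole on its left, just as the root edge of a map has the rest of that map on its left.
\<close>

record 'd hmap = "'d rmap" +
  marks :: "'d set"

definition hole_darts :: "'d hmap \<Rightarrow> 'd set" where
  "hole_darts q = (\<Union>h\<in>marks q. face_at q h)"

text \<open>
  Injectivity of \<open>vertex_at\<close> on \<open>hole_darts\<close> says that the holes are bounded by simple cycles which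
  are pairwise vertex-disjoint. Without it the gluing below need not be a planar map, and the
  collection filling the holes need not be determined by the glued map. No such condition is
  imposed on the root face, nor on the contact between the holes and the root face.
\<close>

definition quad_with_holes :: "'d hmap \<Rightarrow> bool" where
  "quad_with_holes q \<longleftrightarrow>
     planar_map q \<and> marks q \<subseteq> darts q \<and>
     inj_on (face_at q) (marks q) \<and> root_face q \<notin> face_at q ` marks q \<and>
     inj_on (vertex_at q) (hole_darts q) \<and>
     (\<forall>f\<in>internal_faces q - face_at q ` marks q. card f = 4)"

text \<open>
  The hole \<open>h\<close> and the root face of \<open>u h\<close> are identified along their boundaries with opposite
  orientations: \<open>h\<close> with the root dart of \<open>u h\<close>, and then backwards along the hole while moving
  forwards along the root face. If \<open>a\<close> lies on the \<open>f\<close>-cycle of \<open>x\<close>, then \<open>cross f x g y a\<close> is its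
  partner on the \<open>g\<close>-cycle of \<open>y\<close>, where \<open>x\<close> is the partner of \<open>y\<close>.
\<close>

definition cross :: "('a \<Rightarrow> 'a) \<Rightarrow> 'a \<Rightarrow> ('b \<Rightarrow> 'b) \<Rightarrow> 'b \<Rightarrow> 'a \<Rightarrow> 'b" where
  "cross f x g y a = (g ^^ (LEAST k. (f ^^ k) a = x)) y"

definition hole_mark :: "'d hmap \<Rightarrow> 'd \<Rightarrow> 'd" where
  "hole_mark q a = (THE h. h \<in> marks q \<and> a \<in> face_at q h)"

text \<open>
  The hole darts of \<open>q\<close> and the root-face darts of the maps \<open>u h\<close> disappear. The opposite of a
  surviving dart is found by crossing the identified boundary; when both sides of an edge of \<open>u h\<close>
  belong to its root face, one crosses back into \<open>q\<close> and two boundary edges of the hole get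
  identified with each other.
\<close>

definition leave :: "'a hmap \<Rightarrow> ('a \<Rightarrow> 'b rmap) \<Rightarrow> 'a \<Rightarrow> 'b \<Rightarrow> 'a + 'a \<times> 'b" where
  "leave q u h b =
     (if b \<in> root_face (u h)
      then Inl (opp q (cross (nxt (u h)) (root_dart (u h)) (nxt q) h b))
      else Inr (h, b))"

definition glue :: "'a hmap \<Rightarrow> ('a \<Rightarrow> 'b rmap) \<Rightarrow> ('a + 'a \<times> 'b) rmap" where
  "glue q u =
     \<lparr> darts = Inl ` (darts q - hole_darts q) \<union>
               (\<Union>h\<in>marks q. Inr ` ({h} \<times> (darts (u h) - root_face (u h)))),
       opp = (\<lambda>e. case e of
           Inl d \<Rightarrow>
             (let a = opp q d; h = hole_mark q a in
              if a \<in> hole_darts q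
              then leave q u h (opp (u h) (cross (nxt q) h (nxt (u h)) (root_dart (u h)) a))
              else Inl a)
         | Inr (h, b) \<Rightarrow> leave q u h (opp (u h) b)),
       nxt = (\<lambda>e. case e of Inl d \<Rightarrow> Inl (nxt q d) | Inr (h, b) \<Rightarrow> Inr (h, nxt (u h) b)),
       root_dart = Inl (root_dart q) \<rparr>"

definition hole_per :: "'a hmap \<Rightarrow> 'a \<Rightarrow> nat" where
  "hole_per q h = card (face_at q h)"

definition fillings :: "nat hmap \<Rightarrow> (nat \<Rightarrow> nat rmap) set" where
  "fillings q = {u. \<forall>h\<in>marks q. planar_map (u h) \<and> perimeter (u h) = hole_per q h}"

text \<open>The maps \<open>p\<close> with \<open>q \<subset> p\<close>.\<close>

definition maps_containing :: "nat hmap \<Rightarrow> map_class set" where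
  "maps_containing q = {iso_class (glue q u) | u. u \<in> fillings q}"

text \<open>
  The conditional law of the collection of fillings is written out as a product mass function: the
  event that the collection equals \<open>(u h)\<^sub>h\<close> is the event that the map equals \<open>glue q u\<close>. The random
  map is almost surely a quadrangulation, hence has even face degrees, so the truncated division
  only ever acts on even numbers here.
\<close>

definition markov_property :: "(nat \<Rightarrow> map_class pmf) \<Rightarrow> bool" where
  "markov_property P \<longleftrightarrow>
     (\<forall>l\<ge>1. \<forall>q. quad_with_holes q \<and> set_pmf (P l) \<inter> maps_containing q \<noteq> {} \<longrightarrow>
        (\<forall>u\<in>fillings q.
           pmf (cond_pmf (P l) (maps_containing q)) (iso_class (glue q u)) =
             (\<Prod>h\<in>marks q. pmf (P (hole_per q h div 2)) (iso_class (u h)))))"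

text \<open>
  The root may be moved to any oriented edge such that the rerooted map is again a quadrangulation
  with boundary of the same semi-perimeter. The root face itself can only change if \<open>l = 2\<close>.
\<close>

definition reroot_invariant :: "(nat \<Rightarrow> map_class pmf) \<Rightarrow> bool" where
  "reroot_invariant P \<longleftrightarrow>
     (\<forall>l\<ge>1. \<forall>m :: nat rmap. \<forall>r\<in>darts m.
        quadrangulation m \<and> perimeter m = 2 * l \<and>
        quadrangulation (m\<lparr>root_dart := r\<rparr>) \<and> perimeter (m\<lparr>root_dart := r\<rparr>) = 2 * l \<longrightarrow>
        pmf (P l) (iso_class m) = pmf (P l) (iso_class (m\<lparr>root_dart := r\<rparr>)))"

text \<open>Here \<open>q = 0\<close> is allowed, with \<open>0 ^ 0 = 1\<close>: only maps without internal faces have mass.\<close>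

definition boltzmann :: "real \<Rightarrow> nat \<Rightarrow> map_class pmf \<Rightarrow> bool" where
  "boltzmann q l M \<longleftrightarrow>
     set_pmf M \<subseteq> quadrangulations l \<and>
     (\<exists>c>0. \<forall>m :: nat rmap. quadrangulation m \<and> perimeter m = 2 * l \<longrightarrow>
        pmf M (iso_class m) = c * q ^ card (internal_faces m))"

end

theory Submission
  imports Defs "HOL-Complex_Analysis.Complex_Analysis"
begin

text \<open>
  Deleting a root edge that separates the root face from a square, respectively a pendant root edge,
  inverts the gluing of a map into a fixed map with one hole. By the Markov property the mass of a map
  with semi-perimeter \<open>l\<close> is then the mass of the smaller map times a factor that depends only on \<open>l\<close>.
  Rerooting makes one of the two moves available in every map with more than one edge: squares are
  removed until a tree remains, then leaves. Hence all trees with \<open>l\<close> edges have the same mass \<open>c l\<close>,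
  and the mass of any map is a product of factors times some \<open>c (l + n)\<close>, so that \<open>c l > 0\<close>. A map with
  one square and a leaf can be reduced in two ways, which forces the factor of a square to be
  \<open>q * c l / c (l + 1)\<close> with \<open>q\<close> independent of \<open>l\<close>; this gives the Boltzmann form.

  For \<open>q \<le> 1 / 12\<close>, splitting along a bridge as well shows that \<open>W l = 1 / c l\<close> (with \<open>c 0 = 1\<close>)
  satisfies Tutte's recursion as an inequality. Its least solution has a generating function \<open>f\<close> for which
  \<open>(q - z + 2 z\<^sup>2 f)\<^sup>2\<close> is a cubic polynomial in \<open>z\<close>, and for \<open>q > 1 / 12\<close> no power series with
  nonnegative coefficients can have this property.
\<close>

section \<open>Cycles of permutations\<close>

text \<open>Maps are never enumerated. For Boltzmann laws \<open>1 / c l\<close> is the partition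
  function, since a tree has weight 1; here its recursion comes from probabilities alone. The far
  side of the root edge belongs to a square, or the root edge is a bridge cutting off
  semi-perimeters \<open>i\<close> and \<open>k - i\<close>. These events are told apart by the
  place of the opposite of the root dart along the root face, which gluing preserves. Being
  disjoint, they have total probability at most 1, and division by \<open>c (k + 1)\<close> gives
  the inequality. The value 1/12 comes from a discriminant: in the variable s = 1/x, the quotient of
  the cubic by \<open>x ^ 3\<close> has derivative 3 q^2 s^2 - 4 q s + 1 + 4 q, whose discriminant
  is 4 q^2 (1 - 12 q). The combinatorial obstacle is that the Markov property speaks of glued maps,
  whose edges are found by crossing identified boundaries. The maps with holes are therefore
  numbered along their boundaries in the order in which a filling is walked, so that the isomorphism
  undoing a deletion can be written down.\<close>

lemma funpow_in:
  assumes "f ` D \<subseteq> D" "x \<in> D"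
  shows "(f ^^ n) x \<in> D"
  using assms by (induction n) auto

lemma funpow_inj:
  assumes "bij_betw f D D" "x \<in> D" "y \<in> D" "(f ^^ n) x = (f ^^ n) y"
  shows "x = y"
proof -
  have "bij_betw (f ^^ n) D D"
    using assms(1) by (rule bij_betw_funpow)
  then show ?thesis
    using assms by (auto simp: bij_betw_def inj_on_def)
qed

lemma orbit_subset_carrier:
  assumes "f ` D \<subseteq> D" "x \<in> D"
  shows "orbit f x \<subseteq> D"
  using funpow_in[OF assms] by (auto simp: orbit_altdef)

text \<open>\<open>orbit f x\<close> starts at \<open>f x\<close>, so membership of \<open>x\<close>
  is a finiteness fact: two iterates coincide, and injectivity cancels their common number of
  steps.\<close>

lemma mem_orbit_self:
  assumes "finite D" "bij_betw f D D" "x \<in> D"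
  shows "x \<in> orbit f x"
proof -
  have img: "f ` D \<subseteq> D" using assms by (auto simp: bij_betw_def)
  have "finite ((\<lambda>n. (f ^^ n) x) ` UNIV)"
    by (rule finite_subset[OF _ assms(1)]) (use funpow_in[OF img assms(3)] in auto)
  then have "\<not> inj (\<lambda>n. (f ^^ n) x)"
    using finite_imageD infinite_UNIV_nat by blast
  then obtain i j where ij: "i < j" "(f ^^ i) x = (f ^^ j) x"
    unfolding inj_on_def by (metis nat_neq_iff)
  have "(f ^^ i) ((f ^^ (j - i)) x) = (f ^^ i) x"
    using ij by (metis add_diff_inverse_nat funpow_add less_imp_not_less o_apply)
  then have "(f ^^ (j - i)) x = x"
    using funpow_inj[OF assms(2)] funpow_in[OF img assms(3)] assms(3) by blast
  then show ?thesis
    unfolding orbit_altdef using ij(1)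
    by (metis (mono_tags, lifting) CollectI zero_less_diff)
qed

lemma orbit_eq_of_mem:
  assumes "finite D" "bij_betw f D D" "x \<in> D" "y \<in> orbit f x"
  shows "orbit f y = orbit f x"
proof -
  have s: "x \<in> orbit f x" using assms mem_orbit_self by metis
  have "x \<in> orbit f y" using orbit_swap[OF s assms(4)] .
  show ?thesis
  proof (intro set_eqI iffI)
    show "z \<in> orbit f x" if "z \<in> orbit f y" for z using orbit_trans[OF that assms(4)] .
    show "z \<in> orbit f y" if "z \<in> orbit f x" for z using orbit_trans[OF that \<open>x \<in> orbit f y\<close>] .
  qed
qed

lemma funpow_mem_orbit:
  assumes "finite D" "bij_betw f D D" "x \<in> D"
  shows "(f ^^ n) x \<in> orbit f x"
  using funpow_in_orbit[OF mem_orbit_self[OF assms]] .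

lemma funpow_orbit_period:
  assumes "finite D" "bij_betw f D D" "x \<in> D"
  shows "0 < card (orbit f x)"
    and "(f ^^ i) x = (f ^^ j) x \<longleftrightarrow> i mod card (orbit f x) = j mod card (orbit f x)"
    and "orbit f x = (\<lambda>i. (f ^^ i) x) ` {..<card (orbit f x)}"
proof -
  have s: "x \<in> orbit f x" using assms mem_orbit_self by metis
  define n where "n = (LEAST n. 0 < n \<and> (f ^^ n) x = x)"
  have "\<exists>n. 0 < n \<and> (f ^^ n) x = x"
    using s by (auto simp: orbit_altdef)
  then have n: "0 < n" "(f ^^ n) x = x"
    using LeastI_ex[of "\<lambda>n. 0 < n \<and> (f ^^ n) x = x"] unfolding n_def by auto
  have least: "\<not> (0 < m \<and> (f ^^ m) x = x)" if "m < n" for m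
    using that unfolding n_def by (rule not_less_Least)
  have img: "f ` D \<subseteq> D" using assms by (auto simp: bij_betw_def)
  have red: "(f ^^ i) x = (f ^^ (i mod n)) x" for i
    using n(2) by (simp add: funpow_mod_eq)
  have inj: "inj_on (\<lambda>i. (f ^^ i) x) {..<n}"
  proof (rule linorder_inj_onI)
    fix i j assume ij: "i < j" "i \<in> {..<n}" "j \<in> {..<n}"
    show "(f ^^ i) x \<noteq> (f ^^ j) x"
    proof
      assume eq: "(f ^^ i) x = (f ^^ j) x"
      have "(f ^^ i) ((f ^^ (j - i)) x) = (f ^^ i) x"
        using ij eq by (metis add_diff_inverse_nat funpow_add less_imp_not_less o_apply)
      then have "(f ^^ (j - i)) x = x"
        using funpow_inj[OF assms(2)] funpow_in[OF img assms(3)] assms(3) by blast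
      then show False using least[of "j - i"] ij(1) ij(3) less_imp_diff_less by auto
    qed
  qed auto
  have orb: "orbit f x = (\<lambda>i. (f ^^ i) x) ` {..<n}"
    using orbit_altdef_bounded[OF n(2,1)] by auto
  have card: "card (orbit f x) = n"
    unfolding orb using inj by (simp add: card_image)
  show "0 < card (orbit f x)" using card n by simp
  show "orbit f x = (\<lambda>i. (f ^^ i) x) ` {..<card (orbit f x)}" using card orb by simp
  show "(f ^^ i) x = (f ^^ j) x \<longleftrightarrow> i mod card (orbit f x) = j mod card (orbit f x)"
    unfolding card
    using inj red[of i] red[of j] n(1) by (auto simp: inj_on_def)
qed

text \<open>Two points with equal labels both reach the representative of that label, hence lie on
  one cycle. For an explicit permutation this turns counting cycles into counting labels.\<close>

lemma orbits_by_label: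
  assumes "finite D" "f ` D \<subseteq> D" "inj_on f D"
    and inv: "\<And>x. x \<in> D \<Longrightarrow> v (f x) = v x"
    and reach: "\<And>x. x \<in> D \<Longrightarrow> \<exists>k. (f ^^ k) x = rep (v x)"
  shows "x \<in> D \<Longrightarrow> orbit f x = {y \<in> D. v y = v x}"
    and "card (orbit f ` D) = card (v ` D)"
proof -
  have bij: "bij_betw f D D"
    using assms by (simp add: bij_betw_def endo_inj_surj)
  have pv: "v ((f ^^ k) x) = v x \<and> (f ^^ k) x \<in> D" if "x \<in> D" for x k
    using that inv assms(2) by (induction k) auto
  have main: "orbit f x = {y \<in> D. v y = v x}" if x: "x \<in> D" for x
  proof (intro set_eqI iffI)
    fix y assume "y \<in> orbit f x"
    then show "y \<in> {y \<in> D. v y = v x}"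
      using pv[OF x] by (auto simp: orbit_altdef)
  next
    fix y assume y: "y \<in> {y \<in> D. v y = v x}"
    have yD: "y \<in> D" "v y = v x" using y by auto
    obtain k j where kj: "(f ^^ k) x = rep (v x)" "(f ^^ j) y = rep (v x)"
      using reach[OF x] reach[OF yD(1)] yD(2) by auto
    have "orbit f x = orbit f (rep (v x))" "orbit f y = orbit f (rep (v x))"
      using orbit_eq_of_mem[OF assms(1) bij x funpow_mem_orbit[OF assms(1) bij x, of k]]
        orbit_eq_of_mem[OF assms(1) bij yD(1) funpow_mem_orbit[OF assms(1) bij yD(1), of j]] kj
      by simp_all
    then have "orbit f x = orbit f y" by simp
    then show "y \<in> orbit f x" using mem_orbit_self[OF assms(1) bij] y by auto
  qed
  show "orbit f x = {y \<in> D. v y = v x}" if x: "x \<in> D" for x using main[OF x] .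
  have "orbit f ` D = (\<lambda>l. {y \<in> D. v y = l}) ` (v ` D)"
    using main by (auto simp: image_iff)
  moreover have "inj_on (\<lambda>l. {y \<in> D. v y = l}) (v ` D)"
    by (auto simp: inj_on_def)
  ultimately show "card (orbit f ` D) = card (v ` D)"
    by (simp add: card_image)
qed

text \<open>The first-return permutation of \<open>f\<close> to the complement of \<open>a\<close>.
  It describes the rotation around vertices after a dart has been deleted.\<close>

definition skip :: "('a \<Rightarrow> 'a) \<Rightarrow> 'a \<Rightarrow> 'a \<Rightarrow> 'a" where
  "skip f a d = (if f d = a then f a else f d)"

lemma skip_bij:
  assumes "finite D" "bij_betw f D D" "a \<in> D" "f a \<noteq> a"
  shows "bij_betw (skip f a) (D - {a}) (D - {a})"
proof -
  have inj: "inj_on f D" and img: "f ` D = D" using assms by (auto simp: bij_betw_def)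
  have 1: "skip f a ` (D - {a}) \<subseteq> D - {a}"
    using assms(3,4) img by (auto simp: skip_def)
  have 2: "inj_on (skip f a) (D - {a})"
    using inj assms(3) by (auto simp: skip_def inj_on_def)
  show ?thesis using 1 2 assms(1) by (simp add: bij_betw_def endo_inj_surj)
qed

lemma skip_orbit:
  assumes "finite D" "bij_betw f D D" "a \<in> D" "f a \<noteq> a" "x \<in> D - {a}"
  shows "orbit (skip f a) x = orbit f x - {a}"
proof
  note b = skip_bij[OF assms(1-4)]
  show "orbit (skip f a) x \<subseteq> orbit f x - {a}"
  proof
    fix y assume y: "y \<in> orbit (skip f a) x"
    have "y \<noteq> a" using orbit_subset_carrier[of "skip f a" "D - {a}" x] b assms(5) y
      by (auto simp: bij_betw_def)
    moreover have "y \<in> orbit f x" using y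
    proof induction
      case base
      have "f x \<in> orbit f x" "f (f x) \<in> orbit f x"
        by (rule orbit.base, rule orbit.step[OF orbit.base])
      then show ?case by (auto simp: skip_def)
    next
      case (step y)
      have "f y \<in> orbit f x" "f (f y) \<in> orbit f x"
        by (rule orbit.step[OF step.IH], rule orbit.step[OF orbit.step[OF step.IH]])
      then show ?case by (auto simp: skip_def)
    qed
    ultimately show "y \<in> orbit f x - {a}" by simp
  qed
  show "orbit f x - {a} \<subseteq> orbit (skip f a) x"
  proof
    fix y assume "y \<in> orbit f x - {a}"
    then have y: "y \<in> orbit f x" "y \<noteq> a" by auto
    from y(1) have "(y \<noteq> a \<longrightarrow> y \<in> orbit (skip f a) x) \<and> (y = a \<longrightarrow> f a \<in> orbit (skip f a) x)"
    proof induction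
      case base
      have "skip f a x \<in> orbit (skip f a) x" by (rule orbit.base)
      moreover have "skip f a x = (if f x = a then f a else f x)" by (simp add: skip_def)
      ultimately show ?case by (cases "f x = a") simp_all
    next
      case (step y)
      show ?case
      proof (cases "y = a")
        case True
        then show ?thesis using step.IH assms(4) by simp
      next
        case False
        then have "skip f a y \<in> orbit (skip f a) x" using step.IH by (auto intro: orbit.step)
        moreover have "skip f a y = (if f y = a then f a else f y)" by (simp add: skip_def)
        ultimately show ?thesis by (cases "f y = a") simp_all
      qed
    qed
    then show "y \<in> orbit (skip f a) x" using y by auto
  qed
qed

text \<open>Erasing \<open>a\<close> empties no cycle, since the cycle through \<open>a\<close> also
  contains \<open>f a\<close>; so distinct cycles stay distinct.\<close>

lemma skip_card_orbits:
  assumes "finite D" "bij_betw f D D" "a \<in> D" "f a \<noteq> a"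
  shows "card (orbit (skip f a) ` (D - {a})) = card (orbit f ` D)"
proof -
  have img: "f ` D \<subseteq> D" using assms by (auto simp: bij_betw_def)
  have fa: "f a \<in> D - {a}" using img assms by auto
  have e: "orbit (skip f a) ` (D - {a}) = (\<lambda>X. X - {a}) ` (orbit f ` D)"
  proof -
    have "orbit f ` D = orbit f ` (D - {a})"
    proof -
      have "orbit f a = orbit f (f a)" using orbit_eq_of_mem[OF assms(1-3) orbit.base] by simp
      then show ?thesis using fa assms(3) by (metis image_insert insert_Diff insert_absorb image_eqI)
    qed
    then show ?thesis using skip_orbit[OF assms] by (simp add: image_image)
  qed
  have "inj_on (\<lambda>X. X - {a}) (orbit f ` D)"
  proof (rule inj_onI)
    fix o1 o2 assume o: "o1 \<in> orbit f ` D" "o2 \<in> orbit f ` D" "o1 - {a} = o2 - {a}"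
    obtain x1 x2 where x: "x1 \<in> D" "o1 = orbit f x1" "x2 \<in> D" "o2 = orbit f x2" using o by auto
    have ne: "\<exists>y. y \<in> o1 - {a}"
      using assms(4) orbit.base[of f x1] orbit.step[of "f x1" f x1] x by (metis DiffI singletonD)
    then obtain y where "y \<in> o1" "y \<in> o2" using o(3) by blast
    then show "o1 = o2" using orbit_eq_of_mem[OF assms(1,2)] x by metis
  qed
  then show ?thesis unfolding e by (rule card_image)
qed

lemma orbit_cong_on:
  assumes "\<And>y. y \<in> D \<Longrightarrow> f y = g y" "f ` D \<subseteq> D" "x \<in> D"
  shows "orbit f x = orbit g x"
proof -
  have "(f ^^ n) x = (g ^^ n) x" for n
  proof (induction n)
    case (Suc n)
    then show ?case using assms(1)[OF funpow_in[OF assms(2,3), of n]] by simp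
  qed simp
  then show ?thesis by (simp add: orbit_altdef)
qed

lemma fixpoint_card_orbits:
  assumes "finite D" "bij_betw f D D" "a \<in> D" "f a = a"
  shows "bij_betw f (D - {a}) (D - {a})"
    and "card (orbit f ` (D - {a})) + 1 = card (orbit f ` D)"
proof -
  show b: "bij_betw f (D - {a}) (D - {a})"
    using bij_betw_DiffI[OF assms(2), of "{a}" "{a}"] assms(3,4) by (simp add: bij_betw_def)
  have o: "orbit f a = {a}" using assms(4) orbit_eq_singleton_iff by metis
  have "orbit f ` D = insert {a} (orbit f ` (D - {a}))" using assms(3) o by auto
  moreover have "{a} \<notin> orbit f ` (D - {a})"
  proof
    assume "{a} \<in> orbit f ` (D - {a})"
    then obtain x where "x \<in> D - {a}" "orbit f x = {a}" by auto
    then show False using mem_orbit_self[OF assms(1,2)] by auto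
  qed
  ultimately show "card (orbit f ` (D - {a})) + 1 = card (orbit f ` D)"
    using assms(1) by simp
qed

section \<open>Deletion of the root edge\<close>

lemma planar_mapD:
  assumes "planar_map m"
  shows "finite (darts m)" "root_dart m \<in> darts m"
    and "\<And>d. d \<in> darts m \<Longrightarrow> opp m d \<in> darts m"
    and "\<And>d. d \<in> darts m \<Longrightarrow> opp m d \<noteq> d"
    and "\<And>d. d \<in> darts m \<Longrightarrow> opp m (opp m d) = d"
    and "bij_betw (nxt m) (darts m) (darts m)"
    and "map_connected m"
    and "\<And>d. d \<in> darts m \<Longrightarrow> nxt m d \<in> darts m"
    and "\<And>d e. d \<in> darts m \<Longrightarrow> e \<in> darts m \<Longrightarrow> nxt m d = nxt m e \<longleftrightarrow> d = e"
    and "card (map_vertices m) + card (map_faces m) = card (map_edges m) + 2"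
  using assms unfolding planar_map_def by (auto simp: bij_betw_def inj_on_def)

lemma opp_bij:
  assumes "planar_map m"
  shows "bij_betw (opp m) (darts m) (darts m)"
  using planar_mapD(3,5)[OF assms] by (intro bij_betwI[where g = "opp m"]) auto

lemma rotation_bij:
  assumes "planar_map m"
  shows "bij_betw (nxt m \<circ> opp m) (darts m) (darts m)"
  using bij_betw_trans[OF opp_bij[OF assms] planar_mapD(6)[OF assms]] .

lemma face_at_eq:
  assumes "planar_map m" "d \<in> darts m" "e \<in> face_at m d"
  shows "face_at m e = face_at m d"
  using orbit_eq_of_mem[OF planar_mapD(1,6)[OF assms(1)]] assms unfolding face_at_def by metis

lemma mem_face_at:
  assumes "planar_map m" "d \<in> darts m"
  shows "d \<in> face_at m d"
  using mem_orbit_self[OF planar_mapD(1,6)[OF assms(1)]] assms unfolding face_at_def by metis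

lemma face_at_subset:
  assumes "planar_map m" "d \<in> darts m"
  shows "face_at m d \<subseteq> darts m"
  unfolding face_at_def
  by (rule orbit_subset_carrier) (use planar_mapD(8)[OF assms(1)] assms in auto)

lemma nxt_mem_face_iff:
  assumes "planar_map m" "d \<in> darts m" "e \<in> darts m"
  shows "nxt m d \<in> face_at m e \<longleftrightarrow> d \<in> face_at m e"
proof -
  have "nxt m d \<in> face_at m d" unfolding face_at_def by (rule orbit.base)
  then have "face_at m (nxt m d) = face_at m d" using face_at_eq assms by metis
  then show ?thesis
    using face_at_eq[OF assms(1)] mem_face_at[OF assms(1)] assms planar_mapD(8)[OF assms(1)] by metis
qed

lemma face_at_disjoint:
  assumes "planar_map m" "d \<in> darts m" "e \<in> darts m" "face_at m d \<noteq> face_at m e"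
  shows "face_at m d \<inter> face_at m e = {}"
  using face_at_eq[OF assms(1)] assms by blast

text \<open>The darts reachable from a given one form the least closed set containing it.\<close>

lemma map_connected_iff:
  "map_connected m \<longleftrightarrow>
     (\<forall>S\<subseteq>darts m. S \<noteq> {} \<longrightarrow> opp m ` S \<subseteq> S \<longrightarrow> nxt m ` S \<subseteq> S \<longrightarrow> S = darts m)"
    if closed: "opp m ` darts m \<subseteq> darts m" "nxt m ` darts m \<subseteq> darts m"
proof
  let ?R = "{(x, y). x \<in> darts m \<and> (y = opp m x \<or> y = nxt m x)}"
  assume c: "map_connected m"
  show "\<forall>S\<subseteq>darts m. S \<noteq> {} \<longrightarrow> opp m ` S \<subseteq> S \<longrightarrow> nxt m ` S \<subseteq> S \<longrightarrow> S = darts m"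
  proof (intro allI impI)
    fix S assume S: "S \<subseteq> darts m" "S \<noteq> {}" "opp m ` S \<subseteq> S" "nxt m ` S \<subseteq> S"
    obtain d where d: "d \<in> S" using S by auto
    have "e \<in> S" if "e \<in> darts m" for e
    proof -
      have "(d, e) \<in> ?R\<^sup>*" using c d S that unfolding map_connected_def by blast
      then show "e \<in> S" by induction (use d S in auto)
    qed
    then show "S = darts m" using S by auto
  qed
next
  let ?R = "{(x, y). x \<in> darts m \<and> (y = opp m x \<or> y = nxt m x)}"
  assume c: "\<forall>S\<subseteq>darts m. S \<noteq> {} \<longrightarrow> opp m ` S \<subseteq> S \<longrightarrow> nxt m ` S \<subseteq> S \<longrightarrow> S = darts m"
  show "map_connected m" unfolding map_connected_def
  proof (intro ballI)
    fix d e assume de: "d \<in> darts m" "e \<in> darts m"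
    define S where "S = {x \<in> darts m. (d, x) \<in> ?R\<^sup>*}"
    have "opp m x \<in> S" "nxt m x \<in> S" if "x \<in> S" for x
      using that closed unfolding S_def by (auto intro: rtrancl_into_rtrancl)
    moreover have "d \<in> S" using de by (simp add: S_def)
    moreover have "S \<subseteq> darts m" by (auto simp: S_def)
    ultimately have "S = darts m" using c[rule_format, of S] by auto
    then show "(d, e) \<in> ?R\<^sup>*" using de S_def by auto
  qed
qed

text \<open>A set closed under permutations of a finite set has a closed complement, so it is enough
  to treat the one of the two that contains \<open>c\<close>.\<close>

lemma map_connected_to_root:
  assumes "finite (darts m)"
    and opp: "\<And>d. d \<in> darts m \<Longrightarrow> opp m d \<in> darts m \<and> opp m (opp m d) = d"
    and nxt: "bij_betw (nxt m) (darts m) (darts m)"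
    and reach: "\<And>S. S \<subseteq> darts m \<Longrightarrow> c \<in> S \<Longrightarrow> opp m ` S \<subseteq> S \<Longrightarrow>
       (\<And>d. d \<in> darts m \<Longrightarrow> nxt m d \<in> S \<longleftrightarrow> d \<in> S) \<Longrightarrow> S = darts m"
    and c: "c \<in> darts m"
  shows "map_connected m"
proof -
  have closed: "opp m ` darts m \<subseteq> darts m" "nxt m ` darts m \<subseteq> darts m"
    using opp nxt by (auto simp: bij_betw_def)
  have "S = darts m" if S: "S \<subseteq> darts m" "S \<noteq> {}" "opp m ` S \<subseteq> S" "nxt m ` S \<subseteq> S" for S
  proof -
    have fS: "finite S" using S(1) assms(1) finite_subset by auto
    have inj: "inj_on (nxt m) (darts m)" using nxt by (simp add: bij_betw_def)
    have img: "nxt m ` S = S"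
      using S inj fS by (meson endo_inj_surj inj_on_subset)
    have iff: "nxt m d \<in> S \<longleftrightarrow> d \<in> S" if "d \<in> darts m" for d
    proof
      assume "nxt m d \<in> S"
      then obtain x where x: "x \<in> S" "nxt m x = nxt m d" using img by (metis imageE)
      then have "x = d" using inj that S(1) by (auto dest: inj_onD)
      then show "d \<in> S" using x by simp
    qed (use S(4) in auto)
    have iffo: "opp m d \<in> S \<longleftrightarrow> d \<in> S" if "d \<in> darts m" for d
    proof
      assume "opp m d \<in> S"
      then have "opp m (opp m d) \<in> S" using S(3) by blast
      then show "d \<in> S" using opp that by simp
    qed (use S(3) in auto)
    show ?thesis
    proof (cases "c \<in> S")
      case True
      then show ?thesis using reach S iff by blast
    next
      case False
      have "darts m - S = darts m"
      proof (rule reach)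
        show "opp m ` (darts m - S) \<subseteq> darts m - S" using iffo opp by auto
        show "nxt m d \<in> darts m - S \<longleftrightarrow> d \<in> darts m - S" if "d \<in> darts m" for d
          using iff that closed by auto
      qed (use False c in auto)
      then show ?thesis using S by auto
    qed
  qed
  then show ?thesis using map_connected_iff[OF closed] by blast
qed

lemma card_map_edges:
  assumes "finite (darts m)"
    and "\<And>d. d \<in> darts m \<Longrightarrow> opp m d \<in> darts m \<and> opp m d \<noteq> d \<and> opp m (opp m d) = d"
  shows "card (darts m) = 2 * card (map_edges m)"
proof -
  have d: "pairwise disjnt (map_edges m)"
  proof (rule pairwiseI)
    fix x y assume xy: "x \<in> map_edges m" "y \<in> map_edges m" "x \<noteq> y"
    have e: "e = {z, opp m z}" if "e \<in> map_edges m" "z \<in> e" for e z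
      using that assms(2) unfolding map_edges_def by auto
    show "disjnt x y"
    proof (rule ccontr)
      assume "\<not> disjnt x y"
      then obtain z where z: "z \<in> x" "z \<in> y" by (auto simp: disjnt_def)
      show False using xy(3) unfolding e[OF xy(1) z(1)] e[OF xy(2) z(2)] by simp
    qed
  qed
  have u: "\<Union> (map_edges m) = darts m"
  proof
    show "\<Union> (map_edges m) \<subseteq> darts m" unfolding map_edges_def using assms(2) by auto
    show "darts m \<subseteq> \<Union> (map_edges m)" unfolding map_edges_def by auto
  qed
  have c: "card e = 2" if em: "e \<in> map_edges m" for e
  proof -
    obtain d where d: "d \<in> darts m" "e = {d, opp m d}" using em unfolding map_edges_def by auto
    then have "opp m d \<noteq> d" using assms(2) by simp
    then have "d \<noteq> opp m d" by simp
    then show ?thesis unfolding d(2) by simp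
  qed
  have "card (darts m) = (\<Sum>e\<in>map_edges m. card e)"
    unfolding u[symmetric] by (rule card_Union_disjoint[OF d]) (use c in \<open>auto intro: card_ge_0_finite\<close>)
  also have "\<dots> = 2 * card (map_edges m)" using c by simp
  finally show ?thesis .
qed

text \<open>Both darts are cut out by cross-connection: a walk about to enter \<open>r\<close>
  continues after \<open>s\<close>, and conversely, which merges the two faces. The new root
  \<open>nxt m s\<close> leaves the tail of the old root edge.\<close>

definition del_root :: "'d rmap \<Rightarrow> 'd rmap" where
  "del_root m =
     (let r = root_dart m; s = opp m r in
      \<lparr> darts = darts m - {r, s}, opp = opp m,
        nxt = (\<lambda>d. if nxt m d = r then nxt m s else if nxt m d = s then nxt m r else nxt m d),
        root_dart = nxt m s \<rparr>)"

text \<open>The root edge either separates two faces, or it is a pendant edge pointing to its leaf.\<close>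

locale root_deletion =
  fixes m :: "'d rmap" and r s :: 'd
  assumes r_def: "r = root_dart m" and s_def: "s = opp m (root_dart m)"
    and planar: "planar_map m"
    and ns: "nxt m s \<noteq> r" "nxt m s \<noteq> s" and nr: "nxt m r \<noteq> r"
    and cases: "s \<notin> face_at m r \<or> nxt m r = s"
begin

abbreviation "u \<equiv> del_root m"

definition "M = (face_at m r \<union> face_at m s) - {r, s}"

lemma r: "r \<in> darts m" and s: "s \<in> darts m" and rs: "r \<noteq> s" and opp_s: "opp m s = r"
  and opp_r: "opp m r = s"
  using planar_mapD(2-5)[OF planar] by (auto simp: r_def s_def) (metis)

lemmas pm = planar_mapD[OF planar]

lemma u_simps:
  "darts u = darts m - {r, s}" "opp u = opp m"
  "nxt u d = (if nxt m d = r then nxt m s else if nxt m d = s then nxt m r else nxt m d)"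
  "root_dart u = nxt m s"
  by (auto simp: del_root_def Let_def r_def s_def)

lemma opp_u: assumes "d \<in> darts u" shows "opp m d \<in> darts u"
  using assms pm(3,5) opp_r opp_s by (auto simp: u_simps) metis+

lemma nxt_u_mem: assumes "d \<in> darts u" shows "nxt u d \<in> darts u"
proof -
  \<comment> \<open>In the pendant case \<open>r\<close> is the dart before \<open>s\<close>, so a
    surviving \<open>d\<close> is not; hence redirection to \<open>nxt m r\<close> never lands on
    \<open>s\<close>.\<close>
  have "nxt m d = s \<Longrightarrow> nxt m r \<noteq> s" using assms pm(9)[of d r] r by (auto simp: u_simps)
  then show ?thesis using assms ns nr pm(8) r s by (auto simp: u_simps)
qed

lemma nxt_u_bij: "bij_betw (nxt u) (darts u) (darts u)"
proof -
  have "inj_on (nxt u) (darts u)"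
  proof (rule inj_onI)
    fix x y assume xy: "x \<in> darts u" "y \<in> darts u" "nxt u x = nxt u y"
    have *: "nxt m x \<noteq> nxt m r" "nxt m x \<noteq> nxt m s" "nxt m y \<noteq> nxt m r" "nxt m y \<noteq> nxt m s"
      using xy(1,2) pm(9) r s by (auto simp: u_simps)
    have "nxt m r \<noteq> nxt m s" using pm(9) r s rs by simp
    then have "nxt m x = nxt m y" using xy(3) * by (auto simp: u_simps split: if_splits)
    then show "x = y" using pm(9) xy(1,2) by (simp add: u_simps)
  qed
  moreover have "nxt u ` darts u \<subseteq> darts u" using nxt_u_mem by auto
  ultimately show ?thesis
    using endo_inj_surj[of "darts u" "nxt u"] pm(1) by (simp add: bij_betw_def u_simps(1))
qed

lemma finite_u: "finite (darts u)" using pm(1) by (simp add: u_simps)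

lemma M_subset: "M \<subseteq> darts u"
  using face_at_subset[OF planar] r s by (auto simp: M_def u_simps)

lemma face_r: "r \<in> face_at m r" "s \<in> face_at m s"
  using mem_face_at[OF planar] r s by auto

lemma nxt_u_M: assumes "d \<in> darts u" shows "nxt u d \<in> M \<longleftrightarrow> d \<in> M"
proof -
  have d: "d \<in> darts m" "d \<noteq> r" "d \<noteq> s" using assms by (auto simp: u_simps)
  have "nxt u d \<in> darts m" "nxt u d \<noteq> r" "nxt u d \<noteq> s" using nxt_u_mem[OF assms] unfolding u_simps(1) by auto
  then show ?thesis
    using nxt_mem_face_iff[OF planar d(1) r] nxt_mem_face_iff[OF planar d(1) s]
      nxt_mem_face_iff[OF planar r r] nxt_mem_face_iff[OF planar s s] d face_r
    unfolding M_def by (auto simp: u_simps split: if_splits)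
qed

lemma root_M: "nxt m s \<in> M"
  using nxt_mem_face_iff[OF planar s s] face_r ns by (auto simp: M_def)

text \<open>Where a walk along the face of \<open>s\<close> would meet \<open>s\<close>, it is
  redirected into the face of \<open>r\<close>; where it would meet \<open>r\<close>, it is
  redirected to \<open>nxt m s\<close>. So every dart of \<open>M\<close> leads to that dart, and
  \<open>M\<close> is a single cycle.\<close>

lemma reach_nxt_s:
  assumes "d \<in> M"
  shows "nxt m s \<in> orbit (nxt u) d"
proof -
  have R1: "nxt m s \<in> orbit (nxt u) d" if "d \<in> darts u" "(nxt m ^^ Suc k) d = r" for d k
    using that
  proof (induction k arbitrary: d)
    case 0
    then have "nxt u d = nxt m s" by (simp add: u_simps)
    then show ?case by (metis orbit.base)
  next
    case (Suc k)
    show ?case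
    proof (cases "nxt m d = r")
      case True
      then have "nxt u d = nxt m s" by (simp add: u_simps)
      then show ?thesis by (metis orbit.base)
    next
      case False
      have e: "(nxt m ^^ Suc k) (nxt m d) = r" using Suc.prems(2) by (simp add: funpow_swap1)
      \<comment> \<open>The walk to \<open>r\<close> cannot meet \<open>s\<close> first: either
        \<open>s\<close> lies on another face, or \<open>r\<close> is the only dart before
        it.\<close>
      have "nxt m d \<noteq> s"
      proof
        assume ds: "nxt m d = s"
        then have "nxt m r \<noteq> s" using Suc.prems(1) pm(9)[of d r] r by (auto simp: u_simps)
        then have sf: "s \<notin> face_at m r" using cases by simp
        have "r \<in> face_at m s" unfolding face_at_def
          using e ds unfolding orbit_altdef by (metis (mono_tags, lifting) CollectI zero_less_Suc)
        then show False using sf face_at_eq[OF planar s] face_r by metis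
      qed
      then have un: "nxt u d = nxt m d" using False by (simp add: u_simps)
      then have "nxt m d \<in> darts u" using nxt_u_mem[OF Suc.prems(1)] by simp
      then have "nxt m s \<in> orbit (nxt u) (nxt u d)" using Suc.IH e un by simp
      then show ?thesis by (rule orbit_subset)
    qed
  qed
  have nr_reach: "nxt m s \<in> orbit (nxt u) (nxt m r)" if "nxt m r \<in> darts u"
  proof -
    have "r \<in> face_at m (nxt m r)"
      using face_at_eq[OF planar r, of "nxt m r"] face_r(1) orbit.base[of "nxt m" r]
      unfolding face_at_def by simp
    then obtain j where "r = (nxt m ^^ j) (nxt m r)" "0 < j" unfolding face_at_def orbit_altdef by auto
    then show ?thesis using R1[OF that, of "j - 1"] by simp
  qed
  have R2: "nxt m s \<in> orbit (nxt u) d" if "s \<notin> face_at m r" "d \<in> darts u" "(nxt m ^^ Suc k) d = s" for d k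
    using that(2,3)
  proof (induction k arbitrary: d)
    case 0
    then have n: "nxt u d = nxt m r" using rs by (simp add: u_simps)
    have m: "nxt u d \<in> darts u" using nxt_u_mem 0 by simp
    then have "nxt m s \<in> orbit (nxt u) (nxt u d)" using nr_reach n by simp
    then show ?case by (rule orbit_subset)
  next
    case (Suc k)
    show ?case
    proof (cases "nxt m d = s")
      case True
      then have n: "nxt u d = nxt m r" using rs by (simp add: u_simps)
      have m: "nxt u d \<in> darts u" using nxt_u_mem Suc by simp
      then have "nxt m s \<in> orbit (nxt u) (nxt u d)" using nr_reach n by simp
    then show ?thesis by (rule orbit_subset)
    next
      case False
      have e: "(nxt m ^^ Suc k) (nxt m d) = s" using Suc.prems(2) by (simp add: funpow_swap1)
      have "nxt m d \<noteq> r"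
      proof
        assume ds: "nxt m d = r"
        have "s \<in> face_at m r" unfolding face_at_def
          using e ds unfolding orbit_altdef by (metis (mono_tags, lifting) CollectI zero_less_Suc)
        then show False using that(1) by simp
      qed
      then have un: "nxt u d = nxt m d" using False by (simp add: u_simps)
      then have "nxt m d \<in> darts u" using nxt_u_mem[OF Suc.prems(1)] by simp
      then have "nxt m s \<in> orbit (nxt u) (nxt u d)" using Suc.IH e un by simp
      then show ?thesis by (rule orbit_subset)
    qed
  qed
  have du: "d \<in> darts u" using assms M_subset by auto
  show ?thesis
  proof (cases "d \<in> face_at m r")
    case True
    then have "r \<in> face_at m d" using face_at_eq[OF planar r True] face_r(1) by simp
    then obtain j where "r = (nxt m ^^ j) d" "0 < j" unfolding face_at_def orbit_altdef by auto
    then show ?thesis using R1[OF du, of "j - 1"] by simp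
  next
    case False
    then have ds: "d \<in> face_at m s" using assms by (auto simp: M_def)
    then have sf: "s \<notin> face_at m r" using False face_at_eq[OF planar r, of s] by auto
    have "s \<in> face_at m d" using face_at_eq[OF planar s ds] face_r(2) by simp
    then obtain j where "s = (nxt m ^^ j) d" "0 < j" unfolding face_at_def orbit_altdef by auto
    then show ?thesis using R2[OF sf du, of "j - 1"] by simp
  qed
qed

lemma face_u_M:
  assumes "d \<in> M"
  shows "face_at u d = M"
proof -
  have o: "orbit (nxt u) d = orbit (nxt u) (nxt m s)" if "d \<in> M" for d
    using orbit_eq_of_mem[OF finite_u nxt_u_bij _ reach_nxt_s[OF that]] that M_subset by auto
  have "orbit (nxt u) (nxt m s) \<subseteq> M"
    by (rule orbit_subset_carrier) (use nxt_u_M M_subset root_M in auto)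
  moreover have "d \<in> orbit (nxt u) (nxt m s)" if "d \<in> M" for d
    using mem_orbit_self[OF finite_u nxt_u_bij, of d] o[OF that] that M_subset by auto
  ultimately show ?thesis using o[OF assms] unfolding face_at_def by auto
qed

definition "D2 = darts m - (face_at m r \<union> face_at m s)"

lemma face_u_D2:
  assumes "d \<in> D2"
  shows "face_at u d = face_at m d"
  unfolding face_at_def
proof (rule orbit_cong_on[where D = D2, symmetric])
  show "nxt m y = nxt u y" if "y \<in> D2" for y
  proof -
    have "y \<in> darts m" using that by (simp add: D2_def)
    then have "nxt m y \<noteq> r" "nxt m y \<noteq> s"
      using that nxt_mem_face_iff[OF planar _ r, of y] nxt_mem_face_iff[OF planar _ s, of y] face_r
      by (auto simp: D2_def)
    then show ?thesis by (simp add: u_simps)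
  qed
  show "nxt m ` D2 \<subseteq> D2"
    using nxt_mem_face_iff[OF planar _ r] nxt_mem_face_iff[OF planar _ s] pm(8)
    by (auto simp: D2_def)
qed (use assms in auto)

lemma darts_u_split: "darts u = M \<union> D2"
  using M_subset face_r unfolding D2_def M_def by (auto simp: u_simps)

lemma root_face_u: "root_face u = M"
  unfolding root_face_def using face_u_M root_M by (simp add: u_simps)

lemma M_notin: "M \<notin> face_at m ` D2"
proof
  assume "M \<in> face_at m ` D2"
  then obtain d where d: "d \<in> D2" "M = face_at m d" by auto
  then have "d \<in> M" using mem_face_at[OF planar, of d] by (auto simp: D2_def)
  then show False using d(1) by (auto simp: M_def D2_def)
qed

lemma faces_u: "map_faces u = insert M (face_at m ` D2)"
proof -
  have "face_at u ` M = {M}" using face_u_M root_M by auto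
  moreover have "face_at u ` D2 = face_at m ` D2" using face_u_D2 by auto
  ultimately show ?thesis unfolding map_faces_def darts_u_split image_Un by simp
qed

lemma internal_faces_u: "internal_faces u = face_at m ` D2"
  unfolding internal_faces_def faces_u root_face_u using M_notin by auto

lemma faces_m: "map_faces m = {face_at m r, face_at m s} \<union> face_at m ` D2"
proof -
  have "face_at m d \<in> {face_at m r, face_at m s} \<union> face_at m ` D2" if "d \<in> darts m" for d
    using that face_at_eq[OF planar r, of d] face_at_eq[OF planar s, of d] by (auto simp: D2_def)
  then show ?thesis unfolding map_faces_def using r s by (auto simp: D2_def)
qed

lemma face_rs_notin: "face_at m r \<notin> face_at m ` D2" "face_at m s \<notin> face_at m ` D2"
  using face_r mem_face_at[OF planar] by (auto simp: D2_def)

lemma root_face_m: "root_face m = face_at m r"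
  by (simp add: root_face_def r_def)

lemma edges_u: "card (map_edges u) + 1 = card (map_edges m)"
proof -
  have "darts m = {r, s} \<union> darts u" using r s by (auto simp: u_simps(1))
  then have "map_edges m = insert {r, s} (map_edges u)"
    unfolding map_edges_def u_simps(2) using opp_r opp_s by (simp add: insert_commute)
  moreover have "{r, s} \<notin> map_edges u" unfolding map_edges_def by (auto simp: u_simps)
  moreover have "finite (map_edges u)" unfolding map_edges_def using finite_u by simp
  ultimately show ?thesis by simp
qed

text \<open>A closed set of the smaller map that meets \<open>M\<close> contains \<open>M\<close>,
  and together with \<open>r\<close> and \<open>s\<close> it is closed in \<open>m\<close>. One that
  misses \<open>M\<close> is already closed in \<open>m\<close>, which is impossible because it
  omits \<open>r\<close>.\<close>

lemma connected_u: "map_connected u"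
proof -
  have closed: "opp u ` darts u \<subseteq> darts u" "nxt u ` darts u \<subseteq> darts u"
    using opp_u nxt_u_mem by (auto simp: u_simps(2))
  have closedm: "opp m ` darts m \<subseteq> darts m" "nxt m ` darts m \<subseteq> darts m"
    using pm(3,8) by auto
  have cm: "S = darts m" if "S \<subseteq> darts m" "S \<noteq> {}" "opp m ` S \<subseteq> S" "nxt m ` S \<subseteq> S" for S
    using that map_connected_iff[OF closedm] pm(7) by blast
  have "S = darts u" if S: "S \<subseteq> darts u" "S \<noteq> {}" "opp u ` S \<subseteq> S" "nxt u ` S \<subseteq> S" for S
  proof (cases "M \<inter> S = {}")
    case False
    then obtain d where d: "d \<in> M" "d \<in> S" by auto
    have "orbit (nxt u) d \<subseteq> S" by (rule orbit_subset_carrier) (use S d in auto)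
    then have MS: "M \<subseteq> S" using face_u_M[OF d(1)] by (simp add: face_at_def)
    have "nxt m x \<in> S \<union> {r, s}" if "x \<in> S \<union> {r, s}" for x
    proof -
      have "nxt m r \<in> M \<union> {r, s}" "nxt m s \<in> M"
        using nxt_mem_face_iff[OF planar r r] face_r root_M by (auto simp: M_def)
      moreover have "nxt m x \<in> S \<union> {r, s}" if "x \<in> S"
        using S(4) that u_simps(3)[of x] by (metis Un_iff image_subset_iff insert_iff)
      ultimately show ?thesis using that MS by auto
    qed
    moreover have "opp m x \<in> S \<union> {r, s}" if "x \<in> S \<union> {r, s}" for x
      using S(3) that opp_r opp_s by (auto simp: u_simps(2))
    ultimately have "S \<union> {r, s} = darts m"
      using S(1) r s by (intro cm) (auto simp: u_simps(1))
    then show ?thesis using S(1) by (auto simp: u_simps(1))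
  next
    case True
    have "nxt m x \<in> S" if x: "x \<in> S" for x
    proof -
      have xu: "x \<in> darts m" "x \<notin> M" "x \<noteq> r" "x \<noteq> s" using x S(1) True by (auto simp: u_simps(1))
      then have "nxt m x \<noteq> r" "nxt m x \<noteq> s"
        using nxt_mem_face_iff[OF planar xu(1) r] nxt_mem_face_iff[OF planar xu(1) s] face_r
        by (auto simp: M_def)
      then have "nxt u x = nxt m x" by (simp add: u_simps(3))
      then show ?thesis using S(4) x by auto
    qed
    moreover have "opp m x \<in> S" if "x \<in> S" for x using S(3) that by (auto simp: u_simps(2))
    ultimately have "S = darts m" using S(1,2) by (intro cm) (auto simp: u_simps(1))
    then show ?thesis using S(1) r by (auto simp: u_simps(1))
  qed
  then show ?thesis using map_connected_iff[OF closed] by blast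
qed

text \<open>The rotation of \<open>u\<close> is a first-return permutation of the rotation of
  \<open>m\<close>, and skipping a dart keeps the number of cycles. In the pendant case
  \<open>s\<close> is a fixed point of the rotation, namely the leaf, and this vertex is
  lost.\<close>

lemma vertices_u:
  "card (map_vertices u) + (if s \<in> face_at m r then 1 else 0) = card (map_vertices m)"
proof -
  let ?f = "nxt m \<circ> opp m" and ?g = "nxt u \<circ> opp u"
  have D: "darts u = darts m - {s} - {r}" "darts u = darts m - {r} - {s}" by (auto simp: u_simps(1))
  have gimg: "?g ` darts u \<subseteq> darts u" using opp_u nxt_u_mem by (auto simp: u_simps(2))
  note b = rotation_bij[OF planar]
  have fr: "?f r = nxt m s" "?f s = nxt m r" using opp_r opp_s by auto
  have g: "?g d = (if ?f d = r then nxt m s else if ?f d = s then nxt m r else ?f d)" for d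
    by (simp add: u_simps)
  show ?thesis
  proof (cases "nxt m r = s")
    case True
    have sf: "s \<in> face_at m r" using True unfolding face_at_def by (metis orbit.base)
    have fs: "?f s = s" using True fr by simp
    note F = fixpoint_card_orbits[OF pm(1) b s fs]
    have "card (orbit (skip ?f r) ` (darts m - {s} - {r})) = card (orbit ?f ` (darts m - {s}))"
      by (rule skip_card_orbits[OF _ F(1)]) (use pm(1) r rs fr ns in auto)
    moreover have "orbit ?g d = orbit (skip ?f r) d" if "d \<in> darts u" for d
    proof (rule orbit_cong_on[OF _ gimg that])
      fix y assume y: "y \<in> darts u"
      have "?f y \<noteq> ?f s" using b y s by (auto simp: bij_betw_def inj_on_def u_simps(1))
      then have "?f y \<noteq> s" using fs by simp
      then show "?g y = skip ?f r y" unfolding g skip_def fr by simp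
    qed
    ultimately have "card (orbit ?g ` darts u) + 1 = card (orbit ?f ` darts m)"
      using F(2) unfolding D(1)[symmetric] by (metis (no_types, lifting) image_cong)
    then show ?thesis using sf unfolding map_vertices_def vertex_at_def by simp
  next
    case False
    then have sf: "s \<notin> face_at m r" using cases by simp
    have fin: "finite (darts m - {r})" using pm(1) by simp
    have n1: "?f r \<noteq> r" using fr ns by simp
    note b1 = skip_bij[OF pm(1) b r n1]
    have s1: "skip ?f r s = nxt m r" using fr nr by (simp add: skip_def)
    have "card (orbit (skip (skip ?f r) s) ` (darts m - {r} - {s})) = card (orbit (skip ?f r) ` (darts m - {r}))"
      by (rule skip_card_orbits[OF fin b1], use s rs in simp, unfold s1, rule False)
    also have "\<dots> = card (orbit ?f ` darts m)"
      by (rule skip_card_orbits[OF pm(1) b r n1])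
    finally have "card (orbit (skip (skip ?f r) s) ` darts u) = card (orbit ?f ` darts m)"
      unfolding D(2) .
    moreover have "orbit ?g d = orbit (skip (skip ?f r) s) d" if "d \<in> darts u" for d
    proof (rule orbit_cong_on[OF _ gimg that])
      fix y assume y: "y \<in> darts u"
      show "?g y = skip (skip ?f r) s y" unfolding g
        using ns s1 fr by (simp add: skip_def)
    qed
    ultimately have "card (orbit ?g ` darts u) = card (orbit ?f ` darts m)"
      by (metis (no_types, lifting) image_cong)
    then show ?thesis using sf unfolding map_vertices_def vertex_at_def by simp
  qed
qed

text \<open>Along with the edge, one face is lost in the separating case and one vertex in the
  pendant case, so Euler's relation is preserved.\<close>

lemma planar_u: "planar_map u"
proof -
  have fin: "finite (face_at m ` D2)" using pm(1) by (simp add: D2_def)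
  have f: "card (map_faces u) + (if s \<in> face_at m r then 0 else 1) = card (map_faces m)"
  proof (cases "s \<in> face_at m r")
    case True
    then show ?thesis using face_at_eq[OF planar r] M_notin face_rs_notin fin
      by (simp add: faces_u faces_m)
  next
    case False
    then have "face_at m r \<noteq> face_at m s" using face_r by auto
    then show ?thesis using False M_notin face_rs_notin fin by (simp add: faces_u faces_m)
  qed
  have "card (map_vertices u) + card (map_faces u) = card (map_edges u) + 2"
    using f vertices_u edges_u pm(10) by (auto split: if_splits)
  moreover have "root_dart u \<in> darts u" using root_M M_subset by (auto simp: u_simps(4))
  moreover have "opp u d \<in> darts u \<and> opp u d \<noteq> d \<and> opp u (opp u d) = d" if "d \<in> darts u" for d
    using that opp_u[OF that] pm(4,5) by (simp add: u_simps(1,2))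
  ultimately show ?thesis
    unfolding planar_map_def using finite_u nxt_u_bij connected_u by blast
qed

lemma perimeter_u: "perimeter u + 2 = card (face_at m r \<union> face_at m s)"
proof -
  have fin: "finite (face_at m r \<union> face_at m s)"
    using face_at_subset[OF planar] r s pm(1) by (metis finite_UnI finite_subset)
  have "card {r, s} \<le> card (face_at m r \<union> face_at m s)"
    using fin face_r by (intro card_mono) auto
  then show ?thesis
    unfolding perimeter_def root_face_u M_def using fin face_r rs by (subst card_Diff_subset) auto
qed

end

section \<open>Isomorphism and gluing\<close>

text \<open>Together with a root among the darts, this is what symmetry of \<open>rmap_iso\<close>
  requires; for a glued map it is obtained without showing planarity.\<close>

definition wf_rmap :: "('d, 'x) rmap_scheme \<Rightarrow> bool" where
  "wf_rmap m \<longleftrightarrow> (\<forall>d\<in>darts m. opp m d \<in> darts m \<and> nxt m d \<in> darts m)"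

lemma wf_planar: "planar_map m \<Longrightarrow> wf_rmap m"
  using planar_mapD(3,8) by (auto simp: wf_rmap_def)

lemma rmap_iso_refl: "rmap_iso m m"
  unfolding rmap_iso_def by (rule exI[of _ id]) auto

lemma rmap_iso_sym:
  assumes "rmap_iso m m'" "wf_rmap m" "root_dart m \<in> darts m"
  shows "rmap_iso m' m"
proof -
  obtain f where f: "bij_betw f (darts m) (darts m')" "f (root_dart m) = root_dart m'"
    "\<And>d. d \<in> darts m \<Longrightarrow> f (opp m d) = opp m' (f d) \<and> f (nxt m d) = nxt m' (f d)"
    using assms(1) unfolding rmap_iso_def by blast
  define g where "g = inv_into (darts m) f"
  have g: "g (f d) = d" if "d \<in> darts m" for d
    using f(1) that unfolding g_def by (metis bij_betw_def inv_into_f_f)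
  have "g (opp m' e) = opp m (g e) \<and> g (nxt m' e) = nxt m (g e)" if "e \<in> darts m'" for e
  proof -
    obtain d where d: "d \<in> darts m" "e = f d" using f(1) \<open>e \<in> darts m'\<close> by (auto simp: bij_betw_def)
    then show ?thesis using f(3)[OF d(1)] g assms(2) unfolding wf_rmap_def by metis
  qed
  moreover have "bij_betw g (darts m') (darts m)"
    unfolding g_def using f(1) by (rule bij_betw_inv_into)
  moreover have "g (root_dart m') = root_dart m" using g[OF assms(3)] f(2) by simp
  ultimately show ?thesis unfolding rmap_iso_def by blast
qed

lemma rmap_iso_trans:
  assumes "rmap_iso m m'" "rmap_iso m' m''"
  shows "rmap_iso m m''"
proof -
  obtain f where f: "bij_betw f (darts m) (darts m')" "f (root_dart m) = root_dart m'"
    "\<And>d. d \<in> darts m \<Longrightarrow> f (opp m d) = opp m' (f d) \<and> f (nxt m d) = nxt m' (f d)"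
    using assms(1) unfolding rmap_iso_def by blast
  obtain g where g: "bij_betw g (darts m') (darts m'')" "g (root_dart m') = root_dart m''"
    "\<And>d. d \<in> darts m' \<Longrightarrow> g (opp m' d) = opp m'' (g d) \<and> g (nxt m' d) = nxt m'' (g d)"
    using assms(2) unfolding rmap_iso_def by blast
  have fd: "f d \<in> darts m'" if "d \<in> darts m" for d using f(1) that by (auto simp: bij_betw_def)
  have "bij_betw (g \<circ> f) (darts m) (darts m'')" using f(1) g(1) by (rule bij_betw_trans)
  moreover have "(g \<circ> f) (root_dart m) = root_dart m''" using f g by simp
  moreover have "(g \<circ> f) (opp m d) = opp m'' ((g \<circ> f) d) \<and> (g \<circ> f) (nxt m d) = nxt m'' ((g \<circ> f) d)"
    if "d \<in> darts m" for d
    using f(3)[OF that] g(3)[OF fd[OF that]] by simp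
  ultimately show ?thesis unfolding rmap_iso_def by blast
qed

lemma iso_class_eqI:
  assumes "rmap_iso m m'" "wf_rmap m" "root_dart m \<in> darts m"
  shows "iso_class m = iso_class m'"
  unfolding iso_class_def
  using rmap_iso_trans[OF assms(1)] rmap_iso_trans[OF rmap_iso_sym[OF assms]] by blast

lemma iso_class_eqD:
  fixes m' :: "nat rmap"
  assumes "iso_class m = iso_class m'"
  shows "rmap_iso m m'"
proof -
  have "m' \<in> iso_class m" using rmap_iso_refl[of m'] assms by (simp add: iso_class_def)
  then show ?thesis by (simp add: iso_class_def)
qed

text \<open>
  \<open>(f ^^ (n - k)) x\<close>, \<open>k < n\<close>, is the dart from which \<open>x\<close> is reached in \<open>k\<close> steps.
\<close>

lemma cross_funpow:
  assumes per: "\<And>i. (f ^^ i) x = x \<longleftrightarrow> n dvd i" and k: "k < n"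
  shows "cross f x g y ((f ^^ (n - k)) x) = (g ^^ k) y"
proof -
  have e: "(f ^^ j) ((f ^^ (n - k)) x) = x \<longleftrightarrow> n dvd (j + (n - k))" for j
    using per[of "j + (n - k)"] by (simp add: funpow_add)
  have "(LEAST j. (f ^^ j) ((f ^^ (n - k)) x) = x) = k"
  proof (rule Least_equality)
    show "(f ^^ k) ((f ^^ (n - k)) x) = x" unfolding e using k by simp
    fix j assume "(f ^^ j) ((f ^^ (n - k)) x) = x"
    then have d: "n dvd (j + (n - k))" unfolding e .
    show "k \<le> j"
    proof (rule ccontr)
      assume "\<not> k \<le> j"
      then have "0 < j + (n - k)" "j + (n - k) < n" using k by auto
      then show False using d by (auto dest: dvd_imp_le)
    qed
  qed
  then show ?thesis by (simp add: cross_def)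
qed

lemma face_period:
  assumes "planar_map m" "d \<in> darts m"
  shows "(nxt m ^^ i) d = d \<longleftrightarrow> card (face_at m d) dvd i"
    and "0 < card (face_at m d)"
    and "a \<in> face_at m d \<Longrightarrow> \<exists>k<card (face_at m d). a = (nxt m ^^ k) d"
    and "a \<in> face_at m d \<Longrightarrow> \<exists>k<card (face_at m d). a = (nxt m ^^ (card (face_at m d) - k)) d"
    and "(nxt m ^^ i) d \<in> face_at m d"
    and "(nxt m ^^ i) d = (nxt m ^^ j) d \<longleftrightarrow> i mod card (face_at m d) = j mod card (face_at m d)"
proof -
  let ?n = "card (face_at m d)"
  note P = funpow_orbit_period[OF planar_mapD(1,6)[OF assms(1)] assms(2)]
  show pos: "0 < ?n" using P(1) by (simp add: face_at_def)
  show eq: "(nxt m ^^ i) d = (nxt m ^^ j) d \<longleftrightarrow> i mod ?n = j mod ?n" for i j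
    using P(2)[of i j] unfolding face_at_def .
  show per: "(nxt m ^^ i) d = d \<longleftrightarrow> ?n dvd i" for i
    using eq[of i 0] by (simp add: dvd_eq_mod_eq_0)
  show "(nxt m ^^ i) d \<in> face_at m d"
    unfolding face_at_def by (rule funpow_mem_orbit[OF planar_mapD(1,6)[OF assms(1)] assms(2)])
  show ex: "\<exists>k<?n. a = (nxt m ^^ k) d" if "a \<in> face_at m d" for a
    using that P(3) unfolding face_at_def by auto
  show "\<exists>k<?n. a = (nxt m ^^ (?n - k)) d" if a: "a \<in> face_at m d"
  proof -
    obtain i where i: "i < ?n" "a = (nxt m ^^ i) d" using ex[OF a] by auto
    show ?thesis
    proof (cases "i = 0")
      case True
      then have "a = (nxt m ^^ (?n - 0)) d" using i per[of ?n] by simp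
      then show ?thesis using pos by blast
    next
      case False
      then show ?thesis using i by (intro exI[of _ "?n - i"]) auto
    qed
  qed
qed

section \<open>Elementary facts on maps with holes, and isomorphisms from a glued map\<close>

lemma quad_with_holesD:
  assumes "quad_with_holes q"
  shows "planar_map q" "marks q \<subseteq> darts q" "inj_on (face_at q) (marks q)"
    "root_face q \<notin> face_at q ` marks q"
  using assms by (auto simp: quad_with_holes_def)

lemma nxt_mem_hole_iff:
  assumes "quad_with_holes q" "d \<in> darts q"
  shows "nxt q d \<in> hole_darts q \<longleftrightarrow> d \<in> hole_darts q"
  unfolding hole_darts_def
  using nxt_mem_face_iff[OF quad_with_holesD(1)[OF assms(1)] assms(2)] quad_with_holesD(2)[OF assms(1)]
  by blast

lemma hole_darts_subset:
  assumes "quad_with_holes q"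
  shows "hole_darts q \<subseteq> darts q"
  unfolding hole_darts_def
  using face_at_subset[OF quad_with_holesD(1)[OF assms]] quad_with_holesD(2)[OF assms] by blast

lemma root_notin_holes:
  assumes "quad_with_holes q"
  shows "root_dart q \<notin> hole_darts q"
proof
  assume "root_dart q \<in> hole_darts q"
  then obtain h where h: "h \<in> marks q" "root_dart q \<in> face_at q h" by (auto simp: hole_darts_def)
  have "face_at q (root_dart q) = face_at q h"
    using face_at_eq[OF quad_with_holesD(1)[OF assms] _ h(2)] h(1) quad_with_holesD(2)[OF assms] by auto
  then show False using quad_with_holesD(4)[OF assms] h(1) by (auto simp: root_face_def)
qed

lemma hole_mark_eq:
  assumes "quad_with_holes q" "h \<in> marks q" "a \<in> face_at q h"
  shows "hole_mark q a = h"
  unfolding hole_mark_def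
proof (rule the_equality)
  show "h \<in> marks q \<and> a \<in> face_at q h" using assms by simp
  fix h' assume h': "h' \<in> marks q \<and> a \<in> face_at q h'"
  have "face_at q h' = face_at q h"
    using face_at_eq[OF quad_with_holesD(1)[OF assms(1)]] h' assms quad_with_holesD(2)[OF assms(1)]
    by (metis subsetD)
  then show "h' = h" using quad_with_holesD(3)[OF assms(1)] h' assms(2) by (auto dest: inj_onD)
qed

text \<open>\<open>G h\<close> is defined on the root face of \<open>u h\<close> as well, although
  those darts disappear. By \<open>FG\<close> they have the same images in \<open>m\<close> as the
  outer darts of \<open>q\<close> that replace them. Crossing the identified boundary is thus
  invisible in \<open>m\<close>, and \<open>opp\<close> can be checked on \<open>q\<close> and on
  each \<open>u h\<close> separately.\<close>

lemma glue_iso: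
  fixes q :: "'a hmap" and u :: "'a \<Rightarrow> 'b rmap" and m :: "'c rmap"
  assumes q: "quad_with_holes q"
    and out: "\<And>a. a \<in> hole_darts q \<Longrightarrow> opp q a \<notin> hole_darts q"
    and u: "\<And>h. h \<in> marks q \<Longrightarrow> planar_map (u h) \<and> perimeter (u h) = hole_per q h"
    and FG: "\<And>h k. h \<in> marks q \<Longrightarrow> k < hole_per q h \<Longrightarrow>
      F (opp q ((nxt q ^^ (hole_per q h - k)) h)) = G h ((nxt (u h) ^^ k) (root_dart (u h)))"
    and G_opp: "\<And>h b. h \<in> marks q \<Longrightarrow> b \<in> darts (u h) \<Longrightarrow> G h (opp (u h) b) = opp m (G h b)"
    and F_opp: "\<And>d. d \<in> darts q \<Longrightarrow> d \<notin> hole_darts q \<Longrightarrow> opp q d \<notin> hole_darts q \<Longrightarrow>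
      F (opp q d) = opp m (F d)"
    and G_nxt: "\<And>h b. h \<in> marks q \<Longrightarrow> b \<in> darts (u h) - root_face (u h) \<Longrightarrow>
      G h (nxt (u h) b) = nxt m (G h b)"
    and F_nxt: "\<And>d. d \<in> darts q \<Longrightarrow> d \<notin> hole_darts q \<Longrightarrow> F (nxt q d) = nxt m (F d)"
    and F_root: "F (root_dart q) = root_dart m"
    and bij: "bij_betw (case_sum F (\<lambda>(h, b). G h b)) (darts (glue q u)) (darts m)"
  shows "rmap_iso (glue q u) m" and "iso_class (glue q u) = iso_class m"
proof -
  let ?f = "case_sum F (\<lambda>(h, b). G h b)"
  let ?g = "glue q u"
  note pq = quad_with_holesD(1)[OF q] and mk = quad_with_holesD(2)[OF q]
  have mD: "h \<in> darts q" if "h \<in> marks q" for h using mk that by auto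
  have D: "darts ?g = Inl ` (darts q - hole_darts q) \<union>
      (\<Union>h\<in>marks q. Inr ` ({h} \<times> (darts (u h) - root_face (u h))))"
    by (simp add: glue_def)
  have per: "card (face_at (u h) (root_dart (u h))) = card (face_at q h)" if "h \<in> marks q" for h
    using u[OF that] by (simp add: perimeter_def root_face_def hole_per_def)
  have leave: "?f (leave q u h b) = G h b \<and> leave q u h b \<in> darts ?g"
    if h: "h \<in> marks q" and b: "b \<in> darts (u h)" for h b
  proof (cases "b \<in> root_face (u h)")
    case True
    let ?n = "card (face_at q h)" and ?r = "root_dart (u h)"
    have pu: "planar_map (u h)" and ru: "?r \<in> darts (u h)" using u[OF h] planar_mapD(2) by auto
    note PU = face_period[OF pu ru, unfolded per[OF h]]
    obtain k where k: "k < ?n" "b = (nxt (u h) ^^ (?n - k)) ?r"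
      using PU(4) True by (auto simp: root_face_def)
    have c: "cross (nxt (u h)) ?r (nxt q) h b = (nxt q ^^ k) h"
      unfolding k(2) by (rule cross_funpow[OF PU(1) k(1)])
    \<comment> \<open>\<open>j\<close> is \<open>- k\<close> modulo \<open>?n\<close>: counted
      forwards from the root of \<open>u h\<close>, as in \<open>FG\<close>, the dart
      \<open>b\<close> has index \<open>j\<close>.\<close>
    define j where "j = (if k = 0 then 0 else ?n - k)"
    have j: "j < ?n" using k(1) by (auto simp: j_def)
    have hk: "(nxt q ^^ k) h = (nxt q ^^ (?n - j)) h"
      using k(1) face_period(1)[OF pq mD[OF h], of ?n] by (auto simp: j_def)
    have bj: "b = (nxt (u h) ^^ j) ?r"
      using k PU(1)[of ?n] by (auto simp: j_def)
    have l: "leave q u h b = Inl (opp q ((nxt q ^^ (?n - j)) h))"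
      using True unfolding leave_def c hk by simp
    have "(nxt q ^^ (?n - j)) h \<in> hole_darts q"
      using face_period(5)[OF pq mD[OF h]] h unfolding hole_darts_def by auto
    then have "opp q ((nxt q ^^ (?n - j)) h) \<in> darts q - hole_darts q"
      using out hole_darts_subset[OF q] planar_mapD(3)[OF pq] by auto
    then show ?thesis using FG[OF h, of j] j bj unfolding l D by (auto simp: hole_per_def)
  next
    case False
    then show ?thesis using h b unfolding D leave_def by auto
  qed
  have opp_hole: "?f (opp ?g (Inl d)) = opp m (F d) \<and> opp ?g (Inl d) \<in> darts ?g"
    if d: "d \<in> darts q" "opp q d \<in> hole_darts q" for d
  proof -
    obtain h where h: "h \<in> marks q" "opp q d \<in> face_at q h" using d(2) by (auto simp: hole_darts_def)
    let ?n = "card (face_at q h)" and ?r = "root_dart (u h)"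
    have pu: "planar_map (u h)" and ru: "?r \<in> darts (u h)" using u[OF h(1)] planar_mapD(2) by auto
    note PU = face_period[OF pu ru, unfolded per[OF h(1)]]
    obtain k where k: "k < ?n" "opp q d = (nxt q ^^ (?n - k)) h"
      using face_period(4)[OF pq mD[OF h(1)] h(2)] by auto
    have c: "cross (nxt q) h (nxt (u h)) ?r (opp q d) = (nxt (u h) ^^ k) ?r"
      unfolding k(2) by (rule cross_funpow[OF face_period(1)[OF pq mD[OF h(1)]] k(1)])
    let ?e = "(nxt (u h) ^^ k) ?r"
    have e: "?e \<in> darts (u h)" using PU(5)[of k] face_at_subset[OF pu ru] by auto
    have o: "opp ?g (Inl d) = leave q u h (opp (u h) ?e)"
      using d(2) hole_mark_eq[OF q h] c by (simp add: glue_def Let_def)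
    have oe: "opp (u h) ?e \<in> darts (u h)" using planar_mapD(3)[OF pu e] .
    have "F d = G h ?e"
      using FG[OF h(1), of k] k planar_mapD(5)[OF pq d(1)] by (simp add: hole_per_def)
    then show ?thesis using leave[OF h(1) oe] G_opp[OF h(1) e] unfolding o by simp
  qed
  have opp_all: "?f (opp ?g x) = opp m (?f x) \<and> opp ?g x \<in> darts ?g" if x: "x \<in> darts ?g" for x
  proof (cases x)
    case (Inl d)
    then have d: "d \<in> darts q" "d \<notin> hole_darts q" using x D by auto
    show ?thesis
    proof (cases "opp q d \<in> hole_darts q")
      case True
      then show ?thesis using opp_hole[OF d(1)] Inl by simp
    next
      case False
      then have "opp ?g x = Inl (opp q d)" using Inl by (simp add: glue_def Let_def)
      then show ?thesis using F_opp[OF d False] False planar_mapD(3)[OF pq d(1)] Inl D by simp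
    qed
  next
    case (Inr p)
    obtain h b where p: "p = (h, b)" by (cases p)
    have h: "h \<in> marks q" "b \<in> darts (u h)" using x D Inr p by auto
    have "opp ?g x = leave q u h (opp (u h) b)" using Inr p by (simp add: glue_def)
    moreover have "opp (u h) b \<in> darts (u h)" using u[OF h(1)] planar_mapD(3) h(2) by auto
    ultimately show ?thesis using leave[OF h(1)] G_opp[OF h] Inr p by simp
  qed
  have nxt_all: "?f (nxt ?g x) = nxt m (?f x) \<and> nxt ?g x \<in> darts ?g" if x: "x \<in> darts ?g" for x
  proof (cases x)
    case (Inl d)
    then have d: "d \<in> darts q" "d \<notin> hole_darts q" using x D by auto
    have "nxt q d \<in> darts q - hole_darts q"
      using nxt_mem_hole_iff[OF q d(1)] d(2) planar_mapD(8)[OF pq d(1)] by simp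
    then show ?thesis using F_nxt[OF d] Inl unfolding D by (simp add: glue_def)
  next
    case (Inr p)
    obtain h b where p: "p = (h, b)" by (cases p)
    have h: "h \<in> marks q" "b \<in> darts (u h) - root_face (u h)" using x D Inr p by auto
    have pu: "planar_map (u h)" using u[OF h(1)] by simp
    have "nxt (u h) b \<in> darts (u h) - root_face (u h)"
      using nxt_mem_face_iff[OF pu, of b "root_dart (u h)"] planar_mapD(2,8)[OF pu] h(2)
      by (auto simp: root_face_def)
    then show ?thesis using G_nxt[OF h] Inr p h(1) unfolding D by (auto simp: glue_def)
  qed
  have root: "root_dart ?g = Inl (root_dart q)" by (simp add: glue_def)
  show iso: "rmap_iso ?g m"
    unfolding rmap_iso_def using bij opp_all nxt_all F_root root
    by (intro exI[of _ ?f]) auto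
  have "root_dart ?g \<in> darts ?g"
    unfolding root D using root_notin_holes[OF q] planar_mapD(2)[OF pq] by auto
  moreover have "wf_rmap ?g" using opp_all nxt_all by (auto simp: wf_rmap_def)
  ultimately show "iso_class ?g = iso_class m" by (intro iso_class_eqI[OF iso])
qed

text \<open>Gluing keeps the root face of \<open>q\<close>, so the place of the opposite of the root
  dart along it is an isomorphism invariant of the glued map that can be read off \<open>q\<close>.
  It separates the events in \<open>tutte_inequality\<close>.\<close>

lemma glue_root_position:
  assumes q: "quad_with_holes q" and out: "opp q (root_dart q) \<notin> hole_darts q"
    and iso: "rmap_iso (glue q u) m"
  shows "(nxt m ^^ k) (root_dart m) = opp m (root_dart m) \<longleftrightarrow>
    (nxt q ^^ k) (root_dart q) = opp q (root_dart q)"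
proof -
  let ?g = "glue q u"
  note pq = quad_with_holesD(1)[OF q]
  obtain f where f: "bij_betw f (darts ?g) (darts m)" "f (root_dart ?g) = root_dart m"
    "\<And>d. d \<in> darts ?g \<Longrightarrow> f (opp ?g d) = opp m (f d) \<and> f (nxt ?g d) = nxt m (f d)"
    using iso unfolding rmap_iso_def by blast
  have root: "root_dart ?g = Inl (root_dart q)" by (simp add: glue_def)
  have mem: "Inl d \<in> darts ?g \<longleftrightarrow> d \<in> darts q \<and> d \<notin> hole_darts q" for d
    by (auto simp: glue_def)
  have k: "(nxt q ^^ k) (root_dart q) \<in> darts q \<and> (nxt q ^^ k) (root_dart q) \<notin> hole_darts q" for k
    by (induction k)
       (use planar_mapD(2,8)[OF pq] root_notin_holes[OF q] nxt_mem_hole_iff[OF q] in auto)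
  have fk: "f (Inl ((nxt q ^^ k) (root_dart q))) = (nxt m ^^ k) (root_dart m)" for k
  proof (induction k)
    case 0
    then show ?case using f(2) root by simp
  next
    case (Suc k)
    have "nxt ?g (Inl ((nxt q ^^ k) (root_dart q))) = Inl ((nxt q ^^ Suc k) (root_dart q))"
      by (simp add: glue_def)
    then show ?case using f(3)[of "Inl ((nxt q ^^ k) (root_dart q))"] k[of k] Suc mem by simp
  qed
  have "opp ?g (Inl (root_dart q)) = Inl (opp q (root_dart q))"
    using out by (simp add: glue_def Let_def)
  then have fo: "f (Inl (opp q (root_dart q))) = opp m (root_dart m)"
    using f(3)[of "Inl (root_dart q)"] k[of 0] mem f(2) root by simp
  have "Inl (opp q (root_dart q)) \<in> darts ?g" "Inl ((nxt q ^^ k) (root_dart q)) \<in> darts ?g"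
    using mem out k planar_mapD(2,3)[OF pq] by auto
  then show ?thesis unfolding fk[symmetric] fo[symmetric] using f(1)
    by (auto simp: bij_betw_def dest: inj_onD)
qed

section \<open>Maps with one square or one bridge and holes\<close>

text \<open>By \<open>orbits_by_label\<close> the classes of \<open>vf\<close> and \<open>vv\<close>
  are the faces and vertices, so Euler's relation becomes a count of labels; it is doubled because
  there are twice as many darts as edges. In \<open>conn\<close> a face may be entered as a
  whole.\<close>

lemma planar_by_labels:
  fixes m :: "('d, 'x) rmap_scheme"
  assumes fin: "finite (darts m)" and root: "root_dart m \<in> darts m"
    and opp: "\<And>d. d \<in> darts m \<Longrightarrow> opp m d \<in> darts m \<and> opp m d \<noteq> d \<and> opp m (opp m d) = d"
    and nxt: "nxt m ` darts m \<subseteq> darts m" "inj_on (nxt m) (darts m)"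
    and face_inv: "\<And>d. d \<in> darts m \<Longrightarrow> vf (nxt m d) = vf d"
    and face_reach: "\<And>d. d \<in> darts m \<Longrightarrow> \<exists>k. (nxt m ^^ k) d = rf (vf d)"
    and vertex_inv: "\<And>d. d \<in> darts m \<Longrightarrow> vv (nxt m (opp m d)) = vv d"
    and vertex_reach: "\<And>d. d \<in> darts m \<Longrightarrow> \<exists>k. ((nxt m \<circ> opp m) ^^ k) d = rv (vv d)"
    and conn: "\<And>S. S \<subseteq> darts m \<Longrightarrow> root_dart m \<in> S \<Longrightarrow> (\<And>d. d \<in> S \<Longrightarrow> opp m d \<in> S) \<Longrightarrow>
      (\<And>d e. d \<in> S \<Longrightarrow> e \<in> darts m \<Longrightarrow> vf e = vf d \<Longrightarrow> e \<in> S) \<Longrightarrow> darts m \<subseteq> S"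
    and euler: "2 * (card (vv ` darts m) + card (vf ` darts m)) = card (darts m) + 4"
  shows "planar_map m"
    and "\<And>d. d \<in> darts m \<Longrightarrow> face_at m d = {e \<in> darts m. vf e = vf d}"
    and "\<And>d. d \<in> darts m \<Longrightarrow> vertex_at m d = {e \<in> darts m. vv e = vv d}"
proof -
  have bij: "bij_betw (nxt m) (darts m) (darts m)"
    using nxt fin by (simp add: bij_betw_def endo_inj_surj)
  have bo: "bij_betw (opp m) (darts m) (darts m)"
    using opp by (intro bij_betwI[where g = "opp m"]) auto
  have bs: "bij_betw (nxt m \<circ> opp m) (darts m) (darts m)"
    using bij_betw_trans[OF bo bij] .
  note F = orbits_by_label[OF fin nxt face_inv face_reach]
  have s: "(nxt m \<circ> opp m) ` darts m \<subseteq> darts m" "inj_on (nxt m \<circ> opp m) (darts m)"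
    using bs by (auto simp: bij_betw_def)
  have vi: "vv ((nxt m \<circ> opp m) d) = vv d" if "d \<in> darts m" for d
    using vertex_inv[OF that] by simp
  note V = orbits_by_label[OF fin s vi vertex_reach]
  show fa: "face_at m d = {e \<in> darts m. vf e = vf d}" if "d \<in> darts m" for d
    unfolding face_at_def by (rule F(1)[OF _ _ that])
  show "vertex_at m d = {e \<in> darts m. vv e = vv d}" if "d \<in> darts m" for d
    unfolding vertex_at_def by (rule V(1)[OF _ _ that])
  have "map_connected m"
  proof (rule map_connected_to_root[OF fin _ bij _ root])
    show "opp m d \<in> darts m \<and> opp m (opp m d) = d" if "d \<in> darts m" for d
      using opp that by simp
    fix S assume S: "S \<subseteq> darts m" "root_dart m \<in> S" "opp m ` S \<subseteq> S"
      and iff: "\<And>d. d \<in> darts m \<Longrightarrow> nxt m d \<in> S \<longleftrightarrow> d \<in> S"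
    have "e \<in> S" if d: "d \<in> S" and e: "e \<in> darts m" "vf e = vf d" for d e
    proof -
      have "e \<in> orbit (nxt m) d" using fa[of d] d e S(1) by (auto simp: face_at_def)
      moreover have "orbit (nxt m) d \<subseteq> S"
        by (rule orbit_subset_carrier[OF _ d]) (use iff S(1) in auto)
      ultimately show ?thesis by auto
    qed
    then have "darts m \<subseteq> S" using S by (intro conn) auto
    then show "S = darts m" using S(1) by auto
  qed
  moreover have "card (map_vertices m) + card (map_faces m) = card (map_edges m) + 2"
  proof -
    have "card (map_faces m) = card (vf ` darts m)"
      unfolding map_faces_def face_at_def[abs_def] by (rule F(2))
    moreover have "card (map_vertices m) = card (vv ` darts m)"
      unfolding map_vertices_def vertex_at_def[abs_def] by (rule V(2))
    ultimately show ?thesis using euler card_map_edges[OF fin opp] by simp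
  qed
  ultimately show "planar_map m"
    unfolding planar_map_def using fin root opp bij by blast
qed

section \<open>Iteration along arithmetic runs of numbers\<close>

lemma funpow_run_up:
  fixes f :: "nat \<Rightarrow> nat"
  assumes "\<And>d. a \<le> d \<Longrightarrow> d < b \<Longrightarrow> f d = Suc d" "a \<le> d" "d + k \<le> b"
  shows "(f ^^ k) d = d + k"
  using assms(2,3) by (induction k) (auto simp: assms(1))

lemma funpow_run_down:
  fixes f :: "nat \<Rightarrow> nat"
  assumes "\<And>d. a < d \<Longrightarrow> d \<le> b \<Longrightarrow> f d = d - 1" "a + k \<le> d" "d \<le> b"
  shows "(f ^^ k) d = d - k"
  using assms(2,3) by (induction k) (auto simp: assms(1))

lemma funpow_run_by2:
  fixes f :: "nat \<Rightarrow> nat"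
  assumes "\<And>d. a \<le> d \<Longrightarrow> d < b \<Longrightarrow> even d = even a \<Longrightarrow> f d = d + 2"
    "a \<le> d" "d + 2 * k \<le> b" "even d = even a"
  shows "(f ^^ k) d = d + 2 * k"
  using assms(2-4) by (induction k) (auto simp: assms(1))

lemma reach_refl: "\<exists>j. (f ^^ j) d = d"
  by (rule exI[of _ 0]) simp

lemma reach_trans:
  assumes "\<exists>k. (f ^^ k) d = e" "\<exists>k. (f ^^ k) e = c"
  shows "\<exists>k. (f ^^ k) d = c"
  using assms by (metis funpow_add o_apply)

lemma reach_step:
  assumes "\<exists>k. (f ^^ k) (f d) = c"
  shows "\<exists>k. (f ^^ k) d = c"
  using assms by (metis funpow_Suc_right o_apply)

lemma reach_within2:
  assumes "c = d \<or> f d = c \<or> f (f d) = c"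
  shows "\<exists>k. (f ^^ k) d = c"
  using assms reach_refl[of f d] reach_step[of f d c] reach_step[of f "f d" c] reach_refl[of f c] by auto

lemma reach_up:
  fixes f :: "nat \<Rightarrow> nat"
  assumes "\<And>d. a \<le> d \<Longrightarrow> d < b \<Longrightarrow> f d = Suc d" "a \<le> d" "d \<le> b" "f b = c"
  shows "\<exists>k. (f ^^ k) d = c"
proof -
  have "(f ^^ (b - d)) d = d + (b - d)" by (rule funpow_run_up[of a b]) (use assms in auto)
  then have "(f ^^ Suc (b - d)) d = c" using assms(3,4) by simp
  then show ?thesis by blast
qed

lemma reach_down:
  fixes f :: "nat \<Rightarrow> nat"
  assumes "\<And>d. a < d \<Longrightarrow> d \<le> b \<Longrightarrow> f d = d - 1" "a \<le> d" "d \<le> b"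
  shows "\<exists>k. (f ^^ k) d = a"
proof -
  have "(f ^^ (d - a)) d = d - (d - a)" by (rule funpow_run_down[of a b]) (use assms in auto)
  then show ?thesis using assms(2) by (intro exI[of _ "d - a"]) simp
qed

lemma reach_by2:
  fixes f :: "nat \<Rightarrow> nat"
  assumes "\<And>d. a \<le> d \<Longrightarrow> d < b \<Longrightarrow> even d = even a \<Longrightarrow> f d = d + 2"
    "a \<le> d" "d \<le> b" "even d = even a" "even b = even a"
  shows "\<exists>k. (f ^^ k) d = b"
proof -
  define k where "k = (b - d) div 2"
  have "even (b - d)" using assms(3-5) by simp
  then have k: "d + 2 * k = b" using assms(3) by (simp add: k_def)
  have "(f ^^ k) d = d + 2 * k"
    by (rule funpow_run_by2[of a b]) (use assms k in auto)
  then show ?thesis using k by auto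
qed

text \<open>
  The root edge of the face \<open>2 n, 3, ..., n - 1\<close> is also on the square \<open>2 n + 1, 0, 1, 2\<close>; the
  remaining edges \<open>k < n\<close> of both surround the hole \<open>n, ..., 2 n - 1\<close>.
\<close>

definition quad_hole :: "nat \<Rightarrow> nat hmap" where
  "quad_hole n =
     \<lparr> darts = {..<2 * n + 2},
       opp = (\<lambda>d. if d < n then d + n else if d < 2 * n then d - n
                 else if d = 2 * n then 2 * n + 1 else 2 * n),
       nxt = (\<lambda>d. if d = 2 then 2 * n + 1 else if d < n - 1 then d + 1 else if d = n - 1 then 2 * n
                 else if d = n then 2 * n - 1 else if d < 2 * n then d - 1
                 else if d = 2 * n then 3 else 0),
       root_dart = 2 * n, marks = {n} \<rparr>"

lemma quad_hole_simps:
  "darts (quad_hole n) = {..<2 * n + 2}"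
  "opp (quad_hole n) d = (if d < n then d + n else if d < 2 * n then d - n
      else if d = 2 * n then 2 * n + 1 else 2 * n)"
  "nxt (quad_hole n) d = (if d = 2 then 2 * n + 1 else if d < n - 1 then d + 1
      else if d = n - 1 then 2 * n else if d = n then 2 * n - 1 else if d < 2 * n then d - 1
      else if d = 2 * n then 3 else 0)"
  "root_dart (quad_hole n) = 2 * n" "marks (quad_hole n) = {n}"
  by (simp_all add: quad_hole_def)

text \<open>\<open>vf\<close> is 0 on the square, 1 on the root face and 2 on the hole. Every vertex
  lies on the hole, and vertex \<open>l\<close> is represented by its only hole dart
  \<open>n + l\<close>; hence there are \<open>n\<close> vertices and 3 faces on
  \<open>2 * n + 2\<close> darts.\<close>

lemma quad_hole_planar:
  assumes n: "4 \<le> n"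
  defines "vf \<equiv> \<lambda>d. if d < 3 \<or> d = 2 * n + 1 then 0 else if d < n \<or> d = 2 * n then 1 else (2::nat)"
    and "vv \<equiv> \<lambda>d. if d = 0 \<or> d = 2 * n then n - 1 else if d < n then d - 1 else if d < 2 * n then d - n else 2"
  shows "planar_map (quad_hole n)"
    and "\<And>d. d < 2 * n + 2 \<Longrightarrow> face_at (quad_hole n) d = {e. e < 2 * n + 2 \<and> vf e = vf d}"
    and "\<And>d. d < 2 * n + 2 \<Longrightarrow> vertex_at (quad_hole n) d = {e. e < 2 * n + 2 \<and> vv e = vv d}"
proof -
  let ?q = "quad_hole n"
  define rf where "rf l = (if l = 0 then 0 else if l = 1 then 2 * n else n)" for l :: nat
  define rv where "rv l = n + l" for l :: nat
  note S = quad_hole_simps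
  obtain c where c: "n = c + 4" using n by (metis add.commute le_Suc_ex)
  have D: "d \<in> darts ?q \<longleftrightarrow> d < 2 * n + 2" for d by (simp add: S)
  have P1: "finite (darts ?q)" "root_dart ?q \<in> darts ?q" by (simp_all add: S)
  have P2: "opp ?q d \<in> darts ?q \<and> opp ?q d \<noteq> d \<and> opp ?q (opp ?q d) = d" if "d \<in> darts ?q" for d
    using that by (auto simp: S c)
  have P3: "nxt ?q ` darts ?q \<subseteq> darts ?q" by (auto simp: S c)
  have P4: "inj_on (nxt ?q) (darts ?q)"
  proof (rule inj_on_inverseI)
    let ?p = "\<lambda>e. if e = 0 then 2 * n + 1 else if e = 2 * n + 1 then 2 else if e = 3 then 2 * n
      else if e < n then e - 1 else if e = 2 * n then n - 1 else if e = 2 * n - 1 then n else e + 1"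
    show "?p (nxt ?q d) = d" if dD: "d \<in> darts ?q" for d
    proof -
      have dl: "d < 2 * n + 2" using dD by (simp add: S)
      consider "d = 0" | "d = 1" | "d = 2" | "d = 2 * n + 1" | "d = 2 * n" | "3 \<le> d" "d < n - 1"
        | "d = n - 1" | "d = n" | "n < d" "d < 2 * n" using dl by linarith
      then show ?thesis by cases (auto simp: S c)
    qed
  qed
  have P5: "vf (nxt ?q d) = vf d" if dD: "d \<in> darts ?q" for d
  proof -
    have dl: "d < 2 * n + 2" using dD by (simp add: S)
    consider "d = 0" | "d = 1" | "d = 2" | "d = 2 * n + 1" | "d = 2 * n" | "3 \<le> d" "d < n - 1"
      | "d = n - 1" | "d = n" | "n < d" "d < 2 * n" using dl by linarith
    then show ?thesis by cases (auto simp: S c vf_def)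
  qed
  have P6: "vv (nxt ?q (opp ?q d)) = vv d" if dD: "d \<in> darts ?q" for d
  proof -
    have dl: "d < 2 * n + 2" using dD by (simp add: S)
    consider "d = 0" | "d = 1" | "d = 2" | "d = 2 * n + 1" | "d = 2 * n" | "3 \<le> d" "d < n"
      | "n \<le> d" "d < n + 2" | "d = n + 2" | "n + 2 < d" "d < 2 * n - 1" | "d = 2 * n - 1"
      using dl by linarith
    then show ?thesis by cases (auto simp: S c vv_def)
  qed
  have R1: "\<exists>k. (nxt ?q ^^ k) d = rf (vf d)" if d: "d \<in> darts ?q" for d
  proof -
    have n0: "nxt ?q (2 * n + 1) = 0" "nxt ?q 0 = 1" "nxt ?q 1 = 2" "nxt ?q 2 = 2 * n + 1"
      by (simp_all add: S c)
    have r0: "\<exists>k. (nxt ?q ^^ k) (2 * n + 1) = 0"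
      using reach_step[of "nxt ?q" "2 * n + 1" 0] reach_refl[of "nxt ?q" 0] unfolding n0(1) by blast
    have r2: "\<exists>k. (nxt ?q ^^ k) 2 = 0"
      using reach_step[of "nxt ?q" 2 0] r0 unfolding n0(4) by blast
    have r1: "\<exists>k. (nxt ?q ^^ k) 1 = 0"
      using reach_step[of "nxt ?q" 1 0] r2 unfolding n0(3) by blast
    have dl: "d < 2 * n + 2" using d by (simp add: S)
    consider "d = 0" | "d = 1" | "d = 2" | "d = 2 * n + 1" | "d = 2 * n" | "3 \<le> d" "d < n"
      | "n \<le> d" "d < 2 * n" using dl by linarith
    then show ?thesis
    proof cases
      case 1
      then show ?thesis by (simp add: rf_def vf_def reach_refl)
    next
      case 2
      then have "rf (vf d) = 0" by (simp add: rf_def vf_def)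
      then show ?thesis using r1 2 by simp
    next
      case 3
      then have "rf (vf d) = 0" by (simp add: rf_def vf_def)
      then show ?thesis using r2 3 by simp
    next
      case 4
      then have "rf (vf d) = 0" by (simp add: rf_def vf_def)
      then show ?thesis using r0 4 by simp
    next
      case 5
      then show ?thesis using n by (simp add: rf_def vf_def reach_refl)
    next
      case 6
      have r: "rf (vf d) = 2 * n" using 6 n by (simp add: rf_def vf_def)
      show ?thesis unfolding r by (rule reach_up[of 3 "n - 1"]) (use 6 n in \<open>auto simp: S\<close>)
    next
      case 7
      have r: "rf (vf d) = n" using 7 n by (simp add: rf_def vf_def)
      show ?thesis unfolding r by (rule reach_down[of n "2 * n - 1"]) (use 7 n in \<open>auto simp: S\<close>)
    qed
  qed
  have R2: "\<exists>k. ((nxt ?q \<circ> opp ?q) ^^ k) d = rv (vv d)" if d: "d \<in> darts ?q" for d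
  proof -
    have dl: "d < 2 * n + 2" using d by (simp add: S)
    have "n \<le> d \<and> d < 2 * n \<or> d < n \<or> d = 2 * n \<or> d = 2 * n + 1" using dl by linarith
    \<comment> \<open>The ends of the root edge have degree 3 and all other vertices degree 2, so at
      most two rotation steps lead to the hole dart.\<close>
    then show ?thesis by (intro reach_within2) (elim disjE, auto simp: rv_def vv_def S c)
  qed
  have C: "darts ?q \<subseteq> T" if T: "T \<subseteq> darts ?q" "root_dart ?q \<in> T" "\<And>d. d \<in> T \<Longrightarrow> opp ?q d \<in> T"
    "\<And>d e. d \<in> T \<Longrightarrow> e \<in> darts ?q \<Longrightarrow> vf e = vf d \<Longrightarrow> e \<in> T" for T
  proof
    have r: "2 * n \<in> T" using T(2) by (simp add: S)
    then have s: "2 * n + 1 \<in> T" using T(3)[of "2 * n"] n by (simp add: S)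
    have low: "d \<in> T" if "d < n" for d
    proof (cases "d < 3")
      case True
      then have "vf d = vf (2 * n + 1)" by (simp add: vf_def)
      then show ?thesis using T(4)[OF s, of d] that by (simp add: S)
    next
      case False
      then have "vf d = vf (2 * n)" using that by (simp add: vf_def)
      then show ?thesis using T(4)[OF r, of d] that by (simp add: S)
    qed
    fix d assume "d \<in> darts ?q"
    then have "d < 2 * n + 2" by (simp add: S)
    then consider "d < n" | "n \<le> d" "d < 2 * n" | "d = 2 * n" | "d = 2 * n + 1"
      by linarith
    then show "d \<in> T"
    proof cases
      case 2
      then show ?thesis using T(3)[OF low[of "d - n"]] by (simp add: S)
    qed (use r s low in auto)
  qed
  have vvD: "vv ` darts ?q = {..<n}"
  proof
    show "vv ` darts ?q \<subseteq> {..<n}" by (auto simp: S vv_def c)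
    show "{..<n} \<subseteq> vv ` darts ?q"
    proof
      fix k assume "k \<in> {..<n}"
      then show "k \<in> vv ` darts ?q"
        by (intro image_eqI[of _ _ "n + k"]) (auto simp: S vv_def)
    qed
  qed
  have vfD: "vf ` darts ?q = {0, 1, 2}"
  proof
    show "vf ` darts ?q \<subseteq> {0, 1, 2}" by (auto simp: vf_def)
    have "vf 0 = 0" "vf (2 * n) = 1" "vf n = 2" using n by (auto simp: vf_def)
    moreover have "0 \<in> darts ?q" "2 * n \<in> darts ?q" "n \<in> darts ?q" by (auto simp: S)
    ultimately show "{0, 1, 2} \<subseteq> vf ` darts ?q" by force
  qed
  have E: "2 * (card (vv ` darts ?q) + card (vf ` darts ?q)) = card (darts ?q) + 4"
    unfolding vvD vfD by (simp add: S)
  note P = planar_by_labels[where vf = vf and vv = vv and rf = rf and rv = rv, OF P1 P2 P3 P4 P5 R1 P6 R2 C E]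
  show "planar_map ?q" by (rule P(1))
  have F: "d \<in> darts ?q \<Longrightarrow> face_at ?q d = {e \<in> darts ?q. vf e = vf d}" for d by (rule P(2))
  have V: "d \<in> darts ?q \<Longrightarrow> vertex_at ?q d = {e \<in> darts ?q. vv e = vv d}" for d by (rule P(3))
  show "face_at ?q d = {e. e < 2 * n + 2 \<and> vf e = vf d}" if "d < 2 * n + 2" for d
    using F[of d] that by (simp only: D)
  show "vertex_at ?q d = {e. e < 2 * n + 2 \<and> vv e = vv d}" if "d < 2 * n + 2" for d
    using V[of d] that by (simp only: D)
qed

text \<open>Since \<open>nxt\<close> runs downwards on the hole, the \<open>k\<close>-th boundary
  edge of a filling is attached to the outer dart \<open>k\<close>; the numbering is made for this.
  That the root face never meets the opposite of the root dart distinguishes these maps from those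
  with a root bridge.\<close>

lemma quad_hole:
  assumes n: "4 \<le> n"
  shows "quad_with_holes (quad_hole n)" "hole_darts (quad_hole n) = {n..<2 * n}"
    "hole_per (quad_hole n) n = n"
    "(nxt (quad_hole n) ^^ k) (2 * n) \<noteq> 2 * n + 1"
    "k < n \<Longrightarrow> opp (quad_hole n) ((nxt (quad_hole n) ^^ (n - k)) n) = k"
proof -
  let ?q = "quad_hole n"
  note S = quad_hole_simps
  note P = quad_hole_planar[OF n]
  have Fn: "face_at ?q n = {n..<2 * n}" using n by (subst P(2)) auto
  have Fr: "face_at ?q (2 * n) = insert (2 * n) {3..<n}" using n by (subst P(2)) auto
  have Fs: "face_at ?q (2 * n + 1) = insert (2 * n + 1) {..<3}" using n by (subst P(2)) auto
  show H: "hole_darts ?q = {n..<2 * n}" by (simp add: hole_darts_def S Fn)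
  show "hole_per ?q n = n" by (simp add: hole_per_def Fn)
  have "card f = 4" if f: "f \<in> internal_faces ?q - face_at ?q ` marks ?q" for f
  proof -
    obtain d where d: "d < 2 * n + 2" "f = face_at ?q d"
      using f by (auto simp: internal_faces_def map_faces_def S)
    have pd: "face_at ?q d = face_at ?q e" if "d \<in> face_at ?q e" "e < 2 * n + 2" for e
      using face_at_eq[OF P(1) _ that(1)] that(2) by (simp add: S)
    have "f \<noteq> face_at ?q n" "f \<noteq> face_at ?q (2 * n)"
      using f by (auto simp: S internal_faces_def root_face_def)
    then have "d \<notin> face_at ?q n" "d \<notin> face_at ?q (2 * n)" using pd d by auto
    then have "d \<in> face_at ?q (2 * n + 1)" unfolding Fn Fr Fs using d(1) by auto
    then have "f = face_at ?q (2 * n + 1)" using pd d by simp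
    then show ?thesis unfolding Fs using n by simp
  qed
  moreover have "inj_on (vertex_at ?q) (hole_darts ?q)"
  proof (rule inj_onI)
    fix a b assume ab: "a \<in> hole_darts ?q" "b \<in> hole_darts ?q" "vertex_at ?q a = vertex_at ?q b"
    have "b \<in> vertex_at ?q b" using ab(2) P(3)[of b] unfolding H by simp
    then have "b \<in> vertex_at ?q a" using ab(3) by simp
    moreover have l: "n \<le> a" "a < 2 * n" "n \<le> b" "b < 2 * n" using ab(1,2) unfolding H by auto
    ultimately have "b - n = a - n" using P(3)[of a] by auto
    then show "a = b" using l by simp
  qed
  moreover have "root_face ?q \<notin> face_at ?q ` marks ?q"
    unfolding root_face_def S(4,5) using Fn Fr by auto
  ultimately show "quad_with_holes ?q"
    unfolding quad_with_holes_def using P(1) by (auto simp: S)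
  have "(nxt ?q ^^ k) (2 * n) \<in> face_at ?q (2 * n)"
    by (rule face_period(5)[OF P(1)]) (simp add: S)
  then show "(nxt ?q ^^ k) (2 * n) \<noteq> 2 * n + 1" unfolding Fr using n by auto
  show "opp ?q ((nxt ?q ^^ (n - k)) n) = k" if k: "k < n"
  proof -
    have 1: "nxt ?q n = 2 * n - 1" using n by (auto simp: S)
    have "(nxt ?q ^^ (n - k - 1)) (2 * n - 1) = 2 * n - 1 - (n - k - 1)"
      by (rule funpow_run_down[of n "2 * n - 1"]) (use n in \<open>auto simp: S\<close>)
    then have "(nxt ?q ^^ Suc (n - k - 1)) n = n + k"
      unfolding funpow_Suc_right o_apply 1 using k by simp
    moreover have "Suc (n - k - 1) = n - k" using k by simp
    ultimately have e: "(nxt ?q ^^ (n - k)) n = n + k" by (simp only:)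
    show ?thesis unfolding e using k by (simp add: S)
  qed
qed

text \<open>
  The root face is \<open>0, ..., N - 1\<close> with \<open>N = 2 (l1 + l2 + 1)\<close>; the root edge is the bridge joining
  \<open>0\<close> and \<open>p = 2 l1 + 1\<close>, and every other root face dart \<open>d\<close> is opposite to the hole dart \<open>N + d\<close>.
  A hole of perimeter \<open>0\<close> is absent.
\<close>

definition bridge_hole :: "nat \<Rightarrow> nat \<Rightarrow> nat hmap" where
  "bridge_hole l1 l2 =
     (let N = 2 * l1 + 2 * l2 + 2; p = 2 * l1 + 1 in
      \<lparr> darts = {..<2 * N} - {N, N + p},
        opp = (\<lambda>d. if d = 0 then p else if d = p then 0 else if d < N then d + N else d - N),
        nxt = (\<lambda>d. if d + 1 = N then 0 else if d < N then d + 1 else if d = N + 1 then N + 2 * l1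
                  else if d = N + p + 1 then 2 * N - 1 else d - 1),
        root_dart = 0,
        marks = (if l1 = 0 then {} else {N + 1}) \<union> (if l2 = 0 then {} else {N + p + 1}) \<rparr>)"

section \<open>The root bridge with at most two holes\<close>

context
  fixes l1 l2 N p :: nat and q :: "nat hmap"
  assumes N: "N = 2 * l1 + 2 * l2 + 2" and p: "p = 2 * l1 + 1" and q: "q = bridge_hole l1 l2"
begin

lemma bridge_hole_simps:
  "darts q = {..<2 * N} - {N, N + p}"
  "opp q d = (if d = 0 then p else if d = p then 0 else if d < N then d + N else d - N)"
  "nxt q d = (if d + 1 = N then 0 else if d < N then d + 1 else if d = N + 1 then N + 2 * l1
      else if d = N + p + 1 then 2 * N - 1 else d - 1)"
  "root_dart q = 0"
  "marks q = (if l1 = 0 then {} else {N + 1}) \<union> (if l2 = 0 then {} else {N + p + 1})"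
  by (simp_all add: q bridge_hole_def Let_def N p)

text \<open>A vertex on a hole is represented by its only hole dart \<open>N + l\<close>. Where a
  hole is absent, the end of the bridge has no hole dart: its label is 0 if \<open>l1 = 0\<close>
  and \<open>p\<close> if \<open>l2 = 0\<close>, values left free because \<open>N\<close> and
  \<open>N + p\<close> are not darts, and its representative is the side of the bridge that leaves
  it.\<close>

lemma bridge_hole_planar:
  defines "vf \<equiv> \<lambda>d. if d < N then 0 else if d < N + p then 1 else (2::nat)"
    and "vv \<equiv> \<lambda>d. if d < N then if d = 0 \<or> d = p + 1 then N - 1 else d - 1 + (if d = 1 then 2 * l1 else 0)
           else d - N"
  shows "planar_map q"
    and "\<And>d. d \<in> darts q \<Longrightarrow> face_at q d = {e \<in> darts q. vf e = vf d}"
    and "\<And>d. d \<in> darts q \<Longrightarrow> vertex_at q d = {e \<in> darts q. vv e = vv d}"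
proof -
  define rf where "rf l = (if l = 0 then 0 else if l = 1 then N + 1 else N + p + 1)" for l :: nat
  define rv where "rv l = (if l = 0 then p else if l = p then 0 else N + l)" for l :: nat
  note S = bridge_hole_simps
  have D: "d \<in> darts q \<longleftrightarrow> d < 2 * N \<and> d \<noteq> N \<and> d \<noteq> N + p" for d by (auto simp: S)
  have P1: "finite (darts q)" "root_dart q \<in> darts q" using N by (auto simp: S)
  have P2: "opp q d \<in> darts q \<and> opp q d \<noteq> d \<and> opp q (opp q d) = d" if "d \<in> darts q" for d
    using that N p unfolding D by (auto simp: S(2))
  \<comment> \<open>Ranges fine enough for simplification to resolve the branches of
    \<open>opp\<close>, \<open>nxt\<close> and the labels.\<close>
  have cs: "d = 0 \<or> d = 1 \<and> 0 < l1 \<or> 1 < d \<and> d < p \<or> d = p \<or> d = p + 1 \<and> d + 1 < N \<or> d = p + 1 \<and> d + 1 = N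
      \<or> p + 1 < d \<and> d + 1 < N \<or> p + 1 < d \<and> d + 1 = N
      \<or> d = N + 1 \<and> 0 < l1 \<or> N + 1 < d \<and> d < N + p \<or> d = N + p + 1 \<and> 0 < l2 \<or> N + p + 1 < d \<and> d < 2 * N - 1
      \<or> N + p + 1 < d \<and> d = 2 * N - 1"
    if d: "d \<in> darts q" for d
  proof -
    have b: "d < 2 * N" "d \<noteq> N" "d \<noteq> N + p" using d unfolding D by simp_all
    consider "d < p" | "d = p" | "p < d" "d < N" | "N < d" "d < N + p" | "N + p < d" using b by linarith
    then show ?thesis
    proof cases
      case 1
      have "d = 0 \<or> d = 1 \<or> 1 < d" by linarith
      moreover have "0 < l1" if "d = 1" using that 1 p by simp
      ultimately show ?thesis using 1 by blast
    next
      case 3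
      have "d = p + 1 \<or> p + 1 < d" "d + 1 = N \<or> d + 1 < N" using 3 by linarith+
      then show ?thesis by blast
    next
      case 4
      have "d = N + 1 \<or> N + 1 < d" using 4 by linarith
      moreover have "0 < l1" if "d = N + 1" using that 4 p by simp
      ultimately show ?thesis using 4 by blast
    next
      case 5
      have "d = N + p + 1 \<or> N + p + 1 < d" "d < 2 * N - 1 \<or> d = 2 * N - 1" using 5 b by linarith+
      moreover have "0 < l2" if "d = N + p + 1" using that b N p by simp
      ultimately show ?thesis using b by blast
    qed blast
  qed
  have P3: "nxt q ` darts q \<subseteq> darts q"
  proof
    fix e assume "e \<in> nxt q ` darts q"
    then obtain d where d: "d \<in> darts q" "e = nxt q d" by auto
    from cs[OF d(1)] show "e \<in> darts q" unfolding d(2) D by (elim disjE) (auto simp: S(3) N p)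
  qed
  have P4: "inj_on (nxt q) (darts q)"
  proof (rule inj_on_inverseI)
    let ?p = "\<lambda>e. if e = 0 then N - 1 else if e < N then e - 1 else if e = N + 2 * l1 then N + 1
       else if e = 2 * N - 1 then N + p + 1 else e + 1"
    show "?p (nxt q d) = d" if d: "d \<in> darts q" for d
      using cs[OF d] by (elim disjE) (auto simp: S(3) N p)
  qed
  have P5: "vf (nxt q d) = vf d" if d: "d \<in> darts q" for d
    using cs[OF d] by (elim disjE) (auto simp: S(3) N p vf_def)
  have P6: "vv (nxt q (opp q d)) = vv d" if d: "d \<in> darts q" for d
    using cs[OF d] by (elim disjE) (auto simp: S(2,3) N p vv_def)
  have R1: "\<exists>k. (nxt q ^^ k) d = rf (vf d)" if d: "d \<in> darts q" for d
  proof -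
    consider "d < N" | "N < d" "d < N + p" | "N + p < d" "d < 2 * N" using d D[of d] by linarith
    then show ?thesis
    proof cases
      case 1
      have r: "rf (vf d) = 0" using 1 by (simp add: rf_def vf_def)
      show ?thesis unfolding r by (rule reach_up[of 0 "N - 1"]) (use 1 in \<open>auto simp: S(3)\<close>)
    next
      case 2
      have r: "rf (vf d) = N + 1" using 2 by (simp add: rf_def vf_def)
      show ?thesis unfolding r
        by (rule reach_down[of "N + 1" "N + p - 1"]) (use 2 in \<open>auto simp: S(3)\<close>)
    next
      case 3
      have r: "rf (vf d) = N + p + 1" using 3 by (simp add: rf_def vf_def)
      show ?thesis unfolding r
        by (rule reach_down[of "N + p + 1" "2 * N - 1"]) (use 3 in \<open>auto simp: S(3)\<close>)
    qed
  qed
  have R2: "\<exists>k. ((nxt q \<circ> opp q) ^^ k) d = rv (vv d)" if d: "d \<in> darts q" for d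
  proof -
    have b: "d < 2 * N" "d \<noteq> N" "d \<noteq> N + p" using d unfolding D by simp_all
    have "d = 0 \<or> d = 1 \<and> 0 < l1 \<or> 1 < d \<and> d < p \<or> d = p \<or> d = p + 1 \<and> d < N
        \<or> p + 1 < d \<and> d < N \<or> N < d"
      using cs[OF d] by (elim disjE) simp_all
    moreover have "l1 = 0 \<or> 0 < l1" "l2 = 0 \<or> 0 < l2" by auto
    ultimately consider
        "d = 0 \<and> l2 = 0 \<or> d = p \<and> l1 = 0 \<or> N < d \<and> d < 2 * N \<and> d \<noteq> N + p"
      | "d = 1 \<and> 0 < l1 \<or> 1 < d \<and> d < p \<or> d = p + 1 \<and> d < N \<or> p + 1 < d \<and> d < N"
      | "d = 0 \<and> 0 < l2 \<or> d = p \<and> 0 < l1"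
      using b by blast
    then have "rv (vv d) = d \<or> (nxt q \<circ> opp q) d = rv (vv d) \<or> (nxt q \<circ> opp q) ((nxt q \<circ> opp q) d) = rv (vv d)"
    proof cases
      case 1
      then have "rv (vv d) = d" by (elim disjE) (auto simp: rv_def vv_def N p)
      then show ?thesis by (rule disjI1)
    next
      case 2
      then have "(nxt q \<circ> opp q) d = rv (vv d)"
        by (elim disjE) (auto simp: rv_def vv_def S(2,3) N p)
      then show ?thesis by blast
    next
      case 3
      then have "(nxt q \<circ> opp q) ((nxt q \<circ> opp q) d) = rv (vv d)"
        by (elim disjE) (auto simp: rv_def vv_def S(2,3) N p)
      then show ?thesis by blast
    qed
    then show ?thesis by (rule reach_within2)
  qed
  have C: "darts q \<subseteq> T" if T: "T \<subseteq> darts q" "root_dart q \<in> T" "\<And>d. d \<in> T \<Longrightarrow> opp q d \<in> T"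
    "\<And>d e. d \<in> T \<Longrightarrow> e \<in> darts q \<Longrightarrow> vf e = vf d \<Longrightarrow> e \<in> T" for T
  proof
    have r: "0 \<in> T" using T(2) by (simp add: S(4))
    have low: "d \<in> T" if dN: "d < N" for d
    proof -
      have "vf d = vf 0" using dN by (simp add: vf_def)
      moreover have "d \<in> darts q" using dN unfolding D by simp
      ultimately show ?thesis using T(4)[OF r, of d] by simp
    qed
    fix d assume d: "d \<in> darts q"
    show "d \<in> T"
    proof (cases "d < N")
      case False
      have l: "d - N < N" using d False unfolding D by auto
      have "opp q (d - N) = d" using d False unfolding D by (auto simp: S(2))
      then show ?thesis using T(3)[OF low[OF l]] by simp
    qed (rule low)
  qed
  have vvD: "vv ` darts q = (if l1 = 0 then {0} else {1..2 * l1}) \<union> (if l2 = 0 then {p} else {p + 1..<N})"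
  proof
    show "vv ` darts q \<subseteq> (if l1 = 0 then {0} else {1..2 * l1}) \<union> (if l2 = 0 then {p} else {p + 1..<N})"
    proof
      fix e assume "e \<in> vv ` darts q"
      then obtain d where d: "d \<in> darts q" "e = vv d" by auto
      from cs[OF d(1)] show "e \<in> (if l1 = 0 then {0} else {1..2 * l1}) \<union> (if l2 = 0 then {p} else {p + 1..<N})"
        unfolding d(2) by (elim disjE) (auto simp: vv_def N p)
    qed
    have a: "k \<in> vv ` darts q" if "0 < k" "k < N" "k \<noteq> p" for k
      by (rule image_eqI[of _ _ "N + k"]) (use that in \<open>auto simp: D vv_def\<close>)
    have b: "0 \<in> vv ` darts q" if "l1 = 0"
      by (rule image_eqI[of _ _ 1]) (use that N p in \<open>auto simp: D vv_def\<close>)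
    have c: "p \<in> vv ` darts q" if "l2 = 0"
      by (rule image_eqI[of _ _ 0]) (use that N p in \<open>auto simp: D vv_def\<close>)
    have a1: "{1..2 * l1} \<subseteq> vv ` darts q" using a N p by auto
    have a2: "{p + 1..<N} \<subseteq> vv ` darts q" using a by auto
    show "(if l1 = 0 then {0} else {1..2 * l1}) \<union> (if l2 = 0 then {p} else {p + 1..<N}) \<subseteq> vv ` darts q"
      using a1 a2 b c by (cases "l1 = 0"; cases "l2 = 0") simp_all
  qed
  have vfD: "vf ` darts q = {0} \<union> (if l1 = 0 then {} else {1}) \<union> (if l2 = 0 then {} else {2})"
  proof
    show "vf ` darts q \<subseteq> {0} \<union> (if l1 = 0 then {} else {1}) \<union> (if l2 = 0 then {} else {2})"
    proof
      fix e assume "e \<in> vf ` darts q"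
      then obtain d where d: "d \<in> darts q" "e = vf d" by auto
      from cs[OF d(1)] show "e \<in> {0} \<union> (if l1 = 0 then {} else {1}) \<union> (if l2 = 0 then {} else {2})"
        unfolding d(2) by (elim disjE) (auto simp: vf_def N p)
    qed
    have a: "0 \<in> vf ` darts q" by (rule image_eqI[of _ _ 0]) (use N in \<open>auto simp: D vf_def\<close>)
    have b: "1 \<in> vf ` darts q" if "l1 \<noteq> 0"
      by (rule image_eqI[of _ _ "N + 1"]) (use that N p in \<open>auto simp: D vf_def\<close>)
    have c: "2 \<in> vf ` darts q" if "l2 \<noteq> 0"
      by (rule image_eqI[of _ _ "N + p + 1"]) (use that N p in \<open>auto simp: D vf_def\<close>)
    show "{0} \<union> (if l1 = 0 then {} else {1}) \<union> (if l2 = 0 then {} else {2}) \<subseteq> vf ` darts q"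
      using a b c by (cases "l1 = 0"; cases "l2 = 0") simp_all
  qed
  have E: "2 * (card (vv ` darts q) + card (vf ` darts q)) = card (darts q) + 4"
  proof -
    have "card (darts q) = 2 * N - 2"
      unfolding S(1) by (subst card_Diff_subset) (auto simp: N p)
    moreover have "card (vv ` darts q) = (if l1 = 0 then 1 else 2 * l1) + (if l2 = 0 then 1 else 2 * l2)"
      unfolding vvD by (subst card_Un_disjoint) (auto simp: N p)
    moreover have "card (vf ` darts q) = 1 + (if l1 = 0 then 0 else 1) + (if l2 = 0 then 0 else 1)"
      unfolding vfD by (cases "l1 = 0"; cases "l2 = 0") simp_all
    ultimately show ?thesis by (simp add: N)
  qed
  note P = planar_by_labels[where vf = vf and vv = vv and rf = rf and rv = rv, OF P1 P2 P3 P4 P5 R1 P6 R2 C E]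
  show "planar_map q" by (rule P(1))
  show "d \<in> darts q \<Longrightarrow> face_at q d = {e \<in> darts q. vf e = vf d}" for d by (rule P(2))
  show "d \<in> darts q \<Longrightarrow> vertex_at q d = {e \<in> darts q. vv e = vv d}" for d by (rule P(3))
qed

lemma bridge_hole_faces:
  "face_at q 0 = {..<N}"
  "0 < l1 \<Longrightarrow> face_at q (N + 1) = {N + 1..<N + p}"
  "0 < l2 \<Longrightarrow> face_at q (N + p + 1) = {N + p + 1..<2 * N}"
proof -
  note S = bridge_hole_simps
  have D: "d \<in> darts q \<longleftrightarrow> d < 2 * N \<and> d \<noteq> N \<and> d \<noteq> N + p" for d by (auto simp: S)
  define v where "v e = (if e < N then 0 else if e < N + p then 1 else (2::nat))" for e
  have f: "face_at q d = {e \<in> darts q. v e = v d}" if "d \<in> darts q" for d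
    unfolding v_def by (rule bridge_hole_planar(2)[OF that])
  have v: "v e = 0 \<longleftrightarrow> e < N" "v e = 1 \<longleftrightarrow> N \<le> e \<and> e < N + p" "v e = 2 \<longleftrightarrow> N + p \<le> e" for e
    unfolding v_def by simp_all
  have d0: "0 \<in> darts q" and v0: "v 0 = 0" unfolding D v(1) using N by simp_all
  show "face_at q 0 = {..<N}"
    unfolding f[OF d0] v0 v(1) D by auto
  show "face_at q (N + 1) = {N + 1..<N + p}" if l: "0 < l1"
  proof -
    have d1: "N + 1 \<in> darts q" and v1: "v (N + 1) = 1" unfolding D v(2) using N p l by simp_all
    show ?thesis unfolding f[OF d1] v1 v(2) D using N p by auto
  qed
  show "face_at q (N + p + 1) = {N + p + 1..<2 * N}" if l: "0 < l2"
  proof -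
    have d2: "N + p + 1 \<in> darts q" and v2: "v (N + p + 1) = 2" unfolding D v(3) using N p l by simp_all
    show ?thesis unfolding f[OF d2] v2 v(3) D by auto
  qed
qed

lemma bridge_hole_darts: "hole_darts q = {d \<in> darts q. N \<le> d}"
proof -
  note S = bridge_hole_simps and F = bridge_hole_faces
  have "hole_darts q = (if l1 = 0 then {} else {N + 1..<N + p}) \<union> (if l2 = 0 then {} else {N + p + 1..<2 * N})"
    unfolding hole_darts_def S(5) using F by (cases "l1 = 0"; cases "l2 = 0") (simp_all add: Un_commute)
  then show ?thesis using N p by (auto simp: S(1))
qed

lemma bridge_hole_holes: "quad_with_holes q"
proof -
  note S = bridge_hole_simps and F = bridge_hole_faces and P = bridge_hole_planar
  have D: "d \<in> darts q \<longleftrightarrow> d < 2 * N \<and> d \<noteq> N \<and> d \<noteq> N + p" for d by (auto simp: S)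
  have "f \<in> face_at q ` marks q" if f: "f \<in> internal_faces q" for f
  proof -
    obtain d where d: "d \<in> darts q" "f = face_at q d" and nr: "f \<noteq> face_at q 0"
      using f by (auto simp: internal_faces_def map_faces_def root_face_def S(4))
    have "0 \<in> darts q" unfolding D using N by simp
    then have "d \<notin> face_at q 0" using nr face_at_eq[OF P(1), of 0 d] d(2) by auto
    then have "d \<in> hole_darts q" unfolding F(1) bridge_hole_darts using d(1) by auto
    then obtain h where h: "h \<in> marks q" "d \<in> face_at q h" by (auto simp: hole_darts_def)
    have "h \<in> darts q" using h(1) N p unfolding D by (auto simp: S(5) split: if_splits)
    then show ?thesis using face_at_eq[OF P(1) _ h(2)] d(2) h(1) by auto
  qed
  moreover have "inj_on (vertex_at q) (hole_darts q)"
  proof (rule inj_onI)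
    fix a b assume ab: "a \<in> hole_darts q" "b \<in> hole_darts q" "vertex_at q a = vertex_at q b"
    have l: "a \<in> darts q" "b \<in> darts q" "N \<le> a" "N \<le> b" using ab(1,2) unfolding bridge_hole_darts by auto
    have "b \<in> vertex_at q b" using P(3)[OF l(2)] l(2) by simp
    then have "b \<in> vertex_at q a" using ab(3) by simp
    then have "b - N = a - N" using P(3)[OF l(1)] l by auto
    then show "a = b" using l by simp
  qed
  moreover have "inj_on (face_at q) (marks q)"
  proof (cases "0 < l1 \<and> 0 < l2")
    case True
    then have "N + 1 \<in> face_at q (N + 1)" "N + 1 \<notin> face_at q (N + p + 1)"
      unfolding F(2)[OF conjunct1[OF True]] F(3)[OF conjunct2[OF True]] using p by auto
    then have "face_at q (N + 1) \<noteq> face_at q (N + p + 1)" by blast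
    then show ?thesis unfolding S(5) by (auto simp: inj_on_def)
  qed (auto simp: S(5))
  moreover have "root_face q \<notin> face_at q ` marks q"
  proof -
    have "0 \<in> face_at q 0" unfolding F(1) using N by simp
    moreover have "0 \<notin> face_at q h" if "h \<in> marks q" for h
      using that F(2,3) by (auto simp: S(5) split: if_splits)
    ultimately show ?thesis unfolding root_face_def S(4) by auto
  qed
  moreover have "marks q \<subseteq> darts q" unfolding S(5) using N p by (auto simp: D)
  ultimately show ?thesis unfolding quad_with_holes_def using P(1) by auto
qed

lemma bridge_hole_per:
  "0 < l1 \<Longrightarrow> hole_per q (N + 1) = 2 * l1" "0 < l2 \<Longrightarrow> hole_per q (N + p + 1) = 2 * l2"
  unfolding hole_per_def using bridge_hole_faces(2,3) N p by simp_all

text \<open>The root face is numbered consecutively from the root dart. The place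
  \<open>p = 2 * l1 + 1\<close> of the opposite dart lets \<open>l1\<close> be recovered from a
  glued map.\<close>

lemma bridge_hole_root_position: "(nxt q ^^ k) 0 = p \<longleftrightarrow> k mod N = p"
proof -
  have "(nxt q ^^ k) 0 = k mod N"
  proof (induction k)
    case (Suc k)
    have "k mod N < N" using N by simp
    then show ?case using Suc by (auto simp: bridge_hole_simps(3) mod_Suc)
  qed simp
  then show ?thesis by simp
qed

lemma bridge_hole_outer:
  "0 < l1 \<Longrightarrow> k < 2 * l1 \<Longrightarrow> opp q ((nxt q ^^ (2 * l1 - k)) (N + 1)) = k + 1"
  "0 < l2 \<Longrightarrow> k < 2 * l2 \<Longrightarrow> opp q ((nxt q ^^ (2 * l2 - k)) (N + p + 1)) = k + p + 1"
proof -
  note S = bridge_hole_simps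
  show "opp q ((nxt q ^^ (2 * l1 - k)) (N + 1)) = k + 1" if l: "0 < l1" "k < 2 * l1"
  proof -
    have 1: "nxt q (N + 1) = N + 2 * l1" by (simp add: S(3))
    have "(nxt q ^^ (2 * l1 - k - 1)) (N + 2 * l1) = N + 2 * l1 - (2 * l1 - k - 1)"
      by (rule funpow_run_down[of "N + 1" "N + 2 * l1"]) (use l in \<open>auto simp: S(3) p\<close>)
    then have a: "(nxt q ^^ Suc (2 * l1 - k - 1)) (N + 1) = N + k + 1"
      unfolding funpow_Suc_right o_apply 1 using l by simp
    have b: "Suc (2 * l1 - k - 1) = 2 * l1 - k" using l by simp
    have "(nxt q ^^ (2 * l1 - k)) (N + 1) = N + k + 1" using a unfolding b .
    then show ?thesis using l N p by (simp add: S(2))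
  qed
  show "opp q ((nxt q ^^ (2 * l2 - k)) (N + p + 1)) = k + p + 1" if l: "0 < l2" "k < 2 * l2"
  proof -
    have 1: "nxt q (N + p + 1) = 2 * N - 1" using l N p by (simp add: S(3))
    have "(nxt q ^^ (2 * l2 - k - 1)) (2 * N - 1) = 2 * N - 1 - (2 * l2 - k - 1)"
      by (rule funpow_run_down[of "N + p + 1" "2 * N - 1"]) (use l N p in \<open>auto simp: S(3)\<close>)
    then have a: "(nxt q ^^ Suc (2 * l2 - k - 1)) (N + p + 1) = N + p + 1 + k"
      unfolding funpow_Suc_right o_apply 1 using l N p by simp
    have b: "Suc (2 * l2 - k - 1) = 2 * l2 - k" using l by simp
    have "(nxt q ^^ (2 * l2 - k)) (N + p + 1) = N + p + 1 + k" using a unfolding b .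
    then show ?thesis using l N p by (simp add: S(2))
  qed
qed

end

section \<open>Deletion as the inverse of gluing\<close>

lemma (in root_deletion) nxt_u_outside:
  assumes "d \<in> darts u" "d \<notin> M"
  shows "nxt u d = nxt m d"
proof -
  have d: "d \<in> darts m" "d \<notin> face_at m r" "d \<notin> face_at m s"
    using assms by (auto simp: M_def u_simps(1))
  then have "nxt m d \<noteq> r" "nxt m d \<noteq> s"
    using nxt_mem_face_iff[OF planar d(1) r] nxt_mem_face_iff[OF planar d(1) s] face_r by auto
  then show ?thesis by (simp add: u_simps)
qed

lemma bij_betw_face:
  assumes "planar_map m" "d \<in> darts m"
  shows "bij_betw (\<lambda>k. (nxt m ^^ k) d) {..<card (face_at m d)} (face_at m d)"
proof -
  note P = face_period[OF assms]
  have "inj_on (\<lambda>k. (nxt m ^^ k) d) {..<card (face_at m d)}"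
    by (rule inj_onI) (use P(6) in auto)
  moreover have "(\<lambda>k. (nxt m ^^ k) d) ` {..<card (face_at m d)} = face_at m d"
    using P(3,5) by auto
  ultimately show ?thesis by (simp add: bij_betw_def)
qed

lemma bij_betw_case_sum:
  assumes "bij_betw f A C" "bij_betw g B D" "C \<inter> D = {}"
  shows "bij_betw (case_sum f g) (Inl ` A \<union> Inr ` B) (C \<union> D)"
proof -
  have "inj_on (case_sum f g) (Inl ` A \<union> Inr ` B)"
  proof (rule inj_onI)
    fix x y assume xy: "x \<in> Inl ` A \<union> Inr ` B" "y \<in> Inl ` A \<union> Inr ` B" "case_sum f g x = case_sum f g y"
    have fA: "f a \<in> C" if "a \<in> A" for a using assms(1) that by (auto simp: bij_betw_def)
    have gB: "g b \<in> D" if "b \<in> B" for b using assms(2) that by (auto simp: bij_betw_def)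
    show "x = y"
    proof (cases x; cases y)
      fix a b assume "x = Inl a" "y = Inl b"
      then show ?thesis using xy assms(1) by (auto simp: bij_betw_def dest: inj_onD)
    next
      fix a b assume "x = Inr a" "y = Inr b"
      then show ?thesis using xy assms(2) by (auto simp: bij_betw_def dest: inj_onD)
    next
      fix a b assume "x = Inl a" "y = Inr b"
      then show ?thesis using xy fA[of a] gB[of b] assms(3) by auto
    next
      fix a b assume "x = Inr a" "y = Inl b"
      then show ?thesis using xy fA[of b] gB[of a] assms(3) by auto
    qed
  qed
  moreover have "case_sum f g ` (Inl ` A \<union> Inr ` B) = C \<union> D"
    using assms by (auto simp: bij_betw_def image_Un image_image)
  ultimately show ?thesis by (simp add: bij_betw_def)
qed

lemma darts_glue:
  "darts (glue q u) = Inl ` (darts q - hole_darts q) \<union>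
     Inr ` (\<Union>h\<in>marks q. {h} \<times> (darts (u h) - root_face (u h)))"
  by (auto simp: glue_def)

context root_deletion
begin

text \<open>The walk around the merged face from the root of \<open>u\<close>; the boundary of the
  hole that \<open>u\<close> fills is numbered in step with it.\<close>

definition "E k = (nxt u ^^ k) (nxt m s)"

lemma root_u: "nxt m s \<in> darts u" "root_dart u = nxt m s"
  using root_M M_subset by (auto simp: u_simps(4))

lemma card_M: "card M = perimeter u"
  using root_face_u by (simp add: perimeter_def)

lemma bij_E: "bij_betw E {..<card M} M"
  using bij_betw_face[OF planar_u root_u(1)] face_u_M[OF root_M] by (simp add: E_def[abs_def])

lemma E_in: "E k \<in> darts u" "E k \<in> M"
  using face_period(5)[OF planar_u root_u(1), of k] face_u_M[OF root_M] M_subset by (auto simp: E_def)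

lemma E_Suc: "E (Suc k) = nxt u (E k)"
  by (simp add: E_def)

lemma E_period: "E (card M) = nxt m s"
  using face_period(1)[OF planar_u root_u(1), of "card M"] face_u_M[OF root_M] by (simp add: E_def)

lemma card_M_pos: "0 < card M"
  using face_period(2)[OF planar_u root_u(1)] face_u_M[OF root_M] by simp

lemma E_inj: "j < card M \<Longrightarrow> k < card M \<Longrightarrow> E j = E k \<longleftrightarrow> j = k"
  using bij_E by (auto simp: bij_betw_def dest: inj_onD)

text \<open>The cycle closes at \<open>nxt m s\<close>, and only the dart before \<open>r\<close>
  was redirected there.\<close>

lemma nxt_E_last: "nxt m (E (card M - 1)) = r"
proof -
  let ?d = "E (card M - 1)"
  have d: "?d \<in> darts m" "?d \<noteq> r" "?d \<noteq> s" using E_in(1)[of "card M - 1"] by (auto simp: u_simps(1))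
  have "nxt u ?d = nxt m s" using E_Suc[of "card M - 1"] E_period card_M_pos by simp
  moreover have "nxt m r \<noteq> nxt m s" "nxt m ?d \<noteq> nxt m s"
    using pm(9)[OF r s] pm(9)[OF d(1) s] rs d by auto
  ultimately show ?thesis by (auto simp: u_simps(3) split: if_splits)
qed

lemma nxt_E:
  assumes "k < card M" "k \<noteq> card M - 1" "nxt m (E k) \<noteq> s"
  shows "nxt m (E k) = E (Suc k)"
proof -
  have "nxt m (E k) \<noteq> r"
  proof
    assume "nxt m (E k) = r"
    then have "nxt m (E k) = nxt m (E (card M - 1))" using nxt_E_last by simp
    then have "E k = E (card M - 1)" using pm(9) E_in(1) by (auto simp: u_simps(1))
    then show False using E_inj[of k "card M - 1"] assms(1,2) by simp
  qed
  then show ?thesis using assms(3) by (simp add: E_Suc u_simps(3))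
qed

lemma darts_m_split: "darts m = (M \<union> {r, s}) \<union> (darts u - M)" "(M \<union> {r, s}) \<inter> (darts u - M) = {}"
  using M_subset r s by (auto simp: u_simps(1))

text \<open>\<open>F\<close> recovers from \<open>q\<close> the deleted edge and the merged face,
  while the darts of \<open>u\<close> off its root face are common to both maps. \<open>FE\<close>
  says that the boundary of the hole is numbered like the walk \<open>E\<close>.\<close>

lemma glue_delete:
  assumes q: "quad_with_holes q" and mk: "marks q = {h}" and per: "hole_per q h = card M"
    and out: "\<And>a. a \<in> hole_darts q \<Longrightarrow> opp q a \<notin> hole_darts q"
    and FE: "\<And>k. k < card M \<Longrightarrow> F (opp q ((nxt q ^^ (card M - k)) h)) = E k"
    and F_opp: "\<And>d. d \<in> darts q \<Longrightarrow> d \<notin> hole_darts q \<Longrightarrow> opp q d \<notin> hole_darts q \<Longrightarrow>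
      F (opp q d) = opp m (F d)"
    and F_nxt: "\<And>d. d \<in> darts q \<Longrightarrow> d \<notin> hole_darts q \<Longrightarrow> F (nxt q d) = nxt m (F d)"
    and F_root: "F (root_dart q) = r"
    and F_bij: "bij_betw F (darts q - hole_darts q) (M \<union> {r, s})"
  shows "iso_class (glue q (\<lambda>_. u)) = iso_class m"
proof (rule glue_iso(2)[OF q out, where F = F and G = "\<lambda>_ b. b"])
  show "planar_map u \<and> perimeter u = hole_per q h'" if "h' \<in> marks q" for h'
    using that planar_u card_M per by (simp add: mk)
  show "F (opp q ((nxt q ^^ (hole_per q h' - k)) h')) = (nxt u ^^ k) (root_dart u)"
    if "h' \<in> marks q" "k < hole_per q h'" for h' k
    using FE[of k] that per by (simp add: mk E_def root_u(2))
  show "opp u b = opp m b" for b by (simp add: u_simps(2))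
  show "nxt u b = nxt m b" if "b \<in> darts u - root_face u" for b
    using nxt_u_outside[of b] that root_face_u by simp
  show "F (root_dart q) = root_dart m" using F_root by (simp add: r_def)
  have g: "darts (glue q (\<lambda>_. u)) = Inl ` (darts q - hole_darts q) \<union> Inr ` ({h} \<times> (darts u - M))"
    unfolding darts_glue root_face_u mk by simp
  have G: "bij_betw (\<lambda>(h, b). b) ({h} \<times> (darts u - M)) (darts u - M)"
    by (auto simp: bij_betw_def inj_on_def)
  show "bij_betw (case_sum F (\<lambda>(h, b). b)) (darts (glue q (\<lambda>_. u))) (darts m)"
    unfolding g darts_m_split(1) by (rule bij_betw_case_sum[OF F_bij G darts_m_split(2)])
qed (use F_opp F_nxt in auto)

end

lemma quadrangulationD:
  assumes "quadrangulation m"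
  shows "planar_map m" "\<And>f. f \<in> internal_faces m \<Longrightarrow> card f = 4"
  using assms by (auto simp: quadrangulation_def)

text \<open>The merged face consists of the three other sides of the square followed by the rest of
  the root face, \<open>2 * l + 2\<close> darts in all. These are the darts around the hole of
  \<open>quad_hole (2 * l + 2)\<close>, where 0, 1, 2 are sides of the square.\<close>

lemma delete_quad:
  fixes m :: "'d rmap"
  assumes quad: "quadrangulation m" and per: "perimeter m = 2 * l" and l: "1 \<le> l"
    and out: "opp m (root_dart m) \<notin> root_face m"
  shows "quadrangulation (del_root m)" "perimeter (del_root m) = 2 * l + 2"
    "card (internal_faces m) = Suc (card (internal_faces (del_root m)))"
    "iso_class (glue (quad_hole (2 * l + 2)) (\<lambda>_. del_root m)) = iso_class m"
proof -
  define r s where "r = root_dart m" and "s = opp m (root_dart m)"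
  note pl = quadrangulationD(1)[OF quad]
  have rD: "r \<in> darts m" and sD: "s \<in> darts m"
    using planar_mapD(2,3)[OF pl] by (auto simp: r_def s_def)
  have sr: "s \<notin> face_at m r" using out by (simp add: root_face_def r_def s_def)
  have cr: "card (face_at m r) = 2 * l" using per by (simp add: perimeter_def root_face_def r_def)
  have fs: "face_at m s \<noteq> face_at m r" using sr mem_face_at[OF pl sD] by auto
  then have "face_at m s \<in> internal_faces m"
    using sD by (auto simp: internal_faces_def map_faces_def root_face_def r_def)
  then have cs: "card (face_at m s) = 4" using quadrangulationD(2)[OF quad] by simp
  have rs': "r \<notin> face_at m s" using face_at_eq[OF pl sD, of r] fs by auto
  have nn: "nxt m s \<noteq> r" "nxt m s \<noteq> s" "nxt m r \<noteq> r"
  proof -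
    show "nxt m s \<noteq> r" using rs' orbit.base[of "nxt m" s] by (auto simp: face_at_def)
    show "nxt m s \<noteq> s" using face_period(1)[OF pl sD, of 1] cs by auto
    show "nxt m r \<noteq> r" using face_period(1)[OF pl rD, of 1] cr by auto
  qed
  interpret root_deletion m r s
    by unfold_locales (use pl nn sr in \<open>simp_all add: r_def s_def\<close>)
  have int_m: "internal_faces m = insert (face_at m s) (face_at m ` D2)"
    unfolding internal_faces_def faces_m root_face_m using fs face_rs_notin by auto
  have fin: "finite (face_at m ` D2)" using pm(1) by (simp add: D2_def)
  show "quadrangulation u"
    unfolding quadrangulation_def internal_faces_u using planar_u quadrangulationD(2)[OF quad] int_m by auto
  have "card (face_at m r \<union> face_at m s) = 2 * l + 4"
  proof -
    have "face_at m r \<inter> face_at m s = {}" using face_at_disjoint[OF pl rD sD] fs by auto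
    moreover have "finite (face_at m r)" "finite (face_at m s)"
      using face_at_subset[OF pl] rD sD pm(1) finite_subset by metis+
    ultimately show ?thesis using cr cs by (simp add: card_Un_disjoint)
  qed
  then show pu: "perimeter u = 2 * l + 2" using perimeter_u by simp
  show "card (internal_faces m) = Suc (card (internal_faces u))"
    unfolding int_m internal_faces_u using fin face_rs_notin(2) by simp
  define n where "n = 2 * l + 2"
  have n: "4 \<le> n" using l by (simp add: n_def)
  have cM: "card M = n" using card_M pu by (simp add: n_def)
  \<comment> \<open>The darts \<open>2 * n\<close> and \<open>2 * n + 1\<close> are the two sides of
    the root edge.\<close>
  define F where "F d = (if d < n then E d else if d = 2 * n then r else s)" for d
  have p4: "(nxt m ^^ i) s = s \<longleftrightarrow> 4 dvd i" for i using face_period(1)[OF pl sD, of i] cs by simp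
  have pr: "(nxt m ^^ i) s \<noteq> r" for i using face_period(5)[OF pl sD, of i] rs' by auto
  have E0: "E 0 = (nxt m ^^ 1) s" by (simp add: E_def)
  have E1: "E 1 = (nxt m ^^ 2) s"
  proof -
    have e: "nxt m (E 0) = (nxt m ^^ 2) s" by (simp add: E0 numeral_2_eq_2)
    have "(nxt m ^^ 2) s \<noteq> s" unfolding p4 by simp
    then have "nxt u (E 0) = (nxt m ^^ 2) s" using e pr[of 2] by (simp add: u_simps(3))
    then show ?thesis using E_Suc[of 0] by simp
  qed
  have E2: "E 2 = (nxt m ^^ 3) s"
  proof -
    have e: "nxt m (E 1) = (nxt m ^^ 3) s" unfolding E1 by (simp add: numeral_3_eq_3 numeral_2_eq_2)
    have "(nxt m ^^ 3) s \<noteq> s" unfolding p4 by simp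
    then have "nxt u (E 1) = (nxt m ^^ 3) s" using e pr[of 3] by (simp add: u_simps(3))
    then show ?thesis using E_Suc[of 1] by (simp add: numeral_2_eq_2)
  qed
  have nE2: "nxt m (E 2) = s"
  proof -
    have "nxt m (E 2) = (nxt m ^^ 4) s" unfolding E2 by (simp add: eval_nat_numeral)
    also have "\<dots> = s" unfolding p4 by simp
    finally show ?thesis .
  qed
  \<comment> \<open>The dart before \<open>s\<close> is redirected to \<open>nxt m r\<close>: after
    three sides the walk leaves the square and follows the root face.\<close>
  have E3: "E 3 = nxt m r"
    using E_Suc[of 2] nE2 rs by (simp add: u_simps(3) numeral_3_eq_3 numeral_2_eq_2)
  have nE: "nxt m (E k) = E (k + 1)" if k: "k < n - 1" "k \<noteq> 2" for k
  proof -
    have "nxt m (E k) \<noteq> s"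
    proof
      assume "nxt m (E k) = s"
      then have "E k = E 2" using nE2 pm(9)[of "E k" "E 2"] E_in(1) by (auto simp: u_simps(1))
      then show False using E_inj[of k 2] k n cM by simp
    qed
    then show ?thesis using nxt_E[of k] k cM by simp
  qed
  have nEl: "nxt m (E (n - 1)) = r" using nxt_E_last cM by simp
  let ?q = "quad_hole n"
  note Q = quad_hole[OF n] and S = quad_hole_simps[of n]
  have D: "d < n \<or> d = 2 * n \<or> d = 2 * n + 1" if "d \<in> darts (quad_hole n)" "d \<notin> hole_darts (quad_hole n)" for d
    using that unfolding Q(2) S(1) by auto
  have "iso_class (glue ?q (\<lambda>_. u)) = iso_class m"
  proof (rule glue_delete[where F = F])
    show "quad_with_holes ?q" by (rule Q(1))
    show "marks ?q = {n}" by (rule S(5))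
    show "hole_per ?q n = card M" unfolding cM by (rule Q(3))
    show "opp ?q a \<notin> hole_darts ?q" if "a \<in> hole_darts ?q" for a
      using that unfolding Q(2) by (auto simp: S(2))
    show "F (opp ?q ((nxt ?q ^^ (card M - k)) n)) = E k" if "k < card M" for k
      using that Q(5)[of k] by (simp add: cM F_def)
    show "F (opp ?q d) = opp m (F d)"
      if d: "d \<in> darts ?q" "d \<notin> hole_darts ?q" "opp ?q d \<notin> hole_darts ?q" for d
    proof -
      have "\<not> d < n" using d(3) unfolding Q(2) by (auto simp: S(2))
      then have "d = 2 * n \<or> d = 2 * n + 1" using D[OF d(1,2)] by simp
      then show ?thesis using opp_r opp_s by (auto simp: S(2) F_def)
    qed
    show "F (nxt ?q d) = nxt m (F d)"
      if d: "d \<in> darts ?q" "d \<notin> hole_darts ?q" for d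
    proof -
      consider "d = 2" | "d < n - 1" "d \<noteq> 2" | "d = n - 1" | "d = 2 * n" | "d = 2 * n + 1"
        using D[OF d] n by linarith
      then show ?thesis
      proof cases
        case 1
        then have "nxt ?q d = 2 * n + 1" by (simp add: S(3))
        then show ?thesis using 1 n nE2 by (simp add: F_def)
      next
        case 2
        then have "nxt ?q d = d + 1" by (simp add: S(3))
        moreover have "d < n" "d + 1 < n" using 2 by auto
        ultimately show ?thesis using 2 nE[of d] by (simp add: F_def)
      next
        case 3
        then have "nxt ?q d = 2 * n" using n by (auto simp: S(3))
        then show ?thesis using 3 n nEl by (simp add: F_def)
      next
        case 4
        then have "nxt ?q d = 3" using n by (auto simp: S(3))
        then show ?thesis using 4 n E3 by (simp add: F_def)
      next
        case 5
        then have "nxt ?q d = 0" using n by (auto simp: S(3))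
        then show ?thesis using 5 n E0 by (simp add: F_def)
      qed
    qed
    show "F (root_dart ?q) = r" by (simp add: F_def S(4))
    have dq: "darts ?q - hole_darts ?q = {..<n} \<union> {2 * n, 2 * n + 1}"
      unfolding Q(2) S(1) by auto
    show "bij_betw F (darts ?q - hole_darts ?q) (M \<union> {r, s})" unfolding dq
    proof (rule bij_betw_combine)
      show "bij_betw F {..<n} M"
        using bij_E unfolding cM by (rule bij_betw_cong[THEN iffD1, rotated]) (simp add: F_def)
      show "bij_betw F {2 * n, 2 * n + 1} {r, s}"
        using rs by (auto simp: bij_betw_def F_def)
      show "M \<inter> {r, s} = {}" by (auto simp: M_def)
    qed
  qed
  then show "iso_class (glue (quad_hole (2 * l + 2)) (\<lambda>_. u)) = iso_class m" by (simp add: n_def)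
qed

text \<open>A pendant root edge is a bridge with nothing attached to its head:
  \<open>l1 = 0\<close>, hence \<open>p = 1\<close>, and the hole at its tail has perimeter
  \<open>2 * (l - 1)\<close>.\<close>

lemma delete_leaf:
  fixes m :: "'d rmap"
  assumes quad: "quadrangulation m" and per: "perimeter m = 2 * l" and l: "2 \<le> l"
    and leaf: "nxt m (root_dart m) = opp m (root_dart m)"
  shows "quadrangulation (del_root m)" "perimeter (del_root m) = 2 * (l - 1)"
    "card (internal_faces (del_root m)) = card (internal_faces m)"
    "iso_class (glue (bridge_hole 0 (l - 1)) (\<lambda>_. del_root m)) = iso_class m"
proof -
  define r s where "r = root_dart m" and "s = opp m (root_dart m)"
  note pl = quadrangulationD(1)[OF quad]
  have rD: "r \<in> darts m" and sD: "s \<in> darts m" and rs0: "s \<noteq> r"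
    using planar_mapD(2-4)[OF pl] by (auto simp: r_def s_def)
  have nrs: "nxt m r = s" using leaf by (simp add: r_def s_def)
  have cr: "card (face_at m r) = 2 * l" using per by (simp add: perimeter_def root_face_def r_def)
  have sf: "s \<in> face_at m r" using orbit.base[of "nxt m" r] nrs by (simp add: face_at_def)
  have nn: "nxt m s \<noteq> r" "nxt m s \<noteq> s" "nxt m r \<noteq> r"
  proof -
    show "nxt m s \<noteq> r"
    proof
      assume "nxt m s = r"
      then have "(nxt m ^^ 2) r = r" using nrs by (simp add: numeral_2_eq_2)
      then have "2 * l dvd 2" using face_period(1)[OF pl rD, of 2] cr by simp
      then show False using l by (auto dest: dvd_imp_le)
    qed
    show "nxt m s \<noteq> s" using planar_mapD(9)[OF pl rD sD] nrs rs0 by auto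
    show "nxt m r \<noteq> r" using nrs rs0 by simp
  qed
  interpret root_deletion m r s
    by unfold_locales (use pl nn nrs in \<open>simp_all add: r_def s_def\<close>)
  have fsr: "face_at m s = face_at m r" using face_at_eq[OF pl rD sf] .
  have int_m: "internal_faces m = face_at m ` D2"
    unfolding internal_faces_def faces_m root_face_m fsr using face_rs_notin by auto
  show "quadrangulation u"
    unfolding quadrangulation_def internal_faces_u using planar_u quadrangulationD(2)[OF quad] int_m by auto
  show pu: "perimeter u = 2 * (l - 1)" using perimeter_u cr by (simp add: fsr)
  show "card (internal_faces u) = card (internal_faces m)"
    unfolding int_m internal_faces_u by simp
  define q N where "q = bridge_hole 0 (l - 1)" and "N = 2 * l"
  have Ne: "N = 2 * 0 + 2 * (l - 1) + 2" using l by (simp add: N_def)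
  have pe: "(1::nat) = 2 * 0 + 1" by simp
  have cM: "card M = N - 2" using card_M pu by (simp add: N_def)
  have N4: "4 \<le> N" using l by (simp add: N_def)
  \<comment> \<open>Places 0 and 1 of the root face are the two sides of the pendant edge, hence the
    shift by 2.\<close>
  define F where "F d = (if d = 0 then r else if d = 1 then s else E (d - 2))" for d
  note B = bridge_hole_holes[OF Ne pe q_def] bridge_hole_per(2)[OF Ne pe q_def]
    bridge_hole_outer(2)[OF Ne pe q_def] bridge_hole_darts[OF Ne pe q_def]
  note S = bridge_hole_simps[OF Ne pe q_def]
  have mk: "marks q = {N + 2}" using l unfolding S(5) by simp
  have hp: "hole_per q (N + 2) = N - 2" using B(2) l by (simp add: N_def)
  have D: "darts q - hole_darts q = {..<N}" unfolding B(4) S(1) by auto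
  have nE: "nxt m (E k) = E (Suc k)" if k: "k < N - 3" for k
  proof (rule nxt_E)
    show "nxt m (E k) \<noteq> s"
    proof
      assume "nxt m (E k) = s"
      then have "E k = r" using nrs pm(9)[of "E k" r] E_in(1)[of k] r by (auto simp: u_simps(1))
      then show False using E_in(1)[of k] by (simp add: u_simps(1))
    qed
  qed (use k cM in auto)
  have nEl: "nxt m (E (N - 3)) = r" using nxt_E_last cM N4 by simp
  have "iso_class (glue q (\<lambda>_. u)) = iso_class m"
  proof (rule glue_delete[where F = F])
    show "quad_with_holes q" by (rule B(1))
    show "marks q = {N + 2}" by (rule mk)
    show "hole_per q (N + 2) = card M" unfolding cM by (rule hp)
    show "opp q a \<notin> hole_darts q" if "a \<in> hole_darts q" for a
      using that unfolding B(4) by (auto simp: S(1,2))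
    show "F (opp q ((nxt q ^^ (card M - k)) (N + 2))) = E k" if k: "k < card M" for k
    proof -
      have "opp q ((nxt q ^^ (N - 2 - k)) (N + 2)) = k + 2"
        using B(3)[of k] k l by (simp add: N_def cM right_diff_distrib')
      then show ?thesis unfolding cM by (simp add: F_def)
    qed
    show "F (opp q d) = opp m (F d)"
      if d: "d \<in> darts q" "d \<notin> hole_darts q" "opp q d \<notin> hole_darts q" for d
    proof -
      have dN: "d < N" using d(1,2) D by auto
      have "d = 0 \<or> d = 1"
      proof (rule ccontr)
        assume a: "\<not> (d = 0 \<or> d = 1)"
        then have "opp q d = d + N" using dN by (simp add: S(2))
        then show False using d(3) a dN unfolding B(4) by (auto simp: S(1))
      qed
      then show ?thesis using opp_r opp_s by (auto simp: S(2) F_def)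
    qed
    show "F (nxt q d) = nxt m (F d)" if d: "d \<in> darts q" "d \<notin> hole_darts q" for d
    proof -
      have dN: "d < N" using d D by auto
      consider "d = 0" | "d = 1" | "2 \<le> d" "d + 1 < N" | "2 \<le> d" "d = N - 1" using dN by linarith
      then show ?thesis
      proof cases
        case 1
        then have "nxt q d = 1" using N4 by (simp add: S(3))
        then show ?thesis using 1 nrs by (simp add: F_def)
      next
        case 2
        then have "nxt q d = 2" using N4 by (simp add: S(3))
        then show ?thesis using 2 by (simp add: F_def E_def)
      next
        case 3
        then have "nxt q d = d + 1" by (simp add: S(3))
        moreover have "nxt m (E (d - 2)) = E (Suc (d - 2))" using 3 by (intro nE) auto
        moreover have "Suc (d - 2) = d + 1 - 2" using 3 by simp
        ultimately show ?thesis using 3 by (simp add: F_def)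
      next
        case 4
        then have "nxt q d = 0" by (simp add: S(3))
        moreover have "d - 2 = N - 3" using 4 by simp
        ultimately show ?thesis using 4 nEl N4 by (simp add: F_def)
      qed
    qed
    show "F (root_dart q) = r" by (simp add: F_def S(4))
    show "bij_betw F (darts q - hole_darts q) (M \<union> {r, s})"
    proof -
      have "bij_betw (\<lambda>d. d - 2) {2..<N} {..<N - 2}"
        by (rule bij_betwI[where g = "\<lambda>d. d + 2"]) auto
      then have "bij_betw (E \<circ> (\<lambda>d. d - 2)) {2..<N} M"
        by (rule bij_betw_trans) (use bij_E cM in simp)
      then have b1: "bij_betw F {2..<N} M"
        by (rule bij_betw_cong[THEN iffD1, rotated]) (simp add: F_def)
      have b2: "bij_betw F {0, 1} {r, s}" using rs by (auto simp: bij_betw_def F_def)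
      have "{..<N} = {2..<N} \<union> {0, 1}" using N4 by auto
      moreover have "M \<inter> {r, s} = {}" by (auto simp: M_def)
      ultimately show ?thesis using bij_betw_combine[OF b1 b2] unfolding D by simp
    qed
  qed
  then show "iso_class (glue (bridge_hole 0 (l - 1)) (\<lambda>_. u)) = iso_class m" by (simp add: q_def)
qed

section \<open>Explicit maps\<close>

text \<open>The tree with \<open>l1 + l2 + 1\<close> edges in which the ends of the root edge carry \<open>l2\<close> and \<open>l1\<close> leaves.\<close>

definition double_star :: "nat \<Rightarrow> nat \<Rightarrow> nat rmap" where
  "double_star l1 l2 =
     (let N = 2 * l1 + 2 * l2 + 2; p = 2 * l1 + 1 in
      \<lparr> darts = {..<N},
        opp = (\<lambda>d. if d = 0 then p else if d = p then 0 else if (d < p) = odd d then d + 1 else d - 1),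
        nxt = (\<lambda>d. if d + 1 = N then 0 else d + 1),
        root_dart = 0 \<rparr>)"

lemma double_star_simps:
  assumes "N = 2 * l1 + 2 * l2 + 2" "p = 2 * l1 + 1"
  shows "darts (double_star l1 l2) = {..<N}"
    "opp (double_star l1 l2) d =
       (if d = 0 then p else if d = p then 0 else if (d < p) = odd d then d + 1 else d - 1)"
    "nxt (double_star l1 l2) d = (if d + 1 = N then 0 else d + 1)"
    "root_dart (double_star l1 l2) = 0"
  by (simp_all add: double_star_def Let_def assms)

lemma double_star:
  fixes l1 l2 :: nat
  defines "m \<equiv> double_star l1 l2"
  shows "planar_map m" "root_face m = darts m" "quadrangulation m" "internal_faces m = {}"
    "perimeter m = 2 * (l1 + l2 + 1)"
proof -
  define N p where "N = 2 * l1 + 2 * l2 + 2" and "p = 2 * l1 + 1"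
  note S = double_star_simps[OF N_def p_def, folded m_def]
  define vf where "vf d = (0::nat)" for d :: nat
  define rf where "rf d = (0::nat)" for d :: nat
  \<comment> \<open>The head of the root edge has label \<open>p\<close>, the tail has label 0, and
    a leaf is labelled by the only dart leaving it.\<close>
  define vv where "vv d = (if d \<le> p then if odd d then p else d else if even d then 0 else d)" for d :: nat
  define rv where "rv d = d" for d :: nat
  have op: "odd p" and eN: "even N" and pN: "p < N" "0 < p" by (simp_all add: p_def N_def)
  have cs: "d = 0 \<or> d = p \<or> odd d \<and> 0 < d \<and> d + 2 \<le> p \<or> even d \<and> 0 < d \<and> d < p \<or> even d \<and> p < d \<and> d + 2 = N
      \<or> even d \<and> p < d \<and> d + 2 < N \<or> odd d \<and> p + 1 < d"
    if d: "d < N" for d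
  proof -
    consider "d < p" "odd d" | "d < p" "even d" | "d = p" | "p < d" "even d" | "p < d" "odd d" by linarith
    then show ?thesis
    proof cases
      case 1
      then have "d + 1 \<noteq> p" using op by auto
      moreover have "0 < d" using 1 by (simp add: odd_pos)
      ultimately show ?thesis using 1 by simp
    next
      case 4
      have "d + 1 \<noteq> N" using 4 eN by auto
      then have "d + 2 = N \<or> d + 2 < N" using d by linarith
      then show ?thesis using 4 by blast
    next
      case 5
      then have "d \<noteq> p + 1" using op by auto
      then show ?thesis using 5 by auto
    qed auto
  qed
  have P1: "finite (darts m)" "root_dart m \<in> darts m" by (simp_all add: S N_def)
  have P2: "opp m d \<in> darts m \<and> opp m d \<noteq> d \<and> opp m (opp m d) = d" if d: "d \<in> darts m" for d
  proof -
    have dN: "d < N" using d by (simp add: S(1))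
    from cs[OF dN] show ?thesis
      by (elim disjE) (use op pN dN in \<open>auto simp: S(1,2)\<close>)
  qed
  have P3: "nxt m ` darts m \<subseteq> darts m" by (auto simp: S)
  have P4: "inj_on (nxt m) (darts m)" by (auto simp: S inj_on_def split: if_splits)
  have P5: "vf (nxt m d) = vf d" for d by (simp add: vf_def)
  have P6: "vv (nxt m (opp m d)) = vv d" if d: "d \<in> darts m" for d
  proof -
    have dN: "d < N" using d by (simp add: S(1))
    from cs[OF dN] show ?thesis
      by (elim disjE) (use op pN dN in \<open>auto simp: S(2,3) vv_def\<close>)
  qed
  have R1: "\<exists>k. (nxt m ^^ k) d = rf (vf d)" if d: "d \<in> darts m" for d
  proof -
    have dN: "d < N" using d by (simp add: S(1))
    show ?thesis unfolding rf_def
      by (rule reach_up[of 0 "N - 1"]) (use dN in \<open>auto simp: S(3)\<close>)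
  qed
  have R2: "\<exists>k. ((nxt m \<circ> opp m) ^^ k) d = rv (vv d)" if d: "d \<in> darts m" for d
  proof -
    let ?s = "nxt m \<circ> opp m"
    have dN: "d < N" using d by (simp add: S(1))
    consider "d \<le> p" "odd d" | "p < d" "even d" | "vv d = d" unfolding vv_def by fastforce
    then show ?thesis
    proof cases
      case 1
      have step: "?s e = e + 2" if e: "1 \<le> e" "e < p" "even e = even (1::nat)" for e
      proof -
        have "e + 2 \<noteq> N" using e pN eN by auto
        then show ?thesis using e pN by (auto simp: S(2,3))
      qed
      have r: "rv (vv d) = p" using 1 by (simp add: rv_def vv_def)
      show ?thesis unfolding r
        by (rule reach_by2[of 1 p, OF step]) (use 1 op in \<open>auto intro: Suc_leI odd_pos\<close>)
    next
      case 2
      have "d + 1 \<noteq> N" using 2 eN by auto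
      then have d2: "d \<le> N - 2" using dN by linarith
      have step: "?s e = e + 2" if e: "p + 1 \<le> e" "e < N - 2" "even e = even (p + 1)" for e
        using e op by (auto simp: S(2,3))
      have a: "\<exists>k. (?s ^^ k) d = N - 2"
        by (rule reach_by2[of "p + 1" "N - 2", OF step]) (use 2 d2 op eN in auto)
      have "p < N - 2" using 2 d2 by linarith
      then have "?s (N - 2) = 0" using eN by (auto simp: S(2,3))
      then have "\<exists>k. (?s ^^ k) (N - 2) = 0" by (intro reach_within2) simp
      moreover have r: "rv (vv d) = 0" using 2 by (simp add: rv_def vv_def)
      ultimately show ?thesis unfolding r using reach_trans[OF a] by blast
    next
      case 3
      then show ?thesis by (simp add: rv_def reach_refl)
    qed
  qed
  have C: "darts m \<subseteq> T" if T: "T \<subseteq> darts m" "root_dart m \<in> T" "\<And>d. d \<in> T \<Longrightarrow> opp m d \<in> T"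
    "\<And>d e. d \<in> T \<Longrightarrow> e \<in> darts m \<Longrightarrow> vf e = vf d \<Longrightarrow> e \<in> T" for T
    using T(4)[OF T(2)] by (auto simp: vf_def)
  have vvD: "vv ` darts m = {0, p} \<union> ((\<lambda>i. 2 * i) ` {1..l1} \<union> (\<lambda>i. p + 2 * i) ` {1..l2})"
  proof
    show "vv ` darts m \<subseteq> {0, p} \<union> ((\<lambda>i. 2 * i) ` {1..l1} \<union> (\<lambda>i. p + 2 * i) ` {1..l2})"
    proof
      fix e assume "e \<in> vv ` darts m"
      then obtain d where d: "d < N" "e = vv d" by (auto simp: S(1))
      consider "d = 0" | "d \<le> p" "odd d" | "0 < d" "d \<le> p" "even d" | "p < d" "even d" | "p < d" "odd d"
        by linarith
      then show "e \<in> {0, p} \<union> ((\<lambda>i. 2 * i) ` {1..l1} \<union> (\<lambda>i. p + 2 * i) ` {1..l2})"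
      proof cases
        case 3
        then obtain i where i: "d = 2 * i" by (auto elim: evenE)
        then have "i \<in> {1..l1}" using 3 by (auto simp: p_def)
        moreover have "e = 2 * i" using 3 d(2) i by (simp add: vv_def)
        ultimately show ?thesis by blast
      next
        case 5
        define i where "i = (d - p) div 2"
        have i: "d = p + 2 * i" using 5 op by (simp add: i_def)
        then have "i \<in> {1..l2}" using 5 d(1) by (auto simp: p_def N_def)
        moreover have "e = p + 2 * i" using 5 d(2) unfolding i by (simp add: vv_def)
        ultimately show ?thesis by blast
      qed (use d(2) in \<open>simp_all add: vv_def\<close>)
    qed
    show "{0, p} \<union> ((\<lambda>i. 2 * i) ` {1..l1} \<union> (\<lambda>i. p + 2 * i) ` {1..l2}) \<subseteq> vv ` darts m"
    proof
      fix e assume e: "e \<in> {0, p} \<union> ((\<lambda>i. 2 * i) ` {1..l1} \<union> (\<lambda>i. p + 2 * i) ` {1..l2})"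
      then have "e < N" by (auto simp: p_def N_def)
      moreover have "vv e = e" using e op by (auto simp: vv_def p_def)
      ultimately show "e \<in> vv ` darts m" unfolding S(1) by (metis imageI lessThan_iff)
    qed
  qed
  have E: "2 * (card (vv ` darts m) + card (vf ` darts m)) = card (darts m) + 4"
  proof -
    let ?A = "(\<lambda>i. 2 * i) ` {1..l1}" and ?B = "(\<lambda>i. p + 2 * i) ` {1..l2}"
    have "card ?A = l1" "card ?B = l2" by (simp_all add: card_image inj_on_def)
    moreover have "?A \<inter> ?B = {}" using op by (auto, presburger)
    ultimately have AB: "card (?A \<union> ?B) = l1 + l2" by (simp add: card_Un_disjoint)
    have z: "0 \<notin> ?A \<union> ?B" using op by auto
    have "p \<notin> ?A" using op by auto
    then have z2: "p \<notin> ?A \<union> ?B" by auto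
    have "card (vv ` darts m) = l1 + l2 + 2"
      unfolding vvD using AB z z2 op by (cases "p = 0") (simp_all add: card_insert_if)
    moreover have "vf ` darts m = {0}" using P1(2) by (auto simp: vf_def)
    ultimately show ?thesis by (simp add: S(1) N_def)
  qed
  note P = planar_by_labels[where vf = vf and vv = vv and rf = rf and rv = rv, OF P1 P2 P3 P4 P5 R1 P6 R2 C E]
  show pl: "planar_map m" by (rule P(1))
  have F: "d \<in> darts m \<Longrightarrow> face_at m d = {e \<in> darts m. vf e = vf d}" for d by (rule P(2))
  show rf: "root_face m = darts m" using F[OF P1(2)] by (simp add: root_face_def vf_def)
  show int: "internal_faces m = {}"
    using F rf by (auto simp: internal_faces_def map_faces_def vf_def)
  show "quadrangulation m" using pl int by (simp add: quadrangulation_def)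
  show "perimeter m = 2 * (l1 + l2 + 1)" by (simp add: perimeter_def rf S(1) N_def)
qed

text \<open>
  A square glued to itself along one edge, with that edge inside; \<open>l - 1\<close> leaves are attached outside.
\<close>

definition folded_square :: "nat \<Rightarrow> nat rmap" where
  "folded_square l =
     \<lparr> darts = {..<2 * l + 4},
       opp = (\<lambda>d. if d = 0 then 2 * l else if d = 2 * l then 0 else if d = 1 then 2 * l + 1
                 else if d = 2 * l + 1 then 1 else if even d then d + 1 else d - 1),
       nxt = (\<lambda>d. if d + 1 = 2 * l then 0 else if d = 2 * l + 3 then 2 * l else d + 1),
       root_dart = 0 \<rparr>"

lemma folded_square_simps:
  "darts (folded_square l) = {..<2 * l + 4}"
  "opp (folded_square l) d = (if d = 0 then 2 * l else if d = 2 * l then 0 else if d = 1 then 2 * l + 1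
     else if d = 2 * l + 1 then 1 else if even d then d + 1 else d - 1)"
  "nxt (folded_square l) d = (if d + 1 = 2 * l then 0 else if d = 2 * l + 3 then 2 * l else d + 1)"
  "root_dart (folded_square l) = 0"
  by (simp_all add: folded_square_def)

lemma folded_square:
  assumes l: "1 \<le> l"
  defines "m \<equiv> folded_square l"
  shows "quadrangulation m" "root_face m = {..<2 * l}" "card (internal_faces m) = 1"
    "perimeter m = 2 * l"
proof -
  note S = folded_square_simps[of l, folded m_def]
  define vf where "vf d = (if d < 2 * l then 0 else (1::nat))" for d :: nat
  define rf where "rf k = (if k = 0 then 0 else 2 * l)" for k :: nat
  \<comment> \<open>Label 0 is the vertex that carries the leaves, label 1 the other end of the root
    edge, \<open>2 * l + 3\<close> the vertex inside the folded square; each leaf is labelled by its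
    own dart.\<close>
  define vv where "vv d = (if d = 2 * l + 1 then 0 else if d = 2 * l \<or> d = 2 * l + 2 then 1 else if even d then 0 else d)" for d :: nat
  define rv where "rv d = d" for d :: nat
  have cs: "d = 0 \<or> d = 1 \<or> even d \<and> 2 \<le> d \<and> d + 2 < 2 * l \<or> even d \<and> 2 \<le> d \<and> d + 2 = 2 * l \<or> odd d \<and> 3 \<le> d \<and> d < 2 * l
     \<or> d = 2 * l \<or> d = 2 * l + 1 \<or> d = 2 * l + 2 \<or> d = 2 * l + 3"
    if d: "d < 2 * l + 4" for d
  proof -
    consider "d < 2 * l" "even d" | "d < 2 * l" "odd d" | "2 * l \<le> d" by linarith
    then show ?thesis
    proof cases
      case 1
      then have "d + 1 \<noteq> 2 * l" by presburger
      then have "d + 2 < 2 * l \<or> d + 2 = 2 * l" using 1 by linarith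
      moreover have "d = 0 \<or> 2 \<le> d" using 1 by (cases "d = 1") auto
      ultimately show ?thesis using 1 by blast
    next
      case 2
      then have "d = 1 \<or> 3 \<le> d" by (cases "d = 0"; cases "d = 2") auto
      then show ?thesis using 2 by blast
    next
      case 3
      then have "d = 2 * l \<or> d = 2 * l + 1 \<or> d = 2 * l + 2 \<or> d = 2 * l + 3" using d by linarith
      then show ?thesis by blast
    qed
  qed
  have P1: "finite (darts m)" "root_dart m \<in> darts m" by (simp_all add: S)
  have P2: "opp m d \<in> darts m \<and> opp m d \<noteq> d \<and> opp m (opp m d) = d" if d: "d \<in> darts m" for d
  proof -
    have dN: "d < 2 * l + 4" using d by (simp add: S(1))
    from cs[OF dN] show ?thesis
      by (elim disjE) (use l in \<open>auto simp: S(1,2)\<close>)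
  qed
  have P3: "nxt m ` darts m \<subseteq> darts m" by (auto simp: S)
  have P4: "inj_on (nxt m) (darts m)" by (auto simp: S inj_on_def split: if_splits)
  have P5: "vf (nxt m d) = vf d" if d: "d \<in> darts m" for d
  proof -
    have dN: "d < 2 * l + 4" using d by (simp add: S(1))
    from cs[OF dN] show ?thesis
      by (elim disjE) (use l in \<open>auto simp: S(3) vf_def\<close>)
  qed
  have P6: "vv (nxt m (opp m d)) = vv d" if d: "d \<in> darts m" for d
  proof -
    have dN: "d < 2 * l + 4" using d by (simp add: S(1))
    from cs[OF dN] show ?thesis
      by (elim disjE) (use l in \<open>auto simp: S(2,3) vv_def\<close>)
  qed
  have R1: "\<exists>k. (nxt m ^^ k) d = rf (vf d)" if d: "d \<in> darts m" for d
  proof (cases "d < 2 * l")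
    case True
    have r: "rf (vf d) = 0" using True by (simp add: rf_def vf_def)
    show ?thesis unfolding r
      by (rule reach_up[of 0 "2 * l - 1"]) (use True in \<open>auto simp: S(3)\<close>)
  next
    case False
    have dN: "d < 2 * l + 4" using d by (simp add: S(1))
    have r: "rf (vf d) = 2 * l" using False by (simp add: rf_def vf_def)
    show ?thesis unfolding r
      by (rule reach_up[of "2 * l" "2 * l + 3"]) (use False dN in \<open>auto simp: S(3)\<close>)
  qed
  have R2: "\<exists>k. ((nxt m \<circ> opp m) ^^ k) d = rv (vv d)" if d: "d \<in> darts m" for d
  proof -
    let ?s = "nxt m \<circ> opp m"
    have dN: "d < 2 * l + 4" using d by (simp add: S(1))
    have low: "\<exists>k. (?s ^^ k) e = 0" if e: "even e" "2 \<le> e" "e < 2 * l" for e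
    proof -
      have "e + 1 \<noteq> 2 * l" using e by presburger
      then have d2: "e \<le> 2 * l - 2" using e by linarith
      have step: "?s e = e + 2" if e: "2 \<le> e" "e < 2 * l - 2" "even e = even (2::nat)" for e
        using e by (auto simp: S(2,3))
      have a: "\<exists>k. (?s ^^ k) e = 2 * l - 2"
        by (rule reach_by2[of 2 "2 * l - 2", OF step]) (use e d2 in auto)
      have "2 \<le> 2 * l - 2" using d2 e by linarith
      then have "?s (2 * l - 2) = 0" by (auto simp: S(2,3))
      then have "\<exists>k. (?s ^^ k) (2 * l - 2) = 0" by (intro reach_within2) simp
      then show ?thesis using reach_trans[OF a] by blast
    qed
    from cs[OF dN] consider "vv d = d" | "even d" "2 \<le> d" "d < 2 * l" | "d = 2 * l" | "d = 2 * l + 1" | "d = 2 * l + 2"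
      by (elim disjE) (use l in \<open>auto simp: vv_def\<close>)
    then show ?thesis
    proof cases
      case 1
      then show ?thesis by (simp add: rv_def reach_refl)
    next
      case 2
      then have "rv (vv d) = 0" by (simp add: rv_def vv_def)
      then show ?thesis using low[OF 2] by simp
    next
      case 3
      have "?s d = rv (vv d)" using 3 l by (auto simp: rv_def vv_def S(2,3))
      then show ?thesis by (intro reach_within2) simp
    next
      case 4
      have r: "rv (vv d) = 0" using 4 by (simp add: rv_def vv_def)
      show ?thesis
      proof (cases "l = 1")
        case True
        have "?s d = 0" using 4 True by (auto simp: S(2,3))
        then show ?thesis unfolding r by (intro reach_within2) simp
      next
        case False
        have e: "?s d = 2" using 4 False l by (auto simp: S(2,3))
        have "\<exists>k. (?s ^^ k) (?s d) = 0" unfolding e using False l by (intro low) auto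
        then show ?thesis unfolding r by (rule reach_step)
      qed
    next
      case 5
      have "?s (?s d) = rv (vv d)" using 5 l by (auto simp: rv_def vv_def S(2,3))
      then show ?thesis by (intro reach_within2) simp
    qed
  qed
  have C: "darts m \<subseteq> T" if T: "T \<subseteq> darts m" "root_dart m \<in> T" "\<And>d. d \<in> T \<Longrightarrow> opp m d \<in> T"
    "\<And>d e. d \<in> T \<Longrightarrow> e \<in> darts m \<Longrightarrow> vf e = vf d \<Longrightarrow> e \<in> T" for T
  proof
    have r: "0 \<in> T" using T(2) by (simp add: S(4))
    then have s: "2 * l \<in> T" using T(3)[OF r] by (simp add: S(2))
    fix d assume d: "d \<in> darts m"
    show "d \<in> T"
    proof (cases "d < 2 * l")
      case True
      then show ?thesis using T(4)[OF r d] by (simp add: vf_def)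
    next
      case False
      then show ?thesis using T(4)[OF s d] by (simp add: vf_def)
    qed
  qed
  have vvD: "vv ` darts m = {0, 1, 2 * l + 3} \<union> (\<lambda>i. 2 * i + 1) ` {1..<l}"
  proof
    show "vv ` darts m \<subseteq> {0, 1, 2 * l + 3} \<union> (\<lambda>i. 2 * i + 1) ` {1..<l}"
    proof
      fix e assume "e \<in> vv ` darts m"
      then obtain d where d: "d < 2 * l + 4" "e = vv d" by (auto simp: S(1))
      have "e \<in> {0, 1, 2 * l + 3} \<or> odd d \<and> 3 \<le> d \<and> d < 2 * l \<and> e = d"
        using cs[OF d(1)] unfolding d(2) by (elim disjE) (use l in \<open>auto simp: vv_def\<close>)
      then show "e \<in> {0, 1, 2 * l + 3} \<union> (\<lambda>i. 2 * i + 1) ` {1..<l}"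
      proof
        assume a: "odd d \<and> 3 \<le> d \<and> d < 2 * l \<and> e = d"
        then obtain i where "d = 2 * i + 1" by (auto elim: oddE)
        then show ?thesis using a by auto
      qed auto
    qed
    show "{0, 1, 2 * l + 3} \<union> (\<lambda>i. 2 * i + 1) ` {1..<l} \<subseteq> vv ` darts m"
    proof
      fix e assume e: "e \<in> {0, 1, 2 * l + 3} \<union> (\<lambda>i. 2 * i + 1) ` {1..<l}"
      then have "e < 2 * l + 4" by auto
      moreover have "vv e = e"
      proof -
        have "e = 0 \<or> odd e \<and> e \<noteq> 2 * l + 1" using e l by auto
        then show ?thesis
        proof
          assume "e = 0"
          then show ?thesis using l by (simp add: vv_def)
        next
          assume o: "odd e \<and> e \<noteq> 2 * l + 1"
          then have "e \<noteq> 2 * l" "e \<noteq> 2 * l + 2" by presburger+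
          then show ?thesis using o unfolding vv_def by simp
        qed
      qed
      ultimately show "e \<in> vv ` darts m" unfolding S(1) by (metis imageI lessThan_iff)
    qed
  qed
  have E: "2 * (card (vv ` darts m) + card (vf ` darts m)) = card (darts m) + 4"
  proof -
    let ?A = "(\<lambda>i::nat. 2 * i + 1) ` {1..<l}"
    have A: "card ?A = l - 1" by (simp add: card_image inj_on_def)
    have "{0, 1, 2 * l + 3} \<inter> ?A = {}" by auto
    then have "card (vv ` darts m) = l + 2"
      unfolding vvD using A l by (subst card_Un_disjoint) auto
    moreover have "vf ` darts m = {0, 1}"
    proof
      have "vf 0 = 0" "vf (2 * l) = 1" using l by (auto simp: vf_def)
      moreover have "0 \<in> darts m" "2 * l \<in> darts m" by (auto simp: S)
      ultimately show "{0, 1} \<subseteq> vf ` darts m" by force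
    qed (auto simp: vf_def)
    ultimately show ?thesis by (simp add: S(1))
  qed
  note P = planar_by_labels[where vf = vf and vv = vv and rf = rf and rv = rv, OF P1 P2 P3 P4 P5 R1 P6 R2 C E]
  have pl: "planar_map m" by (rule P(1))
  have F: "d \<in> darts m \<Longrightarrow> face_at m d = {e \<in> darts m. vf e = vf d}" for d by (rule P(2))
  have F1: "face_at m d = {..<2 * l}" if "d < 2 * l" for d
  proof -
    have v: "vf e = vf d \<longleftrightarrow> e < 2 * l" for e using that by (simp add: vf_def)
    have "d \<in> darts m" using that by (simp add: S(1))
    then show ?thesis unfolding F[OF \<open>d \<in> darts m\<close>] v S(1) by auto
  qed
  have F2: "face_at m d = {2 * l..<2 * l + 4}" if "2 * l \<le> d" "d < 2 * l + 4" for d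
  proof -
    have v: "vf e = vf d \<longleftrightarrow> 2 * l \<le> e" for e using that by (simp add: vf_def)
    have "d \<in> darts m" using that by (simp add: S(1))
    then show ?thesis unfolding F[OF \<open>d \<in> darts m\<close>] v S(1) by auto
  qed
  show rf: "root_face m = {..<2 * l}" using F1[of 0] l by (simp add: root_face_def S(4))
  have int: "internal_faces m = {{2 * l..<2 * l + 4}}"
  proof
    show "internal_faces m \<subseteq> {{2 * l..<2 * l + 4}}"
    proof
      fix f assume "f \<in> internal_faces m"
      then obtain d where d: "d < 2 * l + 4" "f = face_at m d" "f \<noteq> {..<2 * l}"
        by (auto simp: internal_faces_def map_faces_def S(1) rf)
      have "\<not> d < 2 * l" using F1[of d] d(2,3) by blast
      then show "f \<in> {{2 * l..<2 * l + 4}}" using F2[of d] d(1,2) by simp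
    qed
    have "2 * l \<in> {2 * l..<2 * l + 4}" "2 * l \<notin> {..<2 * l}" by auto
    then have "{2 * l..<2 * l + 4} \<noteq> {..<2 * l}" by blast
    moreover have "{2 * l..<2 * l + 4} = face_at m (2 * l)" using F2[of "2 * l"] by simp
    moreover have "2 * l \<in> darts m" by (simp add: S(1))
    ultimately show "{{2 * l..<2 * l + 4}} \<subseteq> internal_faces m"
      unfolding internal_faces_def map_faces_def rf by auto
  qed
  show "quadrangulation m" using pl int by (simp add: quadrangulation_def)
  show "card (internal_faces m) = 1" by (simp add: int)
  show "perimeter m = 2 * l" by (simp add: perimeter_def rf)
qed

text \<open>All darts of a star lie on its root face and vanish in the gluing, so only the outer
  darts of \<open>bridge_hole\<close> survive, and these are numbered as in
  \<open>double_star\<close>. This evaluates the probability of a root bridge through trees.\<close>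

lemma glue_bridge_stars:
  fixes l1 l2 N p :: nat
  assumes N: "N = 2 * l1 + 2 * l2 + 2" and p: "p = 2 * l1 + 1"
  defines "u \<equiv> \<lambda>h. if h = N + 1 then double_star 0 (l1 - 1) else double_star 0 (l2 - 1)"
  shows "iso_class (glue (bridge_hole l1 l2) u) = iso_class (double_star l1 l2)"
    "u \<in> fillings (bridge_hole l1 l2)"
proof -
  define q m where "q = bridge_hole l1 l2" and "m = double_star l1 l2"
  note S = bridge_hole_simps[OF N p q_def] and T = double_star_simps[OF N p, folded m_def]
  note hp = bridge_hole_per[OF N p q_def] and out = bridge_hole_outer[OF N p q_def]
    and H = bridge_hole_darts[OF N p q_def]
  define c where "c h = (if h = N + 1 then l1 else l2)" for h
  have u: "u h = double_star 0 (c h - 1)" for h by (simp add: u_def c_def)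
  have mk: "h = N + 1 \<and> 0 < l1 \<or> h = N + p + 1 \<and> 0 < l2" if "h \<in> marks q" for h
    using that by (auto simp: S(5) split: if_splits)
  have ch: "0 < c h" "hole_per q h = 2 * c h" if "h \<in> marks q" for h
    using mk[OF that] hp p by (auto simp: c_def)
  have D: "darts q - hole_darts q = {..<N}" unfolding H S(1) by auto
  have Du: "darts (u h) = {..<2 * c h}" "root_face (u h) = darts (u h)" "perimeter (u h) = 2 * c h"
    "planar_map (u h)" "root_dart (u h) = 0" "nxt (u h) d = (if d + 1 = 2 * c h then 0 else d + 1)"
    "opp (u h) d = (if even d then d + 1 else d - 1)"
    if h: "h \<in> marks q" for h d
  proof -
    have e: "2 * c h = 2 * 0 + 2 * (c h - 1) + 2" using ch(1)[OF h] by simp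
    note V = double_star_simps[OF e, of 1, folded u, simplified] double_star[of 0 "c h - 1", folded u]
    show "darts (u h) = {..<2 * c h}" "root_face (u h) = darts (u h)" "planar_map (u h)" "root_dart (u h) = 0"
      "nxt (u h) d = (if d + 1 = 2 * c h then 0 else d + 1)"
      using V by simp_all
    show "perimeter (u h) = 2 * c h" using V ch(1)[OF h] by simp
    show "opp (u h) d = (if even d then d + 1 else d - 1)"
      using V(2)[of d] by (auto elim: oddE)
  qed
  have uq: "planar_map (u h) \<and> perimeter (u h) = hole_per q h" if "h \<in> marks q" for h
    using Du(3,4)[OF that] ch(2)[OF that] by simp
  then show "u \<in> fillings (bridge_hole l1 l2)" unfolding fillings_def q_def by blast
  \<comment> \<open>Offsets of the two boundary walks, which start after the darts 0 and
    \<open>p\<close>.\<close>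
  define G where "G h b = (if h = N + 1 then b + 1 else b + p + 1)" for h b :: nat
  have "iso_class (glue q u) = iso_class m"
  proof (rule glue_iso(2)[where F = "\<lambda>d. d" and G = G])
    show "quad_with_holes q" by (rule bridge_hole_holes[OF N p q_def])
    show "opp q a \<notin> hole_darts q" if "a \<in> hole_darts q" for a
      using that unfolding H by (auto simp: S(1,2))
    show "opp q ((nxt q ^^ (hole_per q h - k)) h) = G h ((nxt (u h) ^^ k) (root_dart (u h)))"
      if h: "h \<in> marks q" and k: "k < hole_per q h" for h k
    proof -
      have k': "k < 2 * c h" using k ch(2)[OF h] by simp
      have "(nxt (u h) ^^ k) 0 = 0 + k"
        by (rule funpow_run_up[of 0 "2 * c h - 1"]) (use k' in \<open>auto simp: Du(6)[OF h]\<close>)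
      then have e: "(nxt (u h) ^^ k) (root_dart (u h)) = k" by (simp add: Du(5)[OF h])
      show ?thesis unfolding e ch(2)[OF h]
        using mk[OF h] out[of k] k' p by (auto simp: G_def c_def)
    qed
    show "G h (opp (u h) b) = opp m (G h b)" if h: "h \<in> marks q" and b: "b \<in> darts (u h)" for h b
    proof -
      have b': "b < 2 * c h" using b Du(1)[OF h] by simp
      show ?thesis
      proof (cases "h = N + 1")
        case True
        then have "b + 1 < p" using b' by (simp add: c_def p)
        then show ?thesis using True unfolding Du(7)[OF h] G_def T(2) by auto
      next
        case False
        then show ?thesis using p unfolding Du(7)[OF h] G_def T(2) by (auto elim!: oddE)
      qed
    qed
    show "opp q d = opp m d" if d: "d \<in> darts q" "d \<notin> hole_darts q" "opp q d \<notin> hole_darts q" for d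
    proof -
      have dN: "d < N" using d(1,2) D by auto
      have "d = 0 \<or> d = p"
      proof (rule ccontr)
        assume a: "\<not> (d = 0 \<or> d = p)"
        then have "opp q d = d + N" using dN by (simp add: S(2))
        then show False using d(3) a dN unfolding H by (auto simp: S(1))
      qed
      then show ?thesis by (auto simp: S(2) T(2))
    qed
    show "G h (nxt (u h) b) = nxt m (G h b)" if "h \<in> marks q" "b \<in> darts (u h) - root_face (u h)" for h b
      using that Du(2) by auto
    show "nxt q d = nxt m d" if d: "d \<in> darts q" "d \<notin> hole_darts q" for d
    proof -
      have "d < N" using d D by auto
      then show ?thesis by (simp add: S(3) T(3))
    qed
    show "root_dart q = root_dart m" by (simp add: S(4) T(4))
    have e: "(\<Union>h\<in>marks q. {h} \<times> (darts (u h) - root_face (u h))) = {}" using Du(2) by auto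
    have "darts (glue q u) = Inl ` {..<N}" unfolding darts_glue D e by simp
    moreover have "bij_betw (case_sum (\<lambda>d. d) (\<lambda>(h, b). G h b)) (Inl ` {..<N}) {..<N}"
      by (auto simp: bij_betw_def inj_on_def image_image)
    ultimately show "bij_betw (case_sum (\<lambda>d. d) (\<lambda>(h, b). G h b)) (darts (glue q u)) (darts m)"
      unfolding T(1) by simp
  qed (use uq in auto)
  then show "iso_class (glue (bridge_hole l1 l2) u) = iso_class (double_star l1 l2)"
    by (simp add: q_def m_def)
qed

section \<open>The critical weight\<close>

lemma higher_diffs:
  "(diffs ^^ k) c n = (fact (n + k) / fact n) * (c (n + k) :: 'a :: field_char_0)"
proof (induction k arbitrary: n)
  case (Suc k)
  have "(diffs ^^ Suc k) c n = of_nat (Suc n) * (diffs ^^ k) c (Suc n)"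
    by (simp add: diffs_def)
  also have "\<dots> = of_nat (Suc n) * (fact (Suc n + k) / fact (Suc n)) * c (Suc n + k)"
    unfolding Suc.IH by (simp add: mult.assoc)
  also have "of_nat (Suc n) * (fact (Suc n + k) / fact (Suc n)) = (fact (n + Suc k) / fact n :: 'a)"
    by (simp add: fact_reduce[of "Suc n"] del: of_nat_Suc)
  finally show ?case by simp
qed simp

lemma higher_deriv_powser:
  fixes c :: "nat \<Rightarrow> complex"
  assumes conv: "\<And>z. norm z < R \<Longrightarrow> summable (\<lambda>n. c n * z ^ n)" and z: "norm z < R"
  shows "(deriv ^^ k) (\<lambda>z. \<Sum>n. c n * z ^ n) z = (\<Sum>n. (diffs ^^ k) c n * z ^ n)"
    and "summable (\<lambda>n. (diffs ^^ k) c n * z ^ n)"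
proof -
  have sm: "summable (\<lambda>n. (diffs ^^ k) c n * z ^ n)" if "norm z < R" for z k
    using that
  proof (induction k arbitrary: z)
    case (Suc k)
    show ?case using termdiff_converges[OF Suc.prems Suc.IH] by simp
  qed (use conv in simp)
  show "summable (\<lambda>n. (diffs ^^ k) c n * z ^ n)" by (rule sm[OF z])
  show "(deriv ^^ k) (\<lambda>z. \<Sum>n. c n * z ^ n) z = (\<Sum>n. (diffs ^^ k) c n * z ^ n)"
    using z
  proof (induction k arbitrary: z)
    case (Suc k)
    let ?A = "\<lambda>z. \<Sum>n. (diffs ^^ k) c n * z ^ n"
    obtain K where K: "norm z < K" "K < R" using Suc.prems dense by blast
    have "0 < K" using K norm_ge_zero[of z] by linarith
    then have nK: "norm (of_real K :: complex) = K" by simp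
    have "((\<lambda>z. \<Sum>n. (diffs ^^ k) c n * z ^ n) has_field_derivative (\<Sum>n. diffs ((diffs ^^ k) c) n * z ^ n)) (at z)"
      by (rule termdiffs_strong[where K = "of_real K"]) (use sm[of "of_real K" k] nK K in auto)
    then have d: "deriv ?A z = (\<Sum>n. (diffs ^^ Suc k) c n * z ^ n)" by (simp add: DERIV_imp_deriv)
    have "deriv ((deriv ^^ k) (\<lambda>z. \<Sum>n. c n * z ^ n)) z = deriv ?A z"
    proof (rule deriv_cong_ev)
      show "\<forall>\<^sub>F x in nhds z. (deriv ^^ k) (\<lambda>z. \<Sum>n. c n * z ^ n) x = ?A x"
        unfolding eventually_nhds
        by (rule exI[of _ "ball 0 R"]) (use Suc in auto)
    qed simp
    then show ?case using d by simp
  qed simp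
qed

text \<open>
  Vivanti-Pringsheim: the Taylor coefficients at \<open>r\<close> are sums of nonnegative terms, so the double
  series can be rearranged.
\<close>

lemma nonneg_powser_extend:
  fixes a :: "nat \<Rightarrow> real"
  assumes nonneg: "\<And>n. 0 \<le> a n"
    and r: "0 < r" "r < R"
    and conv: "\<And>z::complex. norm z < R \<Longrightarrow> summable (\<lambda>n. of_real (a n) * z ^ n)"
    and hol: "F holomorphic_on ball (of_real r) \<rho>"
    and eps: "0 < \<epsilon>"
    and eq: "\<And>z. dist z (of_real r) < \<epsilon> \<Longrightarrow> F z = (\<Sum>n. of_real (a n) * z ^ n)"
    and w: "0 \<le> w" "w < \<rho>"
  shows "summable (\<lambda>n. a n * (r + w) ^ n)"
proof -
  let ?f = "\<lambda>z::complex. \<Sum>n. of_real (a n) * z ^ n"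
  \<comment> \<open>Contribution of the monomial of degree \<open>n + k\<close> to the
    \<open>k\<close>-th Taylor coefficient at \<open>r\<close>.\<close>
  define t where "t k n = real ((n + k) choose k) * a (n + k) * r ^ n" for k n
  have nr: "norm (of_real r :: complex) < R" using r by simp
  have fact_choose: "fact (n + k) / fact n / fact k = real ((n + k) choose k)" for n k
    by (simp add: binomial_fact)
  have t_eq: "(diffs ^^ k) (\<lambda>n. of_real (a n)) n * of_real r ^ n = (of_real (fact k * t k n) :: complex)" for k n
    unfolding higher_diffs t_def fact_choose[symmetric] by simp
  have tsum: "summable (t k)" for k
  proof -
    have "summable (\<lambda>n. of_real (fact k * t k n) :: complex)"
      using higher_deriv_powser(2)[OF conv nr, of k] unfolding t_eq .
    then have "summable (\<lambda>n. fact k * t k n)" by (simp only: summable_complex_of_real)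
    then show ?thesis using summable_mult_D[of "fact k" "t k"] by simp
  qed
  define b where "b k = (\<Sum>n. t k n)" for k
  have der: "(deriv ^^ k) F (of_real r) = of_real (fact k * b k)" for k
  proof -
    have "(deriv ^^ k) F (of_real r) = (deriv ^^ k) ?f (of_real r)"
    proof (rule higher_deriv_cong_ev)
      show "\<forall>\<^sub>F x in nhds (of_real r). F x = ?f x"
        unfolding eventually_nhds_metric using eps eq by auto
    qed simp
    also have "\<dots> = (\<Sum>n. of_real (fact k * t k n))"
      using higher_deriv_powser(1)[OF conv nr, of k] unfolding t_eq .
    also have "\<dots> = of_real (\<Sum>n. fact k * t k n)"
      by (rule suminf_of_real[symmetric]) (use tsum in \<open>intro summable_mult\<close>)
    also have "(\<Sum>n. fact k * t k n) = fact k * b k"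
      unfolding b_def by (rule suminf_mult[OF tsum])
    finally show ?thesis .
  qed
  have "(\<lambda>n. (deriv ^^ n) F (of_real r) / fact n * (of_real (r + w) - of_real r) ^ n) sums F (of_real (r + w))"
    by (rule holomorphic_power_series[OF hol]) (use w in \<open>simp add: dist_norm\<close>)
  then have "summable (\<lambda>n. of_real (b n * w ^ n) :: complex)"
    unfolding der by (auto simp: sums_iff)
  then have sb: "summable (\<lambda>n. b n * w ^ n)" by (simp only: summable_complex_of_real)
  have tn: "0 \<le> t k n" for k n unfolding t_def using nonneg r by simp
  have bn: "0 \<le> b k" for k unfolding b_def by (rule suminf_nonneg[OF tsum tn])
  \<comment> \<open>Terms with \<open>n < k\<close> vanish with the binomial coefficient, so the
    truncated \<open>n - k\<close> is harmless and the shift by \<open>k\<close> adds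
    nothing.\<close>
  have part: "(\<Sum>n<N. real (n choose k) * a n * r ^ (n - k)) \<le> b k" for N k
  proof -
    have "(\<Sum>n<N. real (n choose k) * a n * r ^ (n - k))
        \<le> (\<Sum>n<k + N. real (n choose k) * a n * r ^ (n - k))"
      by (rule sum_mono2) (use nonneg r in auto)
    also have "\<dots> = (\<Sum>n<N. t k n)"
    proof (induction N)
      case 0
      show ?case by (simp add: binomial_eq_0)
    next
      case (Suc N)
      then show ?case by (simp add: t_def add.commute)
    qed
    also have "\<dots> \<le> b k" unfolding b_def by (rule sum_le_suminf[OF tsum]) (use tn in auto)
    finally show ?thesis .
  qed
  \<comment> \<open>Expanding \<open>(r + w) ^ n\<close> bounds the partial sums at
    \<open>r + w\<close> by the Taylor series of \<open>F\<close>, which converges because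
    \<open>r + w\<close> lies in the ball.\<close>
  have bound: "(\<Sum>n<N. a n * (r + w) ^ n) \<le> (\<Sum>k. b k * w ^ k)" for N
  proof -
    have "a n * (r + w) ^ n = (\<Sum>k<N. real (n choose k) * a n * r ^ (n - k) * w ^ k)" if "n < N" for n
    proof -
      have "(w + r) ^ n = (\<Sum>k\<le>n. real (n choose k) * w ^ k * r ^ (n - k))"
        by (rule binomial_ring)
      also have "\<dots> = (\<Sum>k<N. real (n choose k) * w ^ k * r ^ (n - k))"
        by (rule sum.mono_neutral_left) (use that in \<open>auto simp: binomial_eq_0\<close>)
      finally have "a n * (r + w) ^ n = a n * (\<Sum>k<N. real (n choose k) * w ^ k * r ^ (n - k))"
        by (simp add: add.commute)
      then show ?thesis by (simp add: sum_distrib_left mult_ac)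
    qed
    then have "(\<Sum>n<N. a n * (r + w) ^ n) = (\<Sum>n<N. \<Sum>k<N. real (n choose k) * a n * r ^ (n - k) * w ^ k)"
      by (intro sum.cong) auto
    also have "\<dots> = (\<Sum>k<N. (\<Sum>n<N. real (n choose k) * a n * r ^ (n - k)) * w ^ k)"
      by (subst sum.swap) (simp add: sum_distrib_right)
    also have "\<dots> \<le> (\<Sum>k<N. b k * w ^ k)"
      by (intro sum_mono mult_right_mono part) (use w in auto)
    also have "\<dots> \<le> (\<Sum>k. b k * w ^ k)"
      by (rule sum_le_suminf[OF sb]) (use bn w in auto)
    finally show ?thesis .
  qed
  show ?thesis
    by (rule summableI_nonneg_bounded[OF _ bound]) (use nonneg r w in auto)
qed

text \<open>Summing the recursion against the powers of z gives z^2 f^2 + (q - z) f = q - z + q U(1)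
  z; multiplying by 4 z^2 completes the square. The type is general because the equation serves real
  \<open>z\<close>, for signs and monotonicity, as well as complex \<open>z\<close>, for analytic
  continuation.\<close>

lemma tutte_functional_equation:
  fixes z :: "'a :: {real_normed_field, banach}"
  assumes U0: "U 0 = (1::real)" and nonneg: "\<And>n. 0 \<le> U n"
    and eq: "\<And>l. U (Suc l) = q * U (Suc (Suc l)) + (\<Sum>i\<le>l. U i * U (l - i))"
    and conv: "summable (\<lambda>n. U n * norm z ^ n)"
  defines "f \<equiv> (\<Sum>n. of_real (U n) * z ^ n)"
  shows "(of_real q - z + 2 * z\<^sup>2 * f)\<^sup>2
       = (of_real q - z)\<^sup>2 + 4 * z\<^sup>2 * (of_real q - z + of_real (q * U 1) * z)"
proof -
  let ?a = "\<lambda>n. of_real (U n) * z ^ n"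
  have n: "norm (?a n) = U n * norm z ^ n" for n using nonneg by (simp add: norm_mult norm_power)
  have sn: "summable (\<lambda>n. norm (?a n))" unfolding n by (rule conv)
  then have s: "summable ?a" by (rule summable_norm_cancel)
  note p1 = powser_split_head[OF s]
  have s1: "summable (\<lambda>n. of_real (U (Suc n)) * z ^ n)" by (rule p1(3))
  note p2 = powser_split_head[OF s1]
  have s2: "summable (\<lambda>n. of_real (U (Suc (Suc n))) * z ^ n)" by (rule p2(3))
  have f1: "z * (\<Sum>n. of_real (U (Suc n)) * z ^ n) = f - 1"
    using p1(2) U0 unfolding f_def by (simp add: mult.commute)
  have f2: "z * (\<Sum>n. of_real (U (Suc (Suc n))) * z ^ n) = (\<Sum>n. of_real (U (Suc n)) * z ^ n) - of_real (U 1)"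
    using p2(2) by (simp add: mult.commute)
  have "f * f = (\<Sum>k. \<Sum>i\<le>k. ?a i * ?a (k - i))"
    unfolding f_def by (rule Cauchy_product[OF sn sn])
  also have "(\<lambda>k. \<Sum>i\<le>k. ?a i * ?a (k - i))
     = (\<lambda>k. of_real (U (Suc k)) * z ^ k - of_real q * (of_real (U (Suc (Suc k))) * z ^ k))"
  proof
    fix k
    have "(\<Sum>i\<le>k. ?a i * ?a (k - i)) = (\<Sum>i\<le>k. of_real (U i * U (k - i)) * z ^ k)"
      by (rule sum.cong) (auto simp: power_add[symmetric] mult_ac)
    also have "\<dots> = of_real (\<Sum>i\<le>k. U i * U (k - i)) * z ^ k"
      by (simp add: sum_distrib_right)
    also have "(\<Sum>i\<le>k. U i * U (k - i)) = U (Suc k) - q * U (Suc (Suc k))"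
      using eq[of k] by simp
    finally show "(\<Sum>i\<le>k. ?a i * ?a (k - i))
       = of_real (U (Suc k)) * z ^ k - of_real q * (of_real (U (Suc (Suc k))) * z ^ k)"
      by (simp add: algebra_simps)
  qed
  also have "(\<Sum>k. of_real (U (Suc k)) * z ^ k - of_real q * (of_real (U (Suc (Suc k))) * z ^ k))
     = (\<Sum>n. of_real (U (Suc n)) * z ^ n) - of_real q * (\<Sum>n. of_real (U (Suc (Suc n))) * z ^ n)"
    by (subst suminf_diff[OF s1 summable_mult[OF s2], symmetric]) (simp add: suminf_mult[OF s2])
  finally have ff: "f * f = (\<Sum>n. of_real (U (Suc n)) * z ^ n) - of_real q * (\<Sum>n. of_real (U (Suc (Suc n))) * z ^ n)" .
  define A B where "A = (\<Sum>n. of_real (U (Suc n)) * z ^ n)" and "B = (\<Sum>n. of_real (U (Suc (Suc n))) * z ^ n)"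
  have "z * A = f - 1" "z * B = A - of_real (U 1)" "f * f = A - of_real q * B"
    using f1 f2 ff unfolding A_def B_def by auto
  then show ?thesis unfolding of_real_mult by algebra
qed

text \<open>
  With \<open>g = q - z + 2 z\<^sup>2 f\<close>, the square of \<open>g\<close> is a cubic \<open>\<Delta>\<close>. If \<open>q > 1 / 12\<close>, then
  \<open>\<Delta> x / x ^ 3\<close> is strictly decreasing, so \<open>\<Delta>\<close> has at most one positive zero, which is simple. Let
  \<open>R\<close> be the radius of convergence. If \<open>\<Delta> R = 0\<close>, then the slope of \<open>g = sqrt \<Delta>\<close> tends to \<open>-\<infinity>\<close>,
  although \<open>g x + x\<close> is increasing; if \<open>\<Delta> R > 0\<close>, then \<open>f\<close> is analytic at \<open>R\<close>.
\<close>

lemma tutte_recursion_bound: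
  fixes U :: "nat \<Rightarrow> real"
  assumes U0: "U 0 = 1" and nonneg: "\<And>n. 0 \<le> U n"
    and eq: "\<And>l. U (Suc l) = q * U (Suc (Suc l)) + (\<Sum>i\<le>l. U i * U (l - i))"
    and q: "0 < q"
  shows "q \<le> 1 / 12"
proof (rule ccontr)
  assume "\<not> q \<le> 1 / 12"
  then have q12: "1 / 12 < q" by simp
  define S where "S = {x. 0 \<le> x \<and> summable (\<lambda>n. U n * x ^ n)}"
  \<comment> \<open>Keeping a single term of the convolution shows that \<open>U\<close> does not
    decrease, so the radius of convergence is at most 1, in particular finite.\<close>
  have U1: "1 \<le> U n" for n
  proof (induction n)
    case (Suc n)
    have "U 0 * U (n - 0) \<le> (\<Sum>i\<le>n. U i * U (n - i))"
      by (rule member_le_sum) (use nonneg in auto)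
    moreover have "0 \<le> q * U (Suc (Suc n))" using q nonneg by simp
    ultimately show ?case using eq[of n] U0 Suc by simp
  qed (simp add: U0)
  have Sle: "x \<le> 1" if "x \<in> S" for x
  proof (rule ccontr)
    assume "\<not> x \<le> 1"
    then have x: "1 < x" by simp
    have "(\<lambda>n. U n * x ^ n) \<longlonglongrightarrow> 0" using that by (simp add: S_def summable_LIMSEQ_zero)
    moreover have "1 \<le> U n * x ^ n" for n
      using mult_mono[OF U1[of n] one_le_power[of x n]] x U1[of n] by simp
    ultimately show False
      using LIMSEQ_le_const[of "\<lambda>n. U n * x ^ n" 0 1] by force
  qed
  have qS: "q / 2 \<in> S"
  proof -
    \<comment> \<open>Dropping the convolution bounds the growth of \<open>U\<close> by a factor
      \<open>1 / q\<close> per step, so the radius of convergence is positive.\<close>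
    have bound: "U (Suc n) * q ^ n \<le> U 1" for n
    proof (induction n)
      case (Suc n)
      have "0 \<le> (\<Sum>i\<le>n. U i * U (n - i))" by (rule sum_nonneg) (use nonneg in auto)
      then have "q * U (Suc (Suc n)) \<le> U (Suc n)" using eq[of n] by simp
      then have "q * U (Suc (Suc n)) * q ^ n \<le> U (Suc n) * q ^ n"
        using q by (intro mult_right_mono) auto
      then show ?case using Suc by (simp add: mult_ac)
    qed simp
    have "summable (\<lambda>n. U 1 * q / 2 * (1/2 :: real) ^ n)"
      by (intro summable_mult summable_geometric) simp
    then have "summable (\<lambda>n. U (Suc n) * (q / 2) ^ Suc n)"
    proof (rule summable_comparison_test'[where N = 0])
      fix n
      have "U (Suc n) * (q / 2) ^ Suc n = (U (Suc n) * q ^ n) * (q / 2 * (1/2) ^ n)"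
        by (simp add: power_divide)
      also have "\<dots> \<le> U 1 * (q / 2 * (1/2) ^ n)"
        using bound q by (intro mult_right_mono) auto
      finally show "norm (U (Suc n) * (q / 2) ^ Suc n) \<le> U 1 * q / 2 * (1/2) ^ n"
        using nonneg q by (simp add: abs_mult)
    qed
    then have "summable (\<lambda>n. U n * (q / 2) ^ n)" by (subst (asm) summable_Suc_iff)
    then show ?thesis using q by (simp add: S_def)
  qed
  define R where "R = Sup S"
  have bdd: "bdd_above S" using Sle by (auto simp: bdd_above_def)
  have R0: "0 < R" using cSup_upper[OF qS bdd] q by (simp add: R_def)
  have inS: "summable (\<lambda>n. U n * x ^ n)" if x: "0 \<le> x" "x < R" for x
  proof -
    obtain y where y: "y \<in> S" "x < y" using x less_cSup_iff[of S x] bdd qS by (auto simp: R_def)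
    have "summable (\<lambda>n. U n * y ^ n)" using y by (simp add: S_def)
    then show ?thesis using powser_inside[of U y x] y x by (simp add: summable_norm_cancel)
  qed
  have notin: "\<not> summable (\<lambda>n. U n * x ^ n)" if "R < x" for x
    using cSup_upper[OF _ bdd, of x] that R0 by (auto simp: R_def S_def)
  define f where "f x = (\<Sum>n. U n * x ^ n)" for x :: real
  define g where "g x = q - x + 2 * x\<^sup>2 * f x" for x
  define \<Delta> where "\<Delta> x = (q - x)\<^sup>2 + 4 * x\<^sup>2 * (q - x + q * U 1 * x)" for x
  have g2: "(g x)\<^sup>2 = \<Delta> x" if "0 \<le> x" "x < R" for x
    using tutte_functional_equation[OF U0 nonneg eq, of x] inS[OF that] that
    unfolding g_def f_def \<Delta>_def by simp
  have cf: "isCont f x" if x: "0 \<le> x" "x < R" for x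
  proof -
    obtain y where y: "x < y" "y < R" using x dense by blast
    show ?thesis unfolding f_def
      by (rule isCont_powser[where K = y]) (use inS[of y] y x in auto)
  qed
  have cg: "isCont g x" if "0 \<le> x" "x < R" for x
    unfolding g_def by (intro continuous_intros cf that)
  \<comment> \<open>With \<open>s = 1 / x\<close>, \<open>\<Delta> x / x ^ 3\<close> is a cubic in
    \<open>s\<close>; \<open>m0\<close> is the minimum of its derivative, taken at
    \<open>s = 2 / (3 * q)\<close>.\<close>
  define m0 where "m0 = 4 * q - 1 / 3"
  have m0: "0 < m0" using q12 by (simp add: m0_def)
  have mono: "\<Delta> y / y ^ 3 + m0 * (1 / x - 1 / y) \<le> \<Delta> x / x ^ 3" if xy: "0 < x" "x < y" for x y
  proof -
    define s t where "s = 1 / x" and "t = 1 / y"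
    have st: "t < s" using xy by (simp add: s_def t_def frac_less2)
    have \<Delta>s: "\<Delta> x / x ^ 3 = q\<^sup>2 * s ^ 3 - 2 * q * s\<^sup>2 + (1 + 4 * q) * s - 4 * (1 - q * U 1)"
      using xy unfolding \<Delta>_def s_def by (simp add: field_simps power2_eq_square power3_eq_cube)
    have \<Delta>t: "\<Delta> y / y ^ 3 = q\<^sup>2 * t ^ 3 - 2 * q * t\<^sup>2 + (1 + 4 * q) * t - 4 * (1 - q * U 1)"
      using xy unfolding \<Delta>_def t_def by (simp add: field_simps power2_eq_square power3_eq_cube)
    \<comment> \<open>The divided difference of the cubic, less \<open>m0\<close>, as a sum of
      squares.\<close>
    have "q\<^sup>2 * (s\<^sup>2 + s * t + t\<^sup>2) - 2 * q * (s + t) + 1 + 4 * q - m0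
        = 3 * (q * (s + t) / 2 - 2 / 3)\<^sup>2 + q\<^sup>2 * (s - t)\<^sup>2 / 4"
      unfolding m0_def by (simp add: field_simps power2_eq_square)
    then have k: "m0 \<le> q\<^sup>2 * (s\<^sup>2 + s * t + t\<^sup>2) - 2 * q * (s + t) + 1 + 4 * q"
      using zero_le_power2[of "q * (s + t) / 2 - 2 / 3"] mult_nonneg_nonneg[OF zero_le_power2[of q] zero_le_power2[of "s - t"]]
      by linarith
    have "\<Delta> x / x ^ 3 - \<Delta> y / y ^ 3 = (q\<^sup>2 * (s\<^sup>2 + s * t + t\<^sup>2) - 2 * q * (s + t) + 1 + 4 * q) * (s - t)"
      unfolding \<Delta>s \<Delta>t by (simp add: field_simps power2_eq_square power3_eq_cube)
    moreover have "\<dots> \<ge> m0 * (s - t)" using k st by (intro mult_right_mono) auto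
    ultimately show ?thesis unfolding s_def t_def by linarith
  qed
  have cD: "isCont \<Delta> x" for x unfolding \<Delta>_def by (intro continuous_intros)
  have evR: "\<forall>\<^sub>F x in at_left R. 0 < x \<and> x < R"
    using eventually_at_left_real[OF R0] by (auto elim: eventually_mono)
  have limD: "(\<Delta> \<longlongrightarrow> \<Delta> R) (at_left R)"
    using cD[of R] unfolding isCont_def filterlim_at_split by simp
  have DR: "0 \<le> \<Delta> R"
    by (rule tendsto_lowerbound[OF limD]) (use evR g2 in \<open>auto elim!: eventually_mono simp flip: g2\<close>)
  have Dpos: "0 < \<Delta> x" if x: "0 < x" "x < R" for x
  proof -
    have "1 / R < 1 / x" using x by (simp add: frac_less2)
    then have "0 < m0 * (1 / x - 1 / R)" using m0 by simp
    then have "0 < \<Delta> x / x ^ 3"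
      using mono[OF x] DR R0 by (smt (verit) divide_nonneg_pos zero_less_power)
    then show ?thesis using x by (simp add: zero_less_divide_iff)
  qed
  \<comment> \<open>\<open>g\<close> starts at \<open>q > 0\<close> and its square has no zero
    before \<open>R\<close>, so \<open>g\<close> is the positive root throughout.\<close>
  have gpos: "0 < g x" if x: "0 \<le> x" "x < R" for x
  proof (rule ccontr)
    assume "\<not> 0 < g x"
    moreover have "g 0 = q" by (simp add: g_def)
    ultimately obtain y where y: "0 \<le> y" "y \<le> x" "g y = 0"
      using IVT2[of g x 0 0] x cg q by fastforce
    then have "y \<noteq> 0" using \<open>g 0 = q\<close> q by auto
    then show False using Dpos[of y] g2[of y] y x by simp
  qed
  have g_eq: "g x = sqrt (\<Delta> x)" if "0 \<le> x" "x < R" for x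
    using g2[OF that] gpos[OF that] by (metis less_eq_real_def real_sqrt_unique)
  show False
  proof (cases "\<Delta> R = 0")
    case True
    \<comment> \<open>The series itself need not converge at \<open>R\<close>;
      \<open>sqrt \<Delta>\<close> supplies the limit.\<close>
    have limg: "((\<lambda>y. sqrt (\<Delta> y) + y) \<longlongrightarrow> sqrt (\<Delta> R) + R) (at_left R)"
      by (intro tendsto_intros limD)
    have up: "g x \<le> R - x" if x: "0 < x" "x < R" for x
    proof -
      have "\<forall>\<^sub>F y in at_left R. x < y \<and> y < R"
        using eventually_at_left_real[OF x(2)] by (auto elim: eventually_mono)
      then have "\<forall>\<^sub>F y in at_left R. g x + x \<le> sqrt (\<Delta> y) + y"
      proof eventually_elim
        case (elim y)
        have "f x \<le> f y" unfolding f_def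
          by (intro suminf_le inS mult_left_mono power_mono) (use elim x nonneg in auto)
        moreover have "0 \<le> f x" unfolding f_def
          by (intro suminf_nonneg inS) (use x nonneg in auto)
        moreover have "x\<^sup>2 \<le> y\<^sup>2" using elim x by (intro power_mono) auto
        ultimately have "x\<^sup>2 * f x \<le> y\<^sup>2 * f y" by (intro mult_mono) auto
        then show ?case using g_eq[of y] elim x unfolding g_def by auto
      qed
      then have "g x + x \<le> sqrt (\<Delta> R) + R"
        by (intro tendsto_lowerbound[OF limg]) auto
      then show ?thesis using True by simp
    qed
    \<comment> \<open>\<open>\<Delta>\<close> is bounded below linearly and above quadratically in
      \<open>R - x\<close>; cancelling one factor leaves a contradiction as \<open>x\<close> tends
      to \<open>R\<close>.\<close>
    have key: "m0 * x\<^sup>2 \<le> R * (R - x)" if x: "0 < x" "x < R" for x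
    proof -
      have "m0 * (1 / x - 1 / R) \<le> \<Delta> x / x ^ 3" using mono[OF x] True by simp
      then have "m0 * (1 / x - 1 / R) * x ^ 3 \<le> \<Delta> x" using x by (simp add: pos_le_divide_eq)
      also have "\<Delta> x = (g x)\<^sup>2" using g2 x by simp
      also have "\<dots> \<le> (R - x)\<^sup>2" using up[OF x] gpos[of x] x by (intro power_mono) auto
      finally have "m0 * (1 / x - 1 / R) * x ^ 3 \<le> (R - x)\<^sup>2" .
      moreover have "m0 * (1 / x - 1 / R) * x ^ 3 = m0 * x\<^sup>2 * (R - x) / R"
        using x R0 by (simp add: field_simps power2_eq_square power3_eq_cube)
      ultimately have "m0 * x\<^sup>2 * (R - x) \<le> R * (R - x) * (R - x)"
        using R0 by (simp add: field_simps power2_eq_square)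
      then show ?thesis using x by (simp add: mult_le_cancel_right)
    qed
    have l1: "((\<lambda>x. m0 * x\<^sup>2) \<longlongrightarrow> m0 * R\<^sup>2) (at_left R)"
      and l2: "((\<lambda>x. R * (R - x)) \<longlongrightarrow> R * (R - R)) (at_left R)"
      by (intro tendsto_intros)+
    have "\<forall>\<^sub>F x in at_left R. m0 * x\<^sup>2 \<le> R * (R - x)"
      using evR by eventually_elim (use key in blast)
    then have "m0 * R\<^sup>2 \<le> R * (R - R)"
      by (intro tendsto_le[OF _ l2 l1]) auto
    then show False using m0 R0 by (simp add: mult_le_0_iff)
  next
    case False
    then have DRp: "0 < \<Delta> R" using DR by simp
    define Dc :: "complex \<Rightarrow> complex" where
      "Dc z = (of_real q - z)\<^sup>2 + 4 * z\<^sup>2 * (of_real q - z + of_real (q * U 1) * z)" for z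
    have DcR: "Dc (of_real R) = of_real (\<Delta> R)" by (simp add: Dc_def \<Delta>_def)
    have "isCont (\<lambda>z. Re (Dc z)) (of_real R)" unfolding Dc_def by (intro isCont_Re continuous_intros)
    then have "((\<lambda>z. Re (Dc z)) \<longlongrightarrow> Re (Dc (of_real R))) (nhds (of_real R))"
      unfolding isCont_def by (subst (asm) tendsto_at_iff_tendsto_nhds)
    then have "\<forall>\<^sub>F z in nhds (of_real R). 0 < Re (Dc z)"
      by (rule order_tendstoD(1)) (use DRp DcR in auto)
    then obtain \<delta>0 where \<delta>0: "0 < \<delta>0" "\<And>z. dist z (of_real R) < \<delta>0 \<Longrightarrow> 0 < Re (Dc z)"
      unfolding eventually_nhds_metric by auto
    define \<delta> where "\<delta> = min \<delta>0 R"
    have \<delta>: "0 < \<delta>" "\<delta> \<le> R" "\<And>z. dist z (of_real R) < \<delta> \<Longrightarrow> 0 < Re (Dc z)"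
      using \<delta>0 R0 by (auto simp: \<delta>_def)
    \<comment> \<open>The disc of radius \<open>\<delta> / 2\<close> about \<open>r\<close> stays
      within distance \<open>\<delta>\<close> of \<open>R\<close>, where \<open>Re (Dc z)\<close> is
      positive, and reaches to \<open>R + \<delta> / 4\<close>. The series is extended to
      \<open>r + 3 / 8 * \<delta> = R + \<delta> / 8\<close>. As \<open>\<delta> \<le> R\<close>,
      the disc avoids the zero of the denominator of \<open>F\<close>.\<close>
    define r where "r = R - \<delta> / 4"
    have r: "0 < r" "r < R" using \<delta> by (auto simp: r_def)
    define F where "F z = (csqrt (Dc z) - of_real q + z) / (2 * z\<^sup>2)" for z
    have inb: "dist z (of_real R) < \<delta>" "z \<noteq> 0" if "z \<in> ball (of_real r) (\<delta> / 2)" for z :: complex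
    proof -
      have "dist (of_real r) (of_real R :: complex) = \<delta> / 4"
        using \<delta> by (simp add: dist_of_real dist_real_def r_def)
      then show d: "dist z (of_real R) < \<delta>"
        using that dist_triangle[of z "of_real R" "of_real r"] \<delta>(1) by (simp add: dist_commute)
      show "z \<noteq> 0"
        using d \<delta>(2) R0 by (auto simp: dist_norm)
    qed
    have hol: "F holomorphic_on ball (of_real r) (\<delta> / 2)"
      unfolding F_def
    proof (intro holomorphic_intros)
      show "Dc z \<notin> \<real>\<^sub>\<le>\<^sub>0" if "z \<in> ball (of_real r) (\<delta> / 2)" for z
        using \<delta>(3)[OF inb(1)[OF that]] by (auto simp: complex_nonpos_Reals_iff)
      show "Dc holomorphic_on ball (of_real r) (\<delta> / 2)"
        unfolding Dc_def by (intro holomorphic_intros)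
      show "2 * z\<^sup>2 \<noteq> 0" if "z \<in> ball (of_real r) (\<delta> / 2)" for z :: complex
        using inb(2)[OF that] by simp
    qed
    define fc where "fc z = (\<Sum>n. of_real (U n) * z ^ n)" for z :: complex
    define G where "G z = of_real q - z + 2 * z\<^sup>2 * fc z" for z
    have convc: "summable (\<lambda>n. of_real (U n) * z ^ n)" if "norm z < R" for z :: complex
    proof -
      have "summable (\<lambda>n. norm (of_real (U n) * z ^ n))"
        using inS[of "norm z"] that nonneg by (simp add: norm_mult norm_power)
      then show ?thesis by (rule summable_norm_cancel)
    qed
    have G2: "(G z)\<^sup>2 = Dc z" if "norm z < R" for z
      using tutte_functional_equation[OF U0 nonneg eq, of z] inS[of "norm z"] that
      unfolding G_def fc_def Dc_def by simp
    have Gr: "G (of_real r) = of_real (g r)"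
    proof -
      have "fc (of_real r) = of_real (f r)"
        unfolding fc_def f_def by (subst suminf_of_real) (use inS[of r] r in auto)
      then show ?thesis by (simp add: G_def g_def)
    qed
    obtain y where y: "r < y" "y < R" using r dense by blast
    have "isCont fc (of_real r)" unfolding fc_def
      by (rule isCont_powser[where K = "of_real y"]) (use convc[of "of_real y"] y r in auto)
    then have "isCont (\<lambda>z. Re (G z)) (of_real r)" unfolding G_def by (intro isCont_Re continuous_intros)
    then have "((\<lambda>z. Re (G z)) \<longlongrightarrow> Re (G (of_real r))) (nhds (of_real r))"
      unfolding isCont_def by (subst (asm) tendsto_at_iff_tendsto_nhds)
    then have "\<forall>\<^sub>F z in nhds (of_real r). 0 < Re (G z)"
      by (rule order_tendstoD(1)) (use gpos[of r] r Gr in auto)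
    then obtain \<epsilon>0 where \<epsilon>0: "0 < \<epsilon>0" "\<And>z. dist z (of_real r) < \<epsilon>0 \<Longrightarrow> 0 < Re (G z)"
      unfolding eventually_nhds_metric by auto
    \<comment> \<open>So close to \<open>r\<close> the series converges and \<open>G\<close> has
      positive real part, which identifies it with the principal branch
      \<open>csqrt (Dc z)\<close>.\<close>
    define \<epsilon> where "\<epsilon> = min \<epsilon>0 (\<delta> / 4)"
    have "summable (\<lambda>n. U n * (r + 3 / 8 * \<delta>) ^ n)"
    proof (rule nonneg_powser_extend[OF nonneg r convc hol])
      show "0 < \<epsilon>" using \<epsilon>0 \<delta> by (simp add: \<epsilon>_def)
      fix z :: complex assume z: "dist z (of_real r) < \<epsilon>"
      have nz: "norm z < R"
      proof -
        have "norm z \<le> norm (of_real r :: complex) + dist z (of_real r)"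
          unfolding dist_norm by (metis add.commute diff_add_cancel norm_triangle_ineq)
        moreover have "norm (of_real r :: complex) = r" using r by simp
        moreover have "dist z (of_real r) < \<delta> / 4" using z by (simp add: \<epsilon>_def)
        ultimately show ?thesis unfolding r_def using \<delta>(1) by linarith
      qed
      have "z \<noteq> 0" by (rule inb(2)) (use z \<delta>(1) in \<open>simp add: \<epsilon>_def dist_commute\<close>)
      have "csqrt (Dc z) = G z"
        using csqrt_unique[OF G2[OF nz]] \<epsilon>0(2)[of z] z by (simp add: \<epsilon>_def)
      then show "F z = (\<Sum>n. of_real (U n) * z ^ n)"
        using \<open>z \<noteq> 0\<close> unfolding F_def G_def fc_def by simp
    qed (use \<delta> in auto)
    then show False using notin[of "r + 3 / 8 * \<delta>"] \<delta> by (simp add: r_def)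
  qed
qed

text \<open>
  Iterating the recursion from \<open>0\<close> produces the least solution, which lies below the supersolution.
\<close>

lemma tutte_inequality_bound:
  fixes W :: "nat \<Rightarrow> real"
  assumes W0: "W 0 = 1" and nonneg: "\<And>n. 0 \<le> W n"
    and le: "\<And>l. q * W (Suc (Suc l)) + (\<Sum>i\<le>l. W i * W (l - i)) \<le> W (Suc l)"
    and q: "0 \<le> q"
  shows "q \<le> 1 / 12"
proof (cases "q = 0")
  case False
  then have q0: "0 < q" using q by simp
  define T where "T X l = (case l of 0 \<Rightarrow> 1 | Suc l \<Rightarrow> q * X (Suc (Suc l)) + (\<Sum>i\<le>l. X i * X (l - i)))"
    for X :: "nat \<Rightarrow> real" and l
  define X where "X n = (T ^^ n) (\<lambda>_. 0)" for n
  have X0: "X 0 = (\<lambda>_. 0)" and XS: "X (Suc n) = T (X n)" for n by (simp_all add: X_def)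
  have Tmono: "T A l \<le> T B l" if "\<And>l. 0 \<le> A l" "\<And>l. A l \<le> B l" for A B l
    unfolding T_def using that q
    by (auto split: nat.split intro!: add_mono mult_left_mono sum_mono mult_mono order_trans[OF that])
  have Xpos: "0 \<le> X n l" for n l
    by (induction n arbitrary: l)
       (auto simp: X0 XS T_def q split: nat.split intro!: add_nonneg_nonneg sum_nonneg mult_nonneg_nonneg)
  have Xmono: "X n l \<le> X (Suc n) l" for n l
  proof (induction n arbitrary: l)
    case 0
    show ?case using Xpos[of 1] by (simp add: X0)
  next
    case (Suc n)
    have "T (X n) l \<le> T (X (Suc n)) l" by (rule Tmono[OF Xpos Suc.IH])
    then show ?case by (simp add: XS)
  qed
  have XW: "X n l \<le> W l" for n l
  proof (induction n arbitrary: l)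
    case 0
    show ?case using nonneg by (simp add: X0)
  next
    case (Suc n)
    have "T (X n) l \<le> T W l" by (rule Tmono[OF Xpos Suc.IH])
    also have "T W l \<le> W l" using le W0 by (auto simp: T_def split: nat.split)
    finally show ?case by (simp add: XS)
  qed
  define U where "U l = (SUP n. X n l)" for l
  have lim: "(\<lambda>n. X n l) \<longlonglongrightarrow> U l" for l
    unfolding U_def by (rule LIMSEQ_incseq_SUP) (use XW Xmono in \<open>auto intro!: incseq_SucI bdd_aboveI\<close>)
  have limS: "(\<lambda>n. T (X n) l) \<longlonglongrightarrow> U l" for l
    using LIMSEQ_Suc[OF lim[of l]] by (simp add: XS)
  \<comment> \<open>Each value of \<open>T\<close> is a polynomial in finitely many coordinates, so
    pointwise limits pass through.\<close>
  have limT: "(\<lambda>n. T (X n) (Suc l)) \<longlonglongrightarrow> q * U (Suc (Suc l)) + (\<Sum>i\<le>l. U i * U (l - i))" for l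
    unfolding T_def by (auto intro!: tendsto_intros lim)
  show ?thesis
  proof (rule tutte_recursion_bound[where U = U])
    show "U 0 = 1" using LIMSEQ_unique[OF limS[of 0]] by (simp add: T_def)
    show "0 \<le> U n" for n by (rule LIMSEQ_le_const[OF lim]) (use Xpos in auto)
    show "U (Suc l) = q * U (Suc (Suc l)) + (\<Sum>i\<le>l. U i * U (l - i))" for l
      by (rule LIMSEQ_unique[OF limS limT])
  qed (rule q0)
qed simp

section \<open>Markov families\<close>

lemma reroot_quadrangulation:
  fixes m :: "'d rmap"
  assumes "quadrangulation m" "r \<in> root_face m"
  shows "quadrangulation (m\<lparr>root_dart := r\<rparr>)" "root_face (m\<lparr>root_dart := r\<rparr>) = root_face m"
    "perimeter (m\<lparr>root_dart := r\<rparr>) = perimeter m"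
    "internal_faces (m\<lparr>root_dart := r\<rparr>) = internal_faces m" "r \<in> darts m"
proof -
  let ?m = "m\<lparr>root_dart := r\<rparr>"
  note pl = quadrangulationD(1)[OF assms(1)]
  have rD: "root_dart m \<in> darts m" using planar_mapD(2)[OF pl] .
  show r: "r \<in> darts m" using face_at_subset[OF pl rD] assms(2) by (auto simp: root_face_def)
  have f: "face_at ?m = face_at m" by (rule ext) (simp add: face_at_def)
  have v: "vertex_at ?m = vertex_at m" by (rule ext) (simp add: vertex_at_def)
  show rf: "root_face ?m = root_face m"
    using face_at_eq[OF pl rD, of r] assms(2) by (simp add: root_face_def f)
  then show "perimeter ?m = perimeter m" by (simp add: perimeter_def)
  show int: "internal_faces ?m = internal_faces m"
    by (simp add: internal_faces_def map_faces_def rf f)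
  have "planar_map ?m"
    using pl r unfolding planar_map_def map_connected_def map_vertices_def map_faces_def map_edges_def f v
    by simp
  then show "quadrangulation ?m" using assms(1) int by (simp add: quadrangulation_def)
qed

lemma finite_internal_faces:
  assumes "planar_map m"
  shows "finite (internal_faces m)"
  using planar_mapD(1)[OF assms] by (simp add: internal_faces_def map_faces_def)

lemma root_face_eq_darts:
  assumes "planar_map m" "internal_faces m = {}"
  shows "root_face m = darts m"
proof
  show "root_face m \<subseteq> darts m"
    using face_at_subset[OF assms(1) planar_mapD(2)[OF assms(1)]] by (simp add: root_face_def)
  show "darts m \<subseteq> root_face m"
  proof
    fix d assume d: "d \<in> darts m"
    then have "face_at m d = root_face m" using assms(2) by (auto simp: internal_faces_def map_faces_def)
    then show "d \<in> root_face m" using mem_face_at[OF assms(1) d] by simp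
  qed
qed

text \<open>Otherwise the root face is closed under \<open>opp\<close> and \<open>nxt\<close>, and
  by connectedness it is the whole map.\<close>

lemma exists_outer_dart:
  assumes "planar_map m" "internal_faces m \<noteq> {}"
  shows "\<exists>r\<in>root_face m. opp m r \<notin> root_face m"
proof (rule ccontr)
  assume "\<not> ?thesis"
  then have o: "opp m ` root_face m \<subseteq> root_face m" by auto
  have rD: "root_dart m \<in> darts m" using planar_mapD(2)[OF assms(1)] .
  have sub: "root_face m \<subseteq> darts m" using face_at_subset[OF assms(1) rD] by (simp add: root_face_def)
  have n: "nxt m ` root_face m \<subseteq> root_face m"
    using nxt_mem_face_iff[OF assms(1) _ rD] sub unfolding root_face_def by blast
  have ne: "root_face m \<noteq> {}" using mem_face_at[OF assms(1) rD] by (auto simp: root_face_def)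
  have "opp m ` darts m \<subseteq> darts m" "nxt m ` darts m \<subseteq> darts m"
    using planar_mapD(3,8)[OF assms(1)] by auto
  then have eq: "root_face m = darts m"
    using map_connected_iff[of m] planar_mapD(7)[OF assms(1)] sub ne o n by blast
  have "face_at m d = root_face m" if "d \<in> darts m" for d
    using face_at_eq[OF assms(1) rD, of d] that eq by (simp add: root_face_def)
  then show False using assms(2) by (auto simp: internal_faces_def map_faces_def)
qed

text \<open>If every vertex had two darts, there would be at most as many vertices as edges, while
  Euler's relation with a single face gives one more. A fixed point of the rotation is the reverse
  of a dart pointing to a leaf.\<close>

lemma exists_leaf:
  assumes "planar_map m" "internal_faces m = {}"
  shows "\<exists>r\<in>darts m. nxt m r = opp m r"
proof (rule ccontr)
  assume no: "\<not> ?thesis"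
  let ?s = "nxt m \<circ> opp m"
  note pm = planar_mapD[OF assms(1)]
  note b = rotation_bij[OF assms(1)]
  have self: "d \<in> vertex_at m d" if "d \<in> darts m" for d
    unfolding vertex_at_def by (rule mem_orbit_self[OF pm(1) b that])
  have sub: "vertex_at m d \<subseteq> darts m" if "d \<in> darts m" for d
    unfolding vertex_at_def by (rule orbit_subset_carrier[OF _ that]) (use b in \<open>auto simp: bij_betw_def\<close>)
  have eq: "vertex_at m e = vertex_at m d" if "d \<in> darts m" "e \<in> vertex_at m d" for d e
    using orbit_eq_of_mem[OF pm(1) b] that unfolding vertex_at_def by blast
  have two: "2 \<le> card v" if v: "v \<in> map_vertices m" for v
  proof -
    obtain d where d: "d \<in> darts m" "v = vertex_at m d" using v by (auto simp: map_vertices_def)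
    have "opp m d \<in> darts m" "opp m (opp m d) = d" using pm(3,5) d(1) by auto
    then have "?s d \<noteq> d" using no by auto
    moreover have "?s d \<in> v" unfolding d(2) vertex_at_def by (rule orbit.base)
    moreover have "d \<in> v" using self d by simp
    moreover have "finite v" using sub[OF d(1)] pm(1) d(2) finite_subset by blast
    ultimately have "card {d, ?s d} \<le> card v" by (intro card_mono) auto
    then show ?thesis using \<open>?s d \<noteq> d\<close> by simp
  qed
  have "pairwise disjnt (map_vertices m)"
  proof (rule pairwiseI)
    fix v w assume vw: "v \<in> map_vertices m" "w \<in> map_vertices m" "v \<noteq> w"
    obtain d e where de: "d \<in> darts m" "v = vertex_at m d" "e \<in> darts m" "w = vertex_at m e"
      using vw by (auto simp: map_vertices_def)
    show "disjnt v w"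
    proof (rule ccontr)
      assume "\<not> disjnt v w"
      then obtain x where "x \<in> v" "x \<in> w" by (auto simp: disjnt_def)
      then show False using eq[OF de(1), of x] eq[OF de(3), of x] de vw(3) by simp
    qed
  qed
  moreover have "\<Union> (map_vertices m) = darts m"
    using self sub unfolding map_vertices_def by blast
  moreover have "finite v" if "v \<in> map_vertices m" for v
    using two[OF that] by (intro card_ge_0_finite) linarith
  ultimately have "card (darts m) = (\<Sum>v\<in>map_vertices m. card v)"
    using card_Union_disjoint[of "map_vertices m"] by simp
  moreover have "(\<Sum>v\<in>map_vertices m. 2) \<le> (\<Sum>v\<in>map_vertices m. card v)"
    by (rule sum_mono) (rule two)
  ultimately have a: "2 * card (map_vertices m) \<le> card (darts m)" by simp
  have "card (darts m) = 2 * card (map_edges m)"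
    by (rule card_map_edges[OF pm(1)]) (use pm(3,4,5) in auto)
  moreover have "map_faces m = {root_face m}"
  proof -
    have "root_face m \<in> map_faces m" using pm(2) by (auto simp: map_faces_def root_face_def)
    then show ?thesis using assms(2) by (auto simp: internal_faces_def)
  qed
  ultimately show False using a pm(10) by simp
qed

lemma single_edge:
  assumes m: "planar_map m" "internal_faces m = {}" "perimeter m = 2"
  obtains s where "darts m = {root_dart m, s}" "root_dart m \<noteq> s" "opp m (root_dart m) = s"
    "opp m s = root_dart m" "nxt m (root_dart m) = s" "nxt m s = root_dart m"
proof -
  note pm = planar_mapD[OF m(1)]
  let ?r = "root_dart m" and ?s = "opp m (root_dart m)"
  have s: "?s \<in> darts m" "?s \<noteq> ?r" using pm(2,3,4) by auto
  have "card (darts m) = 2"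
    using m(3) root_face_eq_darts[OF m(1,2)] by (simp add: perimeter_def)
  moreover have "card {?r, ?s} = 2" using s by simp
  ultimately have D: "{?r, ?s} = darts m"
    using card_subset_eq[OF pm(1), of "{?r, ?s}"] s(1) pm(2) by simp
  have c: "card (face_at m ?r) = 2" using m(3) by (simp add: perimeter_def root_face_def)
  have "nxt m ?r \<noteq> ?r" using face_period(1)[OF m(1) pm(2), of 1] c by auto
  moreover have "nxt m ?r \<in> {?r, ?s}" using pm(8)[OF pm(2)] D by blast
  ultimately have n: "nxt m ?r = ?s" by blast
  then have "nxt m ?s \<noteq> ?s" using pm(9)[OF pm(2) s(1)] s(2) by auto
  moreover have "nxt m ?s \<in> {?r, ?s}" using pm(8)[OF s(1)] D by blast
  ultimately have "nxt m ?s = ?r" by blast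
  then show thesis using that[OF D[symmetric] s(2)[symmetric] refl pm(5)[OF pm(2)] n] by simp
qed

text \<open>Base case of \<open>pmf_tree\<close>, where the darts and both permutations are
  forced.\<close>

lemma single_edge_iso:
  assumes "planar_map m" "internal_faces m = {}" "perimeter m = 2"
    and "planar_map m'" "internal_faces m' = {}" "perimeter m' = 2"
  shows "rmap_iso m m'"
proof -
  obtain s where A: "darts m = {root_dart m, s}" "root_dart m \<noteq> s" "opp m (root_dart m) = s"
    "opp m s = root_dart m" "nxt m (root_dart m) = s" "nxt m s = root_dart m"
    by (rule single_edge[OF assms(1-3)])
  obtain s' where B: "darts m' = {root_dart m', s'}" "root_dart m' \<noteq> s'" "opp m' (root_dart m') = s'"
    "opp m' s' = root_dart m'" "nxt m' (root_dart m') = s'" "nxt m' s' = root_dart m'"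
    by (rule single_edge[OF assms(4-6)])
  define f where "f d = (if d = root_dart m then root_dart m' else s')" for d
  have f: "f (root_dart m) = root_dart m'" "f s = s'" using A(2) by (auto simp: f_def)
  have "bij_betw f (darts m) (darts m')"
    unfolding A(1) B(1) using A(2) B(2) f by (auto simp: bij_betw_def inj_on_def)
  moreover have "f (opp m d) = opp m' (f d) \<and> f (nxt m d) = nxt m' (f d)" if d: "d \<in> darts m" for d
  proof -
    have "d = root_dart m \<or> d = s" using d A(1) by blast
    then show ?thesis
      by (elim disjE) (simp_all only: A(3-6) B(3-6) f simp_thms)
  qed
  ultimately show ?thesis unfolding rmap_iso_def using f(1) by blast
qed

section \<open>Masses in a family with the Markov property\<close>

locale markov_family =
  fixes P :: "nat \<Rightarrow> map_class pmf"
  assumes supp: "\<And>l. l \<ge> 1 \<Longrightarrow> set_pmf (P l) \<subseteq> quadrangulations l"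
    and markov: "markov_property P"
    and reroot: "reroot_invariant P"
begin

text \<open>An event that misses the support makes both sides 0, so the conditioning can be undone
  without assuming positive probability.\<close>

lemma pmf_glue:
  assumes "1 \<le> l" "quad_with_holes q" "u \<in> fillings q"
  shows "pmf (P l) (iso_class (glue q u)) = measure_pmf.prob (P l) (maps_containing q) *
    (\<Prod>h\<in>marks q. pmf (P (hole_per q h div 2)) (iso_class (u h)))"
proof -
  let ?C = "maps_containing q" and ?x = "iso_class (glue q u)"
  have x: "?x \<in> ?C" using assms(3) by (auto simp: maps_containing_def)
  show ?thesis
  proof (cases "set_pmf (P l) \<inter> ?C = {}")
    case True
    then have "pmf (P l) ?x = 0" using x by (auto simp: pmf_eq_0_set_pmf)
    moreover have "measure_pmf.prob (P l) ?C = 0" using True by (simp add: measure_pmf_zero_iff)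
    ultimately show ?thesis by simp
  next
    case False
    have "pmf (cond_pmf (P l) ?C) ?x = (\<Prod>h\<in>marks q. pmf (P (hole_per q h div 2)) (iso_class (u h)))"
      using markov assms False unfolding markov_property_def by blast
    moreover have "pmf (cond_pmf (P l) ?C) ?x = pmf (P l) ?x / measure_pmf.prob (P l) ?C"
      using pmf_cond[OF False] x by simp
    moreover have "measure_pmf.prob (P l) ?C \<noteq> 0" using False by (simp add: measure_pmf_zero_iff)
    ultimately show ?thesis by (simp add: field_simps)
  qed
qed

lemma pmf_reroot:
  fixes m :: "nat rmap"
  assumes "1 \<le> l" "quadrangulation m" "perimeter m = 2 * l" "r \<in> root_face m"
  shows "pmf (P l) (iso_class (m\<lparr>root_dart := r\<rparr>)) = pmf (P l) (iso_class m)"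
  using reroot assms reroot_quadrangulation[OF assms(2,4)] unfolding reroot_invariant_def by metis

text \<open>The probability that the far side of the root edge belongs to a square;
  \<open>bridge_prob i j\<close> below is that of a root bridge with semi-perimeter \<open>i\<close>
  at its head and \<open>j\<close> at its tail.\<close>

definition "quad_prob l = measure_pmf.prob (P l) (maps_containing (quad_hole (2 * l + 2)))"

definition "bridge_prob i j = measure_pmf.prob (P (i + j + 1)) (maps_containing (bridge_hole i j))"

text \<open>The value at 0 stands for an absent hole, which contributes no factor to a gluing. For
  positive \<open>l\<close> the star serves as the reference tree; \<open>pmf_tree\<close> shows
  that the choice does not matter.\<close>

definition "tree_mass l = (if l = 0 then 1 else pmf (P l) (iso_class (double_star 0 (l - 1))))"

lemma pmf_delete_quad:
  fixes m :: "nat rmap"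
  assumes m: "quadrangulation m" "perimeter m = 2 * l" "1 \<le> l" "opp m (root_dart m) \<notin> root_face m"
  shows "pmf (P l) (iso_class m) = quad_prob l * pmf (P (Suc l)) (iso_class (del_root m))"
proof -
  let ?q = "quad_hole (2 * l + 2)"
  note d = delete_quad[OF m]
  have n: "4 \<le> 2 * l + 2" using m(3) by simp
  note Q = quad_hole[OF n] and S = quad_hole_simps[of "2 * l + 2"]
  have hp: "hole_per ?q (2 * l + 2) = 2 * l + 2" by (rule Q(3))
  have mk: "marks ?q = {2 * l + 2}" by (rule S(5))
  have "(\<lambda>_. del_root m) \<in> fillings ?q"
    using quadrangulationD(1)[OF d(1)] d(2) hp unfolding fillings_def mk by simp
  from pmf_glue[OF m(3) Q(1) this] show ?thesis
    unfolding d(4) mk quad_prob_def using hp by simp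
qed

lemma pmf_delete_leaf:
  fixes m :: "nat rmap"
  assumes m: "quadrangulation m" "perimeter m = 2 * l" "2 \<le> l" "nxt m (root_dart m) = opp m (root_dart m)"
  shows "pmf (P l) (iso_class m) = bridge_prob 0 (l - 1) * pmf (P (l - 1)) (iso_class (del_root m))"
proof -
  let ?q = "bridge_hole 0 (l - 1)"
  note d = delete_leaf[OF m]
  have N: "2 * l = 2 * 0 + 2 * (l - 1) + 2" using m(3) by simp
  have p: "(1::nat) = 2 * 0 + 1" by simp
  have mk: "marks ?q = {2 * l + 1 + 1}" using bridge_hole_simps(5)[OF N p refl] m(3) by simp
  have hp: "hole_per ?q (2 * l + 1 + 1) = 2 * (l - 1)"
    using bridge_hole_per(2)[OF N p refl] m(3) by simp
  have "(\<lambda>_. del_root m) \<in> fillings ?q"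
    using quadrangulationD(1)[OF d(1)] d(2) hp unfolding fillings_def mk by simp
  moreover have "1 \<le> l" "l = 0 + (l - 1) + 1" using m(3) by auto
  ultimately show ?thesis
    using pmf_glue[OF _ bridge_hole_holes[OF N p refl], of l "\<lambda>_. del_root m"]
    unfolding d(4) mk bridge_prob_def using hp by simp
qed

lemma pmf_bridge_stars:
  "pmf (P (i + j + 1)) (iso_class (double_star i j)) = bridge_prob i j * (tree_mass i * tree_mass j)"
proof -
  define N p where "N = 2 * i + 2 * j + 2" and "p = 2 * i + 1"
  let ?q = "bridge_hole i j"
  define u where "u h = (if h = N + 1 then double_star 0 (i - 1) else double_star 0 (j - 1))" for h
  note G = glue_bridge_stars[OF N_def p_def, folded u_def]
  note hp = bridge_hole_per[OF N_def p_def refl] and mk = bridge_hole_simps(5)[OF N_def p_def refl]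
  have ne: "N + 1 \<noteq> N + p + 1" by (simp add: p_def)
  have "(\<Prod>h\<in>marks ?q. pmf (P (hole_per ?q h div 2)) (iso_class (u h))) = tree_mass i * tree_mass j"
    unfolding mk using hp ne by (cases "i = 0"; cases "j = 0") (simp_all add: u_def tree_mass_def)
  then show ?thesis
    using pmf_glue[OF _ bridge_hole_holes[OF N_def p_def refl] G(2), of "i + j + 1"]
    unfolding G(1) bridge_prob_def by simp
qed

text \<open>All darts of a tree lie on its root face, so it may be rerooted at a leaf. The factor
  lost with the leaf depends only on \<open>l\<close>, and the reference star loses the same
  one.\<close>

lemma pmf_tree:
  fixes m :: "nat rmap"
  assumes "1 \<le> l" "quadrangulation m" "perimeter m = 2 * l" "internal_faces m = {}"
  shows "pmf (P l) (iso_class m) = tree_mass l"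
  using assms
proof (induction l arbitrary: m rule: less_induct)
  case (less l)
  have tree: "pmf (P l) (iso_class t) = bridge_prob 0 (l - 1) * tree_mass (l - 1)"
    if l: "2 \<le> l" and t: "quadrangulation t" "perimeter t = 2 * l" "internal_faces t = {}" for t :: "nat rmap"
  proof -
    note pl = quadrangulationD(1)[OF t(1)]
    obtain r where r: "r \<in> darts t" "nxt t r = opp t r" using exists_leaf[OF pl t(3)] by blast
    then have rf: "r \<in> root_face t" using root_face_eq_darts[OF pl t(3)] by simp
    let ?t = "t\<lparr>root_dart := r\<rparr>"
    note R = reroot_quadrangulation[OF t(1) rf]
    have p: "perimeter ?t = 2 * l" using R(3) t(2) by simp
    have lf: "nxt ?t (root_dart ?t) = opp ?t (root_dart ?t)" using r(2) by simp
    note D = delete_leaf[OF R(1) p l lf]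
    have "card (internal_faces (del_root ?t)) = 0" using D(3) R(4) t(3) by simp
    then have "internal_faces (del_root ?t) = {}"
      using finite_internal_faces[OF quadrangulationD(1)[OF D(1)]] by simp
    then have "pmf (P (l - 1)) (iso_class (del_root ?t)) = tree_mass (l - 1)"
      using less.IH[of "l - 1" "del_root ?t"] l D(1,2) by simp
    then show ?thesis
      using pmf_delete_leaf[OF R(1) p l lf] pmf_reroot[OF _ t(1,2) rf] l by simp
  qed
  let ?s = "double_star 0 (l - 1)"
  note S = double_star[of 0 "l - 1"]
  have ps: "perimeter ?s = 2 * l" using S(5) less.prems(1) by simp
  show ?case
  proof (cases "2 \<le> l")
    case True
    then show ?thesis using tree[OF True less.prems(2-4)] tree[OF True S(3) ps S(4)] by (simp add: tree_mass_def)
  next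
    case False
    then have l: "l = 1" using less.prems(1) by simp
    note pl = quadrangulationD(1)[OF less.prems(2)]
    have "rmap_iso m ?s"
      using single_edge_iso[OF pl less.prems(4) _ S(1,4)] less.prems(3) ps l by simp
    then have "iso_class m = iso_class ?s"
      using iso_class_eqI wf_planar[OF pl] planar_mapD(2)[OF pl] by blast
    then show ?thesis using l by (simp add: tree_mass_def)
  qed
qed

text \<open>Each square removed raises the semi-perimeter by one, so \<open>n\<close> removals end
  at a tree with \<open>l + n\<close> edges.\<close>

lemma pmf_map:
  fixes m :: "nat rmap"
  assumes "1 \<le> l" "quadrangulation m" "perimeter m = 2 * l" "card (internal_faces m) = n"
  shows "pmf (P l) (iso_class m) = (\<Prod>i<n. quad_prob (l + i)) * tree_mass (l + n)"
  using assms
proof (induction n arbitrary: l m)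
  case 0
  have "internal_faces m = {}"
    using 0 finite_internal_faces[OF quadrangulationD(1)[OF 0(2)]] by simp
  then show ?case using pmf_tree 0 by simp
next
  case (Suc n)
  note pl = quadrangulationD(1)[OF Suc.prems(2)]
  have "internal_faces m \<noteq> {}" using Suc.prems(4) by auto
  then obtain r where r: "r \<in> root_face m" "opp m r \<notin> root_face m"
    using exists_outer_dart[OF pl] by blast
  let ?m = "m\<lparr>root_dart := r\<rparr>"
  note R = reroot_quadrangulation[OF Suc.prems(2) r(1)]
  have p: "perimeter ?m = 2 * l" using R(3) Suc.prems(3) by simp
  have o: "opp ?m (root_dart ?m) \<notin> root_face ?m" unfolding R(2) using r(2) by simp
  note D = delete_quad[OF R(1) p Suc.prems(1) o]
  have cd: "card (internal_faces (del_root ?m)) = n" using D(3) R(4) Suc.prems(4) by simp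
  have "pmf (P (Suc l)) (iso_class (del_root ?m)) = (\<Prod>i<n. quad_prob (Suc l + i)) * tree_mass (Suc l + n)"
    by (rule Suc.IH) (use D(1,2) cd in simp_all)
  then have "pmf (P l) (iso_class m) = quad_prob l * ((\<Prod>i<n. quad_prob (l + Suc i)) * tree_mass (l + Suc n))"
    using pmf_delete_quad[OF R(1) p Suc.prems(1) o] pmf_reroot[OF Suc.prems(1-3) r(1)] by simp
  then show ?case unfolding prod.lessThan_Suc_shift by (simp add: mult.assoc)
qed

lemma tree_mass_step:
  assumes "2 \<le> l"
  shows "tree_mass l = bridge_prob 0 (l - 1) * tree_mass (l - 1)"
  using pmf_bridge_stars[of 0 "l - 1"] assms by (simp add: tree_mass_def)

text \<open>Some map has positive mass, hence so has the tree it is reduced to, which may have more edges.\<close>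

lemma tree_mass_pos: "0 < tree_mass l"
proof (cases "l = 0")
  case False
  then have l: "1 \<le> l" by simp
  have nonneg: "0 \<le> tree_mass l" for l by (simp add: tree_mass_def)
  obtain x where x: "x \<in> set_pmf (P l)" using set_pmf_not_empty[of "P l"] by blast
  then obtain m :: "nat rmap" where m: "x = iso_class m" "quadrangulation m" "perimeter m = 2 * l"
    using supp[OF l] unfolding quadrangulations_def by blast
  define n where "n = card (internal_faces m)"
  have "pmf (P l) x \<noteq> 0" using x by (simp add: set_pmf_iff)
  then have "tree_mass (l + n) \<noteq> 0" using pmf_map[OF l m(2,3) n_def[symmetric]] m(1) by auto
  \<comment> \<open>By \<open>tree_mass_step\<close> a vanishing mass would persist for all larger
    trees.\<close>
  then have "tree_mass l \<noteq> 0"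
  proof (induction n)
    case (Suc n)
    then show ?case using tree_mass_step[of "l + Suc n"] l by auto
  qed simp
  then show ?thesis using nonneg[of l] by simp
qed (simp add: tree_mass_def)

text \<open>Chosen so that \<open>quad_prob_step\<close> holds at \<open>l = 1\<close>.\<close>

definition "weight = quad_prob 1 * tree_mass 2 / tree_mass 1"

text \<open>The folded square can be reduced at its root or, after rerooting, at one of its leaves.\<close>

lemma quad_prob_step:
  assumes "1 \<le> l"
  shows "quad_prob l * tree_mass (Suc l) = weight * tree_mass l"
  using assms
proof (induction l rule: nat_induct_at_least)
  case base
  then show ?case using tree_mass_pos[of 1] by (simp add: weight_def numeral_2_eq_2)
next
  case (Suc l)
  let ?m = "folded_square (Suc l)"
  have l: "1 \<le> Suc l" "2 \<le> Suc l" using Suc.hyps by auto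
  note F = folded_square[OF l(1)] and S = folded_square_simps[of "Suc l"]
  \<comment> \<open>Dart 2 points to a leaf: its successor 3 is also its opposite.\<close>
  have r: "2 \<in> root_face ?m" unfolding F(2) using l by simp
  let ?m' = "?m\<lparr>root_dart := 2\<rparr>"
  note R = reroot_quadrangulation[OF F(1) r]
  have p: "perimeter ?m' = 2 * Suc l" unfolding R(3) by (rule F(4))
  have lf: "nxt ?m' (root_dart ?m') = opp ?m' (root_dart ?m')"
    using l Suc.hyps by (simp add: S)
  note D = delete_leaf[OF R(1) p l(2) lf]
  have l1: "1 \<le> Suc l - 1" using Suc.hyps by simp
  have cd: "card (internal_faces (del_root ?m')) = 1" unfolding D(3) R(4) by (rule F(3))
  have "pmf (P (Suc l)) (iso_class ?m) = quad_prob (Suc l) * tree_mass (Suc (Suc l))"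
    using pmf_map[OF l(1) F(1,4,3)] by simp
  moreover have "pmf (P (Suc l)) (iso_class ?m) = bridge_prob 0 l * pmf (P l) (iso_class (del_root ?m'))"
    using pmf_delete_leaf[OF R(1) p l(2) lf] pmf_reroot[OF l(1) F(1,4) r] by simp
  moreover have "pmf (P l) (iso_class (del_root ?m')) = quad_prob l * tree_mass (Suc l)"
    using pmf_map[OF l1 D(1,2) cd] by simp
  ultimately have "quad_prob (Suc l) * tree_mass (Suc (Suc l)) = bridge_prob 0 l * (weight * tree_mass l)"
    using Suc.IH by simp
  also have "\<dots> = weight * tree_mass (Suc l)" using tree_mass_step[OF l(2)] by simp
  finally show ?case .
qed

text \<open>The product in \<open>pmf_map\<close> telescopes: each factor trades
  \<open>tree_mass (Suc (l + i))\<close> for \<open>weight * tree_mass (l + i)\<close>.\<close>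

lemma pmf_map_weight:
  fixes m :: "nat rmap"
  assumes "1 \<le> l" "quadrangulation m" "perimeter m = 2 * l"
  shows "pmf (P l) (iso_class m) = tree_mass l * weight ^ card (internal_faces m)"
proof -
  have "(\<Prod>i<n. quad_prob (l + i)) * tree_mass (l + n) = tree_mass l * weight ^ n" for n
  proof (induction n)
    case (Suc n)
    have "(\<Prod>i<Suc n. quad_prob (l + i)) * tree_mass (l + Suc n) = (\<Prod>i<n. quad_prob (l + i)) * (quad_prob (l + n) * tree_mass (Suc (l + n)))"
      by simp
    also have "quad_prob (l + n) * tree_mass (Suc (l + n)) = weight * tree_mass (l + n)" by (rule quad_prob_step) (use assms(1) in simp)
    also have "(\<Prod>i<n. quad_prob (l + i)) * (weight * tree_mass (l + n)) = weight * ((\<Prod>i<n. quad_prob (l + i)) * tree_mass (l + n))"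
      by (rule mult.left_commute)
    also have "\<dots> = tree_mass l * weight ^ Suc n" unfolding Suc.IH by simp
    finally show ?case .
  qed simp
  then show ?thesis using pmf_map[OF assms refl] by simp
qed

lemma weight_nonneg: "0 \<le> weight"
  using tree_mass_pos[of 1] tree_mass_pos[of 2] by (simp add: weight_def quad_prob_def)

text \<open>The double star is a tree, and it is also a bridge with stars in its holes; the two
  expressions for its mass give the ratio.\<close>

lemma bridge_prob_eq: "bridge_prob i j = tree_mass (i + j + 1) / (tree_mass i * tree_mass j)"
proof -
  note S = double_star[of i j]
  have "pmf (P (i + j + 1)) (iso_class (double_star i j)) = tree_mass (i + j + 1)"
    by (rule pmf_tree[OF _ S(3) _ S(4)]) (use S(5) in simp_all)
  then have "tree_mass (i + j + 1) = bridge_prob i j * (tree_mass i * tree_mass j)" using pmf_bridge_stars by simp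
  then show ?thesis using tree_mass_pos[of i] tree_mass_pos[of j] by (simp add: field_simps)
qed

text \<open>Both glued maps are isomorphic to one representative of \<open>x\<close> and share its
  root position. Used contrapositively, to show that events are disjoint.\<close>

lemma root_position_eq:
  assumes l: "1 \<le> l" "x \<in> set_pmf (P l)"
    and q: "quad_with_holes q" "opp q (root_dart q) \<notin> hole_darts q" "x \<in> maps_containing q"
    and q': "quad_with_holes q'" "opp q' (root_dart q') \<notin> hole_darts q'" "x \<in> maps_containing q'"
  shows "(nxt q ^^ k) (root_dart q) = opp q (root_dart q) \<longleftrightarrow>
    (nxt q' ^^ k) (root_dart q') = opp q' (root_dart q')"
proof -
  obtain m :: "nat rmap" where m: "x = iso_class m"
    using supp[OF l(1)] l(2) unfolding quadrangulations_def by blast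
  have "(nxt m ^^ k) (root_dart m) = opp m (root_dart m) \<longleftrightarrow> (nxt p ^^ k) (root_dart p) = opp p (root_dart p)"
    if p: "quad_with_holes p" "opp p (root_dart p) \<notin> hole_darts p" "x \<in> maps_containing p" for p
  proof -
    obtain u :: "nat \<Rightarrow> nat rmap" where "x = iso_class (glue p u)"
      using p(3) by (auto simp: maps_containing_def)
    then have "rmap_iso (glue p u) m" using m by (intro iso_class_eqD) simp
    then show ?thesis by (rule glue_root_position[OF p(1,2)])
  qed
  then show ?thesis using q q' by blast
qed

text \<open>The opposite of the root dart is off the root face in the first event and at place
  \<open>2 * i + 1\<close> in the others. So the events are disjoint, and their probabilities sum to
  at most 1.\<close>

lemma tutte_inequality: "quad_prob (Suc k) + (\<Sum>i\<le>k. bridge_prob i (k - i)) \<le> 1"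
proof -
  let ?l = "Suc k"
  let ?QA = "quad_hole (2 * ?l + 2)" and ?QB = "\<lambda>i. bridge_hole i (k - i)"
  \<comment> \<open>\<open>root_position_eq\<close> takes a representative from the support; the
    intersection does not change the probabilities.\<close>
  define SA where "SA = maps_containing ?QA \<inter> set_pmf (P ?l)"
  define SB where "SB i = maps_containing (?QB i) \<inter> set_pmf (P ?l)" for i
  have n: "4 \<le> 2 * ?l + 2" by simp
  note Q = quad_hole[OF n] and QS = quad_hole_simps[of "2 * ?l + 2"]
  have posA: "\<not> (nxt ?QA ^^ j) (root_dart ?QA)
      = opp ?QA (root_dart ?QA)" for j
    using Q(4)[of j] unfolding QS(2,4) by simp
  have outA: "opp ?QA (root_dart ?QA) \<notin> hole_darts ?QA"
    unfolding Q(2) QS(2,4) by simp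
  have BQ: "quad_with_holes (?QB i)"
    "opp (?QB i) (root_dart (?QB i)) \<notin> hole_darts (?QB i)"
    "(nxt (?QB i) ^^ j) (root_dart (?QB i))
      = opp (?QB i) (root_dart (?QB i)) \<longleftrightarrow> j mod (2 * ?l) = 2 * i + 1"
    if i: "i \<le> k" for i j
  proof -
    have N: "2 * ?l = 2 * i + 2 * (k - i) + 2" using i by simp
    note H = bridge_hole_holes[OF N refl refl] bridge_hole_simps[OF N refl refl]
      bridge_hole_darts[OF N refl refl] bridge_hole_root_position[OF N refl refl]
    show "quad_with_holes (?QB i)" by (rule H(1))
    have o: "opp (?QB i) (root_dart (?QB i)) = 2 * i + 1"
      by (simp add: H(3,5))
    show "opp (?QB i) (root_dart (?QB i)) \<notin> hole_darts (?QB i)"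
      unfolding o H(7) using i by simp
    show "(nxt (?QB i) ^^ j) (root_dart (?QB i))
      = opp (?QB i) (root_dart (?QB i)) \<longleftrightarrow> j mod (2 * ?l) = 2 * i + 1"
      unfolding o unfolding H(5) by (rule H(8))
  qed
  have lt: "(2 * i + 1) mod (2 * ?l) = 2 * i + 1" if "i \<le> k" for i using that by simp
  have AB: "SA \<inter> SB i = {}" if i: "i \<le> k" for i
  proof (rule ccontr)
    assume "SA \<inter> SB i \<noteq> {}"
    then obtain x where x: "x \<in> set_pmf (P ?l)" "x \<in> maps_containing ?QA"
      "x \<in> maps_containing (?QB i)" by (auto simp: SA_def SB_def)
    show False
      using root_position_eq[OF _ x(1) Q(1) outA x(2) BQ(1,2)[OF i] x(3), of "2 * i + 1"]
        posA[of "2 * i + 1"] BQ(3)[OF i, of "2 * i + 1"] lt[OF i] by simp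
  qed
  have BB: "SB i \<inter> SB j = {}" if ij: "i \<le> k" "j \<le> k" "i \<noteq> j" for i j
  proof (rule ccontr)
    assume "SB i \<inter> SB j \<noteq> {}"
    then obtain x where x: "x \<in> set_pmf (P ?l)" "x \<in> maps_containing (?QB i)"
      "x \<in> maps_containing (?QB j)" by (auto simp: SB_def)
    have "(2 * i + 1) mod (2 * ?l) = 2 * j + 1"
      using root_position_eq[OF _ x(1) BQ(1,2)[OF ij(1)] x(2) BQ(1,2)[OF ij(2)] x(3), of "2 * i + 1"]
      unfolding BQ(3)[OF ij(1)] BQ(3)[OF ij(2)] lt[OF ij(1)] by simp
    then show False using lt[OF ij(1)] ij(3) by simp
  qed
  have pA: "quad_prob ?l = measure_pmf.prob (P ?l) SA"
    unfolding quad_prob_def SA_def by (rule measure_Int_set_pmf[symmetric])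
  have pB: "bridge_prob i (k - i) = measure_pmf.prob (P ?l) (SB i)" if "i \<le> k" for i
  proof -
    have "i + (k - i) + 1 = ?l" using that by simp
    then show ?thesis unfolding bridge_prob_def SB_def by (simp add: measure_Int_set_pmf)
  qed
  have "(\<Sum>i\<le>k. bridge_prob i (k - i)) = (\<Sum>i\<le>k. measure_pmf.prob (P ?l) (SB i))"
    by (rule sum.cong) (use pB in auto)
  also have "\<dots> = measure_pmf.prob (P ?l) (\<Union>i\<le>k. SB i)"
    by (rule measure_pmf.finite_measure_finite_Union[symmetric])
       (use BB in \<open>auto simp: disjoint_family_on_def\<close>)
  finally have "quad_prob ?l + (\<Sum>i\<le>k. bridge_prob i (k - i)) = measure_pmf.prob (P ?l) (SA \<union> (\<Union>i\<le>k. SB i))"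
    unfolding pA using AB by (subst measure_pmf.finite_measure_Union) auto
  then show ?thesis by simp
qed

text \<open>The probabilities in \<open>tutte_inequality\<close> are ratios of tree masses with the
  common factor \<open>tree_mass (Suc k)\<close>, which is divided out.\<close>

lemma weight_tutte:
  "weight * (1 / tree_mass (Suc (Suc k))) + (\<Sum>i\<le>k. 1 / tree_mass i * (1 / tree_mass (k - i))) \<le> 1 / tree_mass (Suc k)"
proof -
  have "quad_prob (Suc k) = weight * tree_mass (Suc k) / tree_mass (Suc (Suc k))"
    using quad_prob_step[of "Suc k"] tree_mass_pos[of "Suc (Suc k)"] by (simp add: field_simps)
  moreover have "bridge_prob i (k - i) = tree_mass (Suc k) * (1 / tree_mass i * (1 / tree_mass (k - i)))" if "i \<le> k" for i
    using bridge_prob_eq[of i "k - i"] that by simp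
  ultimately have "weight * tree_mass (Suc k) / tree_mass (Suc (Suc k)) + (\<Sum>i\<le>k. tree_mass (Suc k) * (1 / tree_mass i * (1 / tree_mass (k - i)))) \<le> 1"
    using tutte_inequality[of k] by simp
  then have "tree_mass (Suc k) * (weight * (1 / tree_mass (Suc (Suc k))) + (\<Sum>i\<le>k. 1 / tree_mass i * (1 / tree_mass (k - i)))) \<le> 1"
    unfolding sum_distrib_left[symmetric] by (simp add: algebra_simps)
  then show ?thesis using tree_mass_pos[of "Suc k"] by (simp add: field_simps)
qed

end

theorem theorem1p2:
  fixes P :: "nat \<Rightarrow> map_class pmf"
  assumes supp: "\<And>l. l \<ge> 1 \<Longrightarrow> set_pmf (P l) \<subseteq> quadrangulations l"
    and markov: "markov_property P"
    and reroot: "reroot_invariant P"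
  shows "\<exists>q::real. 0 \<le> q \<and> q \<le> 1 / 12 \<and> (\<forall>l\<ge>1. boltzmann q l (P l))"
proof -
  interpret markov_family P
    using assms by unfold_locales auto
  have "weight \<le> 1 / 12"
  proof (rule tutte_inequality_bound[where W = "\<lambda>l. 1 / tree_mass l"])
    show "1 / tree_mass 0 = 1" by (simp add: tree_mass_def)
    show "0 \<le> 1 / tree_mass l" for l using tree_mass_pos[of l] by simp
  qed (use weight_tutte weight_nonneg in auto)
  moreover have "boltzmann weight l (P l)" if "l \<ge> 1" for l
    unfolding boltzmann_def using supp[OF that] tree_mass_pos[of l] pmf_map_weight[OF that] by blast
  ultimately show ?thesis using weight_nonneg by blast
qed

end
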